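(* The following hold. (1) For every integer $k\ge4$ and all sufficiently large $n$ (depending on $k$), $\mathrm{exco}_2(n,P_3^k)=\binom{n-1}{k-1}\bigl(1+(n-k+1)(k-1)\bigr)$. (2) For every integer $k\ge3$ and all sufficiently large $n$ (depending on $k$), $\mathrm{exco}_2(n,C_3^k)=\binom{n-1}{k-1}\bigl(1+(n-k+1)(k-1)\bigr)$. (3) For every integer $k\ge3$ and all $n\ge2k$, $\mathrm{exco}_2(n,\mathcal{P}_3^k)=\binom{n-1}{k-1}\bigl(1+(n-k+1)(k-1)\bigr)$. (4) For every integer $k\ge3$ and all $n\ge\frac{3k}{2}$, $\mathrm{exco}_2(n,\mathcal{C}_3^k)=\binom{n-1}{k-1}\bigl(1+(n-k+1)(k-1)\bigr)$. In all cases, the only hypergraph (up to isomorphism) attaining the maximum is $\{F\in\binom{[n]}{k}:1\in F\}$.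
   Context: $[n]=\{1,\dots,n\}$ and $\binom{[n]}{k}$ is the family of $k$-element subsets of $[n]$. For a $k$-uniform hypergraph $\mathcal{H}\subset\binom{[n]}{k}$ and $E\subseteq[n]$, $d(E)$ is the number of edges of $\mathcal{H}$ containing $E$, and $\mathrm{co}_2(\mathcal{H})=\sum_{E\in\binom{[n]}{k-1}}d(E)^2$. For a $k$-uniform hypergraph, or family of $k$-uniform hypergraphs, $\mathscr{F}$, $\mathrm{exco}_2(n,\mathscr{F})$ is the maximum of $\mathrm{co}_2(\mathcal{H})$ over all $k$-uniform hypergraphs $\mathcal{H}$ on $n$ vertices containing no copy of (any member of) $\mathscr{F}$ as a not necessarily induced subhypergraph. A Berge $s$-cycle is a $k$-uniform hypergraph with $s$ edges $E_1,\dots,E_s$ such that there are $s$ distinct vertices $v_1,\dots,v_s$ with $v_i\in E_i\cap E_{i+1}$ for $1\le i\le s-1$ and $v_s\in E_s\cap E_1$. A minimal $s$-cycle is a Berge $s$-cycle with edges $E_1,\dots,E_s$ such that, for $i\ne j$, $E_i\cap E_j\ne\emptyset$ if and only if $|j-i|=1$ or $\{i,j\}=\{1,s\}$, and no vertex belongs to all of $E_1,\dots,E_s$. The linear $s$-cycle $C_s^k$ is the $k$-uniform Berge $s$-cycle with edges $E_1,\dots,E_s$ such that, for $i\ne j$, $|E_i\cap E_j|=1$ if $|j-i|=1$ or $\{i,j\}=\{1,s\}$, and $|E_i\cap E_j|=0$ otherwise. $\mathcal{C}_s^k$ is the family of all $k$-uniform minimal $s$-cycles. A minimal (resp. linear)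 $s$-path is a hypergraph with $s$ edges obtained from a minimal (resp. linear) $(s+1)$-cycle by deleting one of its edges; thus its edges can be ordered $E_1,\dots,E_s$ so that, for $i\neq j$, $E_i\cap E_j\ne\emptyset$ if and only if $|i-j|=1$ (and, in the linear case, $|E_i\cap E_{i+1}|=1$). $\mathcal{P}_s^k$ is the family of all $k$-uniform minimal $s$-paths and $P_s^k$ is the $k$-uniform linear $s$-path.
   Formalization: In (3), uniqueness of the extremal hypergraph is claimed only for n > 2k, since at n = 2k the complete k-uniform hypergraph on 2k-1 vertices also attains the maximum; the value, and that the star attains it, are kept for all n ≥ 2k. *)

theory Defs
  imports Complex_Main "HOL-Library.Ramsey"
begin

text \<open>A hypergraph is identified with its set of edges. The library's \<^term>\<open>nsets A k\<close> is the
  family of \<open>k\<close>-element subsets of \<open>A\<close>, so a \<open>k\<close>-uniform hypergraph on the vertex set \<open>[n]\<close> is a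
  subset of \<^term>\<open>nsets {1..n} k\<close>.\<close>

definition degree :: "'a set set \<Rightarrow> 'a set \<Rightarrow> nat" where
  "degree H E = card {F \<in> H. E \<subseteq> F}"

definition co2 :: "nat \<Rightarrow> nat \<Rightarrow> nat set set \<Rightarrow> nat" where
  "co2 n k H = (\<Sum>E\<in>nsets {1..n} (k - 1). (degree H E)\<^sup>2)"

definition contains_copy :: "'a set set \<Rightarrow> 'b set set \<Rightarrow> bool" where
  "contains_copy H G \<longleftrightarrow> (\<exists>f. inj_on f (\<Union>G) \<and> (\<lambda>E. f ` E) ` G \<subseteq> H)"

definition free_hypergraphs :: "nat \<Rightarrow> nat \<Rightarrow> nat set set set \<Rightarrow> nat set set set" where
  "free_hypergraphs n k \<F> = {H. H \<subseteq> nsets {1..n} k \<and> (\<forall>G\<in>\<F>. \<not> contains_copy H G)}"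

definition exco2 :: "nat \<Rightarrow> nat \<Rightarrow> nat set set set \<Rightarrow> nat" where
  "exco2 n k \<F> = Max (co2 n k ` free_hypergraphs n k \<F>)"

definition extremal :: "nat \<Rightarrow> nat \<Rightarrow> nat set set set \<Rightarrow> nat set set \<Rightarrow> bool" where
  "extremal n k \<F> H \<longleftrightarrow> H \<in> free_hypergraphs n k \<F> \<and> co2 n k H = exco2 n k \<F>"

definition isomorphic_on :: "nat \<Rightarrow> nat set set \<Rightarrow> nat set set \<Rightarrow> bool" where
  "isomorphic_on n H G \<longleftrightarrow> (\<exists>f. bij_betw f {1..n} {1..n} \<and> H = (\<lambda>E. f ` E) ` G)"

definition star :: "nat \<Rightarrow> nat \<Rightarrow> nat set set" where
  "star n k = {F \<in> nsets {1..n} k. 1 \<in> F}"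

text \<open>Cycles are given by an enumeration \<open>E 1, \<dots>, E s\<close> of their (distinct) edges. Vertices are taken
  in \<^typ>\<open>nat\<close>, which contains a copy of every finite hypergraph.\<close>

definition Berge_cycle :: "nat \<Rightarrow> nat \<Rightarrow> (nat \<Rightarrow> nat set) \<Rightarrow> bool" where
  "Berge_cycle k s E \<longleftrightarrow>
     (\<forall>i\<in>{1..s}. E i \<in> nsets UNIV k) \<and> inj_on E {1..s} \<and>
     (\<exists>v. inj_on v {1..s} \<and> (\<forall>i\<in>{1..<s}. v i \<in> E i \<inter> E (i + 1)) \<and> v s \<in> E s \<inter> E 1)"

definition cyclically_adjacent :: "nat \<Rightarrow> nat \<Rightarrow> nat \<Rightarrow> bool" where
  "cyclically_adjacent s i j \<longleftrightarrow> \<bar>int j - int i\<bar> = 1 \<or> {i, j} = {1, s}"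

definition minimal_cycles :: "nat \<Rightarrow> nat \<Rightarrow> nat set set set" where
  "minimal_cycles k s = {E ` {1..s} | E. Berge_cycle k s E \<and>
     (\<forall>i\<in>{1..s}. \<forall>j\<in>{1..s}. i \<noteq> j \<longrightarrow> (E i \<inter> E j \<noteq> {} \<longleftrightarrow> cyclically_adjacent s i j)) \<and>
     (\<Inter>i\<in>{1..s}. E i) = {}}"

text \<open>The linear \<open>s\<close>-cycle is determined only up to isomorphism. It is represented by the set of
  all its realisations with vertices in \<^typ>\<open>nat\<close>; avoiding every one of them is the same as
  avoiding a single one. The same applies to linear paths.\<close>

definition linear_cycles :: "nat \<Rightarrow> nat \<Rightarrow> nat set set set" where
  "linear_cycles k s = {E ` {1..s} | E. Berge_cycle k s E \<and>
     (\<forall>i\<in>{1..s}. \<forall>j\<in>{1..s}. i \<noteq> j \<longrightarrow>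
        card (E i \<inter> E j) = (if cyclically_adjacent s i j then 1 else 0))}"

definition minimal_paths :: "nat \<Rightarrow> nat \<Rightarrow> nat set set set" where
  "minimal_paths k s = {C - {E} | C E. C \<in> minimal_cycles k (s + 1) \<and> E \<in> C}"

definition linear_paths :: "nat \<Rightarrow> nat \<Rightarrow> nat set set set" where
  "linear_paths k s = {C - {E} | C E. C \<in> linear_cycles k (s + 1) \<and> E \<in> C}"

lemma co2_clique:
  assumes "k \<ge> 1"
  shows "co2 (2 * k) k (nsets {2..2 * k} k) = (2 * k - 1 choose (k - 1)) * k\<^sup>2"
proof -
  let ?V = "{2..2 * k}"
  have deg: "degree (nsets ?V k) E = (if E \<subseteq> ?V then k else 0)" if E: "E \<in> nsets {1..2 * k} (k - 1)" for E
  proof (cases "E \<subseteq> ?V")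
    case True
    have fE: "finite E" and cE: "card E = k - 1" using E by (auto simp: nsets_def)
    have "{F \<in> nsets ?V k. E \<subseteq> F} = (\<lambda>x. insert x E) ` (?V - E)"
    proof (intro equalityI subsetI)
      fix F assume F: "F \<in> {F \<in> nsets ?V k. E \<subseteq> F}"
      then have "finite F" "card F = k" "F \<subseteq> ?V" "E \<subseteq> F" by (auto simp: nsets_def)
      then have "card (F - E) = 1" using fE cE assms by (simp add: card_Diff_subset)
      then obtain x where "F - E = {x}" by (auto simp: card_1_singleton_iff)
      then show "F \<in> (\<lambda>x. insert x E) ` (?V - E)" using \<open>E \<subseteq> F\<close> \<open>F \<subseteq> ?V\<close> by blast
    next
      fix F assume "F \<in> (\<lambda>x. insert x E) ` (?V - E)"
      then obtain x where "x \<in> ?V" "x \<notin> E" "F = insert x E" by blast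
      then show "F \<in> {F \<in> nsets ?V k. E \<subseteq> F}" using fE cE True assms by (auto simp: nsets_def)
    qed
    moreover have "inj_on (\<lambda>x. insert x E) (?V - E)" by (auto simp: inj_on_def)
    moreover have "card (?V - E) = k" using fE cE True assms by (simp add: card_Diff_subset)
    ultimately show ?thesis using True by (simp add: degree_def card_image)
  next
    case False
    then have "{F \<in> nsets ?V k. E \<subseteq> F} = {}" unfolding nsets_def by blast
    then have "degree (nsets ?V k) E = 0" unfolding degree_def by (simp only: card.empty)
    then show ?thesis using False by simp
  qed
  have sub: "nsets ?V (k - 1) \<subseteq> nsets {1..2 * k} (k - 1)" by (rule nsets_mono) auto
  have "co2 (2 * k) k (nsets ?V k) = (\<Sum>E\<in>nsets ?V (k - 1). k\<^sup>2)"
    unfolding co2_def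
  proof (rule sum.mono_neutral_cong_right)
    show "\<forall>E\<in>nsets {1..2 * k} (k - 1) - nsets ?V (k - 1). (degree (nsets ?V k) E)\<^sup>2 = 0"
    proof
      fix E assume E: "E \<in> nsets {1..2 * k} (k - 1) - nsets ?V (k - 1)"
      then have "\<not> E \<subseteq> ?V" unfolding nsets_def by blast
      then show "(degree (nsets ?V k) E)\<^sup>2 = 0" using deg[of E] E by simp
    qed
    show "(degree (nsets ?V k) E)\<^sup>2 = k\<^sup>2" if E: "E \<in> nsets ?V (k - 1)" for E
    proof -
      have "E \<subseteq> ?V" using E unfolding nsets_def by blast
      moreover have "E \<in> nsets {1..2 * k} (k - 1)" using E sub by blast
      ultimately show ?thesis using deg[of E] by simp
    qed
    show "finite (nsets {1..2 * k} (k - 1))" by (rule finite_imp_finite_nsets) simp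
  qed (rule sub)
  then show ?thesis by simp
qed

text \<open>For \<open>n = 2k\<close> the star is not the only extremal hypergraph for minimal 3-paths: the complete
  \<open>k\<close>-uniform hypergraph on \<open>2k - 1\<close> of the vertices is a second one.\<close>

lemma minimal_path_counterexample:
  assumes "k \<ge> 3"
  defines "H \<equiv> nsets {2..2 * k} k"
  shows "H \<in> free_hypergraphs (2 * k) k (minimal_paths k 3)"
    and "co2 (2 * k) k H = (2 * k - 1 choose (k - 1)) * (1 + (2 * k - k + 1) * (k - 1))"
    and "\<not> isomorphic_on (2 * k) H (star (2 * k) k)"
proof -
  have inter: "A \<inter> B \<noteq> {}" if "A \<in> H" "B \<in> H" for A B
  proof
    assume "A \<inter> B = {}"
    then have "card (A \<union> B) = 2 * k" using that by (simp add: H_def nsets_def card_Un_disjoint)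
    moreover have "card (A \<union> B) \<le> card {2..2 * k}"
      by (rule card_mono) (use that in \<open>auto simp: H_def nsets_def\<close>)
    ultimately show False using assms by simp
  qed
  have "\<not> contains_copy H G" if "G \<in> minimal_paths k 3" for G
  proof
    assume "contains_copy H G"
    then obtain f where f: "inj_on f (\<Union>G)" "(\<lambda>E. f ` E) ` G \<subseteq> H" unfolding contains_copy_def by blast
    have "\<exists>C D. G = C - {D} \<and> C \<in> minimal_cycles k 4 \<and> D \<in> C"
      using that by (simp add: minimal_paths_def)
    then obtain C D where G: "G = C - {D}" "C \<in> minimal_cycles k 4" "D \<in> C" by blast
    then obtain E where E: "C = E ` {1..4}" "inj_on E {1..4}"
      "\<forall>i\<in>{1..4}. \<forall>j\<in>{1..4}. i \<noteq> j \<longrightarrow> (E i \<inter> E j \<noteq> {} \<longleftrightarrow> cyclically_adjacent 4 i j)"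
      unfolding minimal_cycles_def Berge_cycle_def by (simp only: mem_Collect_eq) blast
    have d: "E 1 \<inter> E 3 = {}" "E 2 \<inter> E 4 = {}"
      using E(3)[rule_format, of 1 3] E(3)[rule_format, of 2 4] by (auto simp: cyclically_adjacent_def doubleton_eq_iff)
    obtain m where m: "m \<in> {1..4}" "D = E m" using G E by blast
    have mem: "E i \<in> G" if "i \<in> {1..4}" "i \<noteq> m" for i
    proof -
      have "E i \<noteq> D" using inj_onD[OF E(2), of i m] that m by metis
      then show ?thesis using that(1) G(1) E(1) by blast
    qed
    have "m \<noteq> 1 \<and> m \<noteq> 3 \<or> m \<noteq> 2 \<and> m \<noteq> 4" by auto
    then have "\<exists>A\<in>G. \<exists>B\<in>G. A \<inter> B = {}"
    proof
      assume "m \<noteq> 1 \<and> m \<noteq> 3"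
      then have "E 1 \<in> G" "E 3 \<in> G" using mem[of 1] mem[of 3] by simp_all
      then show ?thesis using d(1) by blast
    next
      assume "m \<noteq> 2 \<and> m \<noteq> 4"
      then have "E 2 \<in> G" "E 4 \<in> G" using mem[of 2] mem[of 4] by simp_all
      then show ?thesis using d(2) by blast
    qed
    then obtain A B where AB: "A \<in> G" "B \<in> G" "A \<inter> B = {}" by blast
    then have "f ` A \<inter> f ` B = f ` (A \<inter> B)" using inj_on_image_Int[OF f(1), of A B] by blast
    then show False using inter[of "f ` A" "f ` B"] AB f(2) by (metis image_empty image_subset_iff)
  qed
  moreover have "H \<subseteq> nsets {1..2 * k} k" unfolding H_def by (rule nsets_mono) auto
  ultimately show "H \<in> free_hypergraphs (2 * k) k (minimal_paths k 3)" by (simp add: free_hypergraphs_def)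
  obtain j where "k = Suc j" using assms by (cases k) auto
  then show "co2 (2 * k) k H = (2 * k - 1 choose (k - 1)) * (1 + (2 * k - k + 1) * (k - 1))"
    using co2_clique[of k] by (simp add: H_def power2_eq_square algebra_simps)
  show "\<not> isomorphic_on (2 * k) H (star (2 * k) k)"
  proof
    assume "isomorphic_on (2 * k) H (star (2 * k) k)"
    then obtain f where f: "H = (\<lambda>E. f ` E) ` star (2 * k) k" unfolding isomorphic_on_def by blast
    have "k \<le> card ({2..2 * k} - {f 1})" using assms(1) by (simp add: card_Diff_singleton_if) linarith
    then obtain F where F: "F \<subseteq> {2..2 * k} - {f 1}" "card F = k" "finite F"
      using obtain_subset_with_card_n by blast
    then have "F \<in> H" unfolding H_def nsets_def by blast
    then obtain E where "E \<in> star (2 * k) k" "F = f ` E" using f by blast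
    then have "f 1 \<in> F" unfolding star_def by blast
    then show False using F by blast
  qed
qed

end

theory Submission
  imports Defs "HOL-Combinatorics.Permutations" "HOL-Number_Theory.Cong"
begin

text \<open>
  An eigenvalue computation for the up and down operators shows that a hypergraph with at most
  \<open>N = (n - 1 choose (k - 1))\<close> edges has degree square sum at most that of the star, with equality only
  for stars (and for the complement of a star if \<open>n = 2k\<close>). It remains to show that a hypergraph
  without the forbidden configuration has at most \<open>N\<close> edges or a smaller degree square sum than the star.

  For minimal paths, meeting is an equivalence relation on the edges and the theorem of
  Erdos, Ko and Rado is applied to its classes. For minimal cycles with \<open>n < 2k\<close> all edges meet,
  hence any three of them have a common vertex, and Frankl's theorem applies; for \<open>n \<ge> 2k\<close> the links of
  all vertices are bounded in such a way that summation excludes more than \<open>N\<close> edges together with a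
  large degree square sum.

  For the linear configurations, call a set flexible if it lies in edges that avoid any given bounded
  set of further vertices. All but \<open>O(n ^ (k - 2))\<close> edges have so many flexible subsets that
  the forbidden configuration makes them behave like the edges of a star: they have a centre, and the rest
  of the edge lies in no other edge. A large degree square sum forces a common centre \<open>c\<close> for which
  all but a bounded number of pairs \<open>{c, v}\<close> are flexible. An edge missing \<open>c\<close> then excludes more edges
  through \<open>c\<close> than there are edges missing \<open>c\<close>.
\<close>

section \<open>A bound on the degree square sum by the number of edges\<close>

text \<open>The bound for the degree square sum increases with the number of edges and takes the
  value of the star exactly at \<open>N\<close> edges. So an edge bound may be proved under the
  extra assumption that the degree square sum is at least that of the star. This assumption replaces
  the full Turan theorems for triangles and linear configurations: the degree square sum is a sum of
  edge weights, an edge with a facet in no other edge weighs at most as much as an edge of a star,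
  and a large total forces almost all edges to be close to this maximum. Small \<open>k\<close>
  shapes the linear case. For \<open>k = 4\<close> an edge of a hypergraph without linear triangles
  may have flexible subsets and yet no centre; such edges weigh about \<open>2 * n\<close> instead
  of \<open>3 * n\<close> and are therefore few. For \<open>k = 3\<close> the flexible subsets no
  longer determine a centre. Moreover, the edges missing the centre and the edges they exclude then
  both have linear order, so that counting alone decides nothing; weights are compared instead,
  about \<open>n\<close> for an edge missing the centre against \<open>2 * n\<close> for an edge
  through it.\<close>

definition up_sum :: "'a set \<Rightarrow> ('a set \<Rightarrow> real) \<Rightarrow> 'a set \<Rightarrow> real" where
  "up_sum V f E = (\<Sum>x\<in>V - E. f (insert x E))"

definition down_sum :: "('a set \<Rightarrow> real) \<Rightarrow> 'a set \<Rightarrow> real" where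
  "down_sum g A = (\<Sum>x\<in>A. g (A - {x}))"

lemma nsets_insertI: "E \<in> nsets V j \<Longrightarrow> x \<in> V - E \<Longrightarrow> insert x E \<in> nsets V (Suc j)"
  by (auto simp: nsets_def)

lemma nsets_removeI: "A \<in> nsets V (Suc j) \<Longrightarrow> x \<in> A \<Longrightarrow> A - {x} \<in> nsets V j"
  by (auto simp: nsets_def)

lemma sum_flags:
  assumes "finite V"
  shows "(\<Sum>E\<in>nsets V j. \<Sum>x\<in>V - E. h E x (insert x E)) =
    (\<Sum>A\<in>nsets V (Suc j). \<Sum>x\<in>A. h (A - {x}) x A)" (is "?l = ?r")
proof -
  have fin: "finite (nsets V i)" for i using assms by (rule finite_imp_finite_nsets)
  have "?l = (\<Sum>(E, x)\<in>Sigma (nsets V j) (\<lambda>E. V - E). h E x (insert x E))"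
    using fin assms by (subst sum.Sigma) auto
  also have "\<dots> = (\<Sum>(A, x)\<in>Sigma (nsets V (Suc j)) (\<lambda>A. A). h (A - {x}) x A)"
    by (rule sum.reindex_bij_witness[of _ "\<lambda>(A, x). (A - {x}, x)" "\<lambda>(E, x). (insert x E, x)"])
      (auto simp: nsets_def insert_absorb)
  also have "\<dots> = ?r"
    using fin by (subst sum.Sigma) (auto simp: nsets_def)
  finally show ?thesis .
qed

lemma up_down_adjoint:
  assumes "finite V"
  shows "(\<Sum>E\<in>nsets V j. up_sum V f E * g E) = (\<Sum>A\<in>nsets V (Suc j). f A * down_sum g A)"
  using sum_flags[OF assms, of "\<lambda>E x A. f A * g E" j]
  by (simp add: up_sum_def down_sum_def sum_distrib_left sum_distrib_right)

lemma sum_up_sum: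
  assumes "finite V"
  shows "(\<Sum>E\<in>nsets V j. up_sum V f E) = real (Suc j) * (\<Sum>A\<in>nsets V (Suc j). f A)"
proof -
  have "(\<Sum>E\<in>nsets V j. up_sum V f E) = (\<Sum>A\<in>nsets V (Suc j). \<Sum>x\<in>A. f A)"
    using sum_flags[OF assms, of "\<lambda>E x A. f A" j] by (simp add: up_sum_def)
  also have "\<dots> = (\<Sum>A\<in>nsets V (Suc j). real (Suc j) * f A)"
    by (rule sum.cong) (auto simp: nsets_def)
  finally show ?thesis by (simp add: sum_distrib_left)
qed

text \<open>Both composites consist of the exchanges of one vertex of \<open>E\<close> for one
  outside, and these agree. They differ only in how often \<open>E\<close> itself comes back:
  \<open>card V - Suc j\<close> times on the left, \<open>Suc j\<close> times on the right.\<close>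

lemma up_down_commute:
  assumes "finite V" and E: "E \<in> nsets V (Suc j)"
  shows "up_sum V (down_sum g) E =
    down_sum (up_sum V g) E + (real (card V) - 2 * real (Suc j)) * g E"
proof -
  have fE: "finite E" "E \<subseteq> V" and cE: "card E = Suc j" using E by (auto simp: nsets_def)
  have cVE: "card (V - E) = card V - Suc j" "Suc j \<le> card V"
    using fE cE assms card_mono[of V E] by (auto simp: card_Diff_subset)
  let ?S = "\<Sum>x\<in>V - E. \<Sum>y\<in>E. g (insert x (E - {y}))"
  have "up_sum V (down_sum g) E = (\<Sum>x\<in>V - E. g E + (\<Sum>y\<in>E. g (insert x (E - {y}))))"
    unfolding up_sum_def down_sum_def
  proof (rule sum.cong)
    fix x assume x: "x \<in> V - E"
    have "(\<Sum>y\<in>E. g (insert x E - {y})) = (\<Sum>y\<in>E. g (insert x (E - {y})))"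
      using x by (intro sum.cong refl arg_cong[of _ _ g]) auto
    moreover have "insert x E - {x} = E" using x by auto
    ultimately show "(\<Sum>y\<in>insert x E. g (insert x E - {y})) = g E + (\<Sum>y\<in>E. g (insert x (E - {y})))"
      using x fE by (simp)
  qed simp
  also have "\<dots> = (real (card V) - real (Suc j)) * g E + ?S"
    using cVE by (simp add: sum.distrib of_nat_diff)
  finally have 1: "up_sum V (down_sum g) E = (real (card V) - real (Suc j)) * g E + ?S" .
  have "down_sum (up_sum V g) E = (\<Sum>y\<in>E. g E + (\<Sum>x\<in>V - E. g (insert x (E - {y}))))"
    unfolding up_sum_def down_sum_def
  proof (rule sum.cong)
    fix y assume y: "y \<in> E"
    have "V - (E - {y}) = insert y (V - E)" using y fE by auto
    then show "(\<Sum>x\<in>V - (E - {y}). g (insert x (E - {y}))) = g E + (\<Sum>x\<in>V - E. g (insert x (E - {y})))"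
      using y assms by (simp add: insert_absorb)
  qed simp
  also have "\<dots> = real (Suc j) * g E + (\<Sum>y\<in>E. \<Sum>x\<in>V - E. g (insert x (E - {y})))"
    using cE by (simp add: sum.distrib)
  also have "(\<Sum>y\<in>E. \<Sum>x\<in>V - E. g (insert x (E - {y}))) = ?S" by (rule sum.swap)
  finally show ?thesis using 1 by (simp add: algebra_simps)
qed

text \<open>The constant is the second eigenvalue of the Johnson scheme: sum zero excludes the
  constant functions, and the next eigenfunctions have degree one, whence the equality case. Instead
  of decomposing into eigenspaces, the commutation relation carries the bound from one level to the
  next.\<close>

lemma spectral_bound:
  fixes f :: "'a set \<Rightarrow> real"
  assumes V: "finite V" and "Suc j < card V" and "(\<Sum>A\<in>nsets V (Suc j). f A) = 0"
  shows "(\<Sum>E\<in>nsets V j. (up_sum V f E)\<^sup>2) \<le>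
      real j * (real (card V) - real (Suc j)) * (\<Sum>A\<in>nsets V (Suc j). (f A)\<^sup>2) \<and>
    ((\<Sum>E\<in>nsets V j. (up_sum V f E)\<^sup>2) =
      real j * (real (card V) - real (Suc j)) * (\<Sum>A\<in>nsets V (Suc j). (f A)\<^sup>2) \<longrightarrow>
      (\<exists>l. \<forall>A\<in>nsets V (Suc j). f A = (\<Sum>x\<in>A. l x)))"
  using assms(2,3)
proof (induction j arbitrary: f)
  case 0
  have 1: "nsets V (Suc 0) = (\<lambda>x. {x}) ` V"
    by (auto simp: nsets_def card_1_singleton_iff)
  have "(\<Sum>x\<in>V. f {x}) = 0"
    using 0 by (simp add: 1 sum.reindex)
  moreover have "nsets V 0 = {{}}" by (auto simp: nsets_def)
  moreover have "\<exists>l. \<forall>A\<in>nsets V (Suc 0). f A = (\<Sum>x\<in>A. l x)"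
    by (rule exI[of _ "\<lambda>x. f {x}"]) (auto simp: 1)
  ultimately show ?case by (simp add: up_sum_def)
next
  case (Suc j)
  define n where "n = real (card V)"
  define c where "c = real (Suc j) * (n - real (Suc (Suc j)))"
  have c: "c > 0" unfolding c_def n_def using Suc.prems by simp
  define g where "g = up_sum V f"
  define u where "u = down_sum g"
  let ?K = "nsets V (Suc (Suc j))" and ?J = "nsets V (Suc j)" and ?I = "nsets V j"
  define ff gg where "ff = (\<Sum>A\<in>?K. (f A)\<^sup>2)" and "gg = (\<Sum>A\<in>?J. (g A)\<^sup>2)"
  define uu where "uu = (\<Sum>A\<in>?K. (u A)\<^sup>2)"
  define hh where "hh = (\<Sum>A\<in>?I. (up_sum V g A)\<^sup>2)"
  have g0: "(\<Sum>A\<in>?J. g A) = 0"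
    unfolding g_def using sum_up_sum[OF V, of f "Suc j"] Suc.prems by simp
  have IH: "hh \<le> real j * (n - real (Suc j)) * gg"
    "hh = real j * (n - real (Suc j)) * gg \<Longrightarrow> \<exists>l. \<forall>A\<in>?J. g A = (\<Sum>x\<in>A. l x)"
    using Suc.IH[OF _ g0] Suc.prems unfolding hh_def gg_def n_def by auto
  have fu: "(\<Sum>A\<in>?K. f A * u A) = gg"
    using up_down_adjoint[OF V, of f g "Suc j"] unfolding g_def u_def gg_def
    by (simp add: power2_eq_square)
  have "uu = (\<Sum>E\<in>?J. up_sum V u E * g E)"
    using up_down_adjoint[OF V, of u g "Suc j"] unfolding u_def uu_def by (simp add: power2_eq_square)
  also have "\<dots> = (\<Sum>E\<in>?J. g E * down_sum (up_sum V g) E + (n - 2 * real (Suc j)) * (g E)\<^sup>2)"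
    by (rule sum.cong) (simp_all add: u_def up_down_commute[OF V] n_def algebra_simps power2_eq_square)
  also have "\<dots> = (\<Sum>E\<in>?J. g E * down_sum (up_sum V g) E) + (n - 2 * real (Suc j)) * gg"
    by (simp add: sum.distrib sum_distrib_left gg_def)
  also have "(\<Sum>E\<in>?J. g E * down_sum (up_sum V g) E) = hh"
    using up_down_adjoint[OF V, of g "up_sum V g" j] unfolding hh_def by (simp add: power2_eq_square)
  finally have uu: "uu = hh + (n - 2 * real (Suc j)) * gg" .
  have cc: "real j * (n - real (Suc j)) + (n - 2 * real (Suc j)) = c"
    unfolding c_def by (simp add: algebra_simps)
  have "uu \<le> (real j * (n - real (Suc j)) + (n - 2 * real (Suc j))) * gg"
    using IH(1) uu by (simp add: distrib_right)
  then have uc: "uu \<le> c * gg" by (simp only: cc)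
  \<comment> \<open>Cauchy-Schwarz written as a nonnegative square, because its vanishing in the
    equality case identifies \<open>f\<close> with \<open>u / c\<close>.\<close>
  have sq: "(\<Sum>A\<in>?K. (u A - c * f A)\<^sup>2) = uu - 2 * c * gg + c\<^sup>2 * ff"
  proof -
    have "(\<Sum>A\<in>?K. (u A - c * f A)\<^sup>2) = (\<Sum>A\<in>?K. (u A)\<^sup>2 - 2 * c * (f A * u A) + c\<^sup>2 * (f A)\<^sup>2)"
      by (rule sum.cong) (simp_all add: power2_eq_square algebra_simps)
    then show ?thesis by (simp add: sum.distrib sum_subtractf sum_distrib_left[symmetric] fu uu_def ff_def)
  qed
  have nn: "0 \<le> (\<Sum>A\<in>?K. (u A - c * f A)\<^sup>2)" by (rule sum_nonneg) simp
  have "0 \<le> c * (c * ff - gg)" using sq nn uc by (simp add: power2_eq_square algebra_simps)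
  then have le: "gg \<le> c * ff" using c by (simp add: zero_le_mult_iff)
  have eq: "\<exists>l. \<forall>A\<in>?K. f A = (\<Sum>x\<in>A. l x)" if "gg = c * ff"
  proof -
    have "(\<Sum>A\<in>?K. (u A - c * f A)\<^sup>2) = uu - c * gg" using sq that by (simp add: power2_eq_square)
    then have z: "(\<Sum>A\<in>?K. (u A - c * f A)\<^sup>2) = 0" and "uu = c * gg" using nn uc by auto
    then have "hh = (c - (n - 2 * real (Suc j))) * gg" using uu by (simp add: left_diff_distrib)
    moreover have "c - (n - 2 * real (Suc j)) = real j * (n - real (Suc j))" using cc by linarith
    ultimately have "hh = real j * (n - real (Suc j)) * gg" by (simp only:)
    then obtain l where l: "\<forall>A\<in>?J. g A = (\<Sum>x\<in>A. l x)" using IH(2) by blast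
    \<comment> \<open>\<open>u\<close> sums the degree one function \<open>g\<close> over the facets
      of \<open>A\<close>; each \<open>l x\<close> occurs in all facets but one, that is
      \<open>Suc j\<close> times.\<close>
    have "f A = (\<Sum>x\<in>A. real (Suc j) / c * l x)" if A: "A \<in> ?K" for A
    proof -
      have fA: "finite A" "card A = Suc (Suc j)" using A by (auto simp: nsets_def)
      have "u A = c * f A"
        using z A V by (simp add: sum_nonneg_eq_0_iff finite_imp_finite_nsets)
      moreover have "u A = (\<Sum>y\<in>A. (\<Sum>x\<in>A. l x) - l y)"
        unfolding u_def down_sum_def
        using l nsets_removeI[OF A] fA by (intro sum.cong) (simp_all add: sum_diff1)
      then have "u A = real (Suc j) * (\<Sum>x\<in>A. l x)"
        using fA by (simp add: sum_subtractf algebra_simps)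
      ultimately have "f A = real (Suc j) / c * (\<Sum>x\<in>A. l x)" using c by (simp add: field_simps)
      then show ?thesis by (simp add: sum_distrib_left)
    qed
    then show ?thesis by blast
  qed
  show ?case using le eq unfolding gg_def ff_def c_def g_def n_def by blast
qed


section \<open>From the eigenvalue bound to the degree square sum\<close>

lemma card_nsets: "finite V \<Longrightarrow> card (nsets V k) = card V choose k"
  using n_subsets[of V k] unfolding nsets_def
  by (metis (no_types, lifting) Collect_cong finite_subset)

lemma nsets_obtain:
  assumes "k \<le> card V" "finite V"
  obtains B where "B \<in> nsets V k"
  using obtain_subset_with_card_n[OF assms(1)] unfolding nsets_def by blast

lemma degree_up_sum:
  assumes "finite V" "H \<subseteq> nsets V (Suc j)" "E \<in> nsets V j"
  shows "real (degree H E) = up_sum V (\<lambda>A. if A \<in> H then 1 else 0) E"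
proof -
  have "{F \<in> H. E \<subseteq> F} = (\<lambda>x. insert x E) ` {x \<in> V - E. insert x E \<in> H}"
  proof (intro equalityI subsetI)
    fix F assume F: "F \<in> {F \<in> H. E \<subseteq> F}"
    then have *: "finite F" "card F = Suc j" "F \<subseteq> V" "E \<subseteq> F" "finite E" "card E = j" using assms by (auto simp: nsets_def)
    then have "card (F - E) = 1" by (simp add: card_Diff_subset)
    then obtain x where "F - E = {x}" by (auto simp: card_1_singleton_iff)
    then have "F = insert x E" "x \<in> V - E" using * by auto
    then show "F \<in> (\<lambda>x. insert x E) ` {x \<in> V - E. insert x E \<in> H}" using F by auto
  qed auto
  moreover have "inj_on (\<lambda>x. insert x E) {x \<in> V - E. insert x E \<in> H}" by (auto simp: inj_on_def)
  ultimately have "degree H E = card {x \<in> V - E. insert x E \<in> H}"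
    by (simp add: degree_def card_image)
  also have "real \<dots> = (\<Sum>x\<in>V - E. if insert x E \<in> H then 1 else 0)"
    using assms(1) by (simp add: sum.If_cases Int_def)
  finally show ?thesis by (simp add: up_sum_def)
qed

text \<open>Degrees are values of \<open>up_sum\<close> at the indicator of \<open>H\<close>.
  Subtracting the density \<open>e / C\<close> leaves a function of sum zero, to which
  \<open>spectral_bound\<close> applies; the constant part is responsible for the term quadratic in
  \<open>e\<close>.\<close>

lemma co2_bound:
  assumes "Suc j < n" and H: "H \<subseteq> nsets {1..n} (Suc j)"
  defines "e \<equiv> real (card H)" and "C \<equiv> real (n choose Suc j)"
  shows "real (co2 n (Suc j) H) \<le> real j * (real n - real (Suc j)) * e + real n * e\<^sup>2 / C \<and>
    (real (co2 n (Suc j) H) = real j * (real n - real (Suc j)) * e + real n * e\<^sup>2 / C \<longrightarrow>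
      (\<exists>l. \<forall>A\<in>nsets {1..n} (Suc j). (if A \<in> H then 1 else 0) - e / C = (\<Sum>x\<in>A. l x)))"
proof -
  let ?V = "{1..n}" and ?K = "nsets {1..n} (Suc j)" and ?J = "nsets {1..n} j"
  define g :: "nat set \<Rightarrow> real" where "g = (\<lambda>A. if A \<in> H then 1 else 0)"
  define m where "m = e / C"
  define f where "f = (\<lambda>A. g A - m)"
  have C: "C > 0" "card ?K = n choose Suc j" using assms by (auto simp: C_def card_nsets)
  have finK: "finite ?K" by (simp add: finite_imp_finite_nsets)
  have g1: "(\<Sum>A\<in>?K. g A) = e"
    using finK H by (simp add: g_def e_def sum.If_cases Int_absorb1)
  have g2: "(\<Sum>A\<in>?K. (g A)\<^sup>2) = e"
  proof -
    have "(\<Sum>A\<in>?K. (g A)\<^sup>2) = (\<Sum>A\<in>?K. g A)" by (rule sum.cong) (auto simp: g_def)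
    then show ?thesis using g1 by simp
  qed
  have f0: "(\<Sum>A\<in>?K. f A) = 0"
    using g1 C by (simp add: f_def sum_subtractf m_def C_def)
  have f2: "(\<Sum>A\<in>?K. (f A)\<^sup>2) = e - e\<^sup>2 / C"
  proof -
    have "(\<Sum>A\<in>?K. (f A)\<^sup>2) = (\<Sum>A\<in>?K. (g A)\<^sup>2 - 2 * m * g A + m\<^sup>2)"
      by (rule sum.cong) (auto simp: f_def power2_eq_square algebra_simps)
    also have "\<dots> = e - 2 * m * e + C * m\<^sup>2"
      unfolding sum.distrib sum_subtractf sum_distrib_left[symmetric] g1 g2 sum_constant C(2) C_def by simp
    also have "\<dots> = e - e\<^sup>2 / C" using C by (simp add: m_def power2_eq_square field_simps)
    finally show ?thesis .
  qed
  define d where "d = real n - real j"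
  have ug: "up_sum ?V g E = up_sum ?V f E + d * m" if "E \<in> ?J" for E
  proof -
    have "real (card (?V - E)) = d"
      using that assms(1) by (auto simp: nsets_def card_Diff_subset d_def)
    moreover have "up_sum ?V g E = (\<Sum>x\<in>?V - E. f (insert x E) + m)"
      by (simp add: up_sum_def f_def)
    ultimately show ?thesis by (simp add: up_sum_def sum.distrib)
  qed
  have su: "(\<Sum>E\<in>?J. up_sum ?V f E) = 0" using sum_up_sum[of ?V f j] f0 by simp
  have "real (co2 n (Suc j) H) = (\<Sum>E\<in>?J. (up_sum ?V g E)\<^sup>2)"
    unfolding co2_def g_def using degree_up_sum[of ?V H j] H by simp
  also have "\<dots> = (\<Sum>E\<in>?J. (up_sum ?V f E)\<^sup>2 + 2 * d * m * up_sum ?V f E + d\<^sup>2 * m\<^sup>2)"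
  proof (rule sum.cong[OF refl])
    fix E assume E: "E \<in> ?J"
    show "(up_sum ?V g E)\<^sup>2 = (up_sum ?V f E)\<^sup>2 + 2 * d * m * up_sum ?V f E + d\<^sup>2 * m\<^sup>2"
      unfolding ug[OF E] by (simp add: power2_eq_square algebra_simps)
  qed
  also have "\<dots> = (\<Sum>E\<in>?J. (up_sum ?V f E)\<^sup>2) + real (n choose j) * d\<^sup>2 * m\<^sup>2"
    unfolding sum.distrib sum_distrib_left[symmetric] su by (simp add: card_nsets)
  also have "real (n choose j) * d\<^sup>2 * m\<^sup>2 = d * real (Suc j) * e\<^sup>2 / C"
  proof -
    have "(n - j) * (n choose j) = Suc j * (n choose Suc j)"
      using binomial_absorb_comp[of n j] binomial_absorption[of j n] by simp
    then have "real ((n - j) * (n choose j)) = real (Suc j * (n choose Suc j))" by simp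
    then have "d * real (n choose j) = real (Suc j) * C"
      using assms(1) by (simp only: of_nat_mult C_def d_def of_nat_diff Suc_lessD less_imp_le_nat)
    then have "real (n choose j) * d\<^sup>2 * m\<^sup>2 = d * (real (Suc j) * C) * m\<^sup>2"
      by (simp add: power2_eq_square algebra_simps)
    then show ?thesis using C(1) by (simp add: m_def power2_eq_square field_simps)
  qed
  finally have co: "real (co2 n (Suc j) H) = (\<Sum>E\<in>?J. (up_sum ?V f E)\<^sup>2) + d * real (Suc j) * e\<^sup>2 / C" .
  have id: "real j * (real n - real (Suc j)) * (e - e\<^sup>2 / C) + d * real (Suc j) * e\<^sup>2 / C =
     real j * (real n - real (Suc j)) * e + real n * e\<^sup>2 / C"
    using C(1) by (simp add: d_def field_simps)
  show ?thesis
    using spectral_bound[of ?V j f] assms(1) f0 co id unfolding f2 by (auto simp: f_def g_def m_def)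
qed

section \<open>Degree one functions with two values, and the equality case\<close>

text \<open>Exchanging one vertex changes the sum by 0, 1 or -1, so \<open>l\<close> takes two
  neighbouring values. If both values occurred twice, exchanging two vertices at once would change
  the sum by 2. So one vertex is exceptional, and membership depends on it alone.
  \<open>k + 2 \<le> card V\<close> leaves room for the common part of the exchanged sets.\<close>

lemma degree_one_two_valued:
  fixes l :: "'a \<Rightarrow> real"
  assumes V: "finite V" and k: "2 \<le> k" "k + 2 \<le> card V" and H: "H \<subseteq> nsets V k" "H \<noteq> {}" "H \<noteq> nsets V k"
    and l: "\<And>A. A \<in> nsets V k \<Longrightarrow> (\<Sum>x\<in>A. l x) = (if A \<in> H then u else u - 1)"
  shows "\<exists>c\<in>V. H = {A \<in> nsets V k. c \<in> A} \<or> H = {A \<in> nsets V k. c \<notin> A}"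
proof -
  have ins: "insert x B \<in> nsets V k" if "B \<in> nsets (V - X) (k - 1)" "x \<in> X" "x \<in> V" for x B X
  proof -
    have "x \<notin> B" "finite B" "B \<subseteq> V" "card B = k - 1" using that by (auto simp: nsets_def)
    then show ?thesis using that k by (simp add: nsets_def)
  qed
  have diff1: "l x = l y \<or> l x = l y + 1 \<or> l y = l x + 1" if xy: "x \<in> V" "y \<in> V" "x \<noteq> y" for x y
  proof -
    have "k - 1 \<le> card (V - {x, y})" using V k xy by (simp add: card_Diff_subset)
    then obtain B where B: "B \<in> nsets (V - {x, y}) (k - 1)" using nsets_obtain V by (metis finite_Diff)
    have "finite B" "x \<notin> B" "y \<notin> B" using B by (auto simp: nsets_def)
    then show ?thesis
      using l[OF ins[OF B, of x]] l[OF ins[OF B, of y]] xy by (auto split: if_splits)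
  qed
  obtain A0 A1 where A01: "A0 \<in> H" "A0 \<in> nsets V k" "A1 \<in> nsets V k" "A1 \<notin> H" using H by blast
  have "\<exists>a\<in>V. \<exists>b\<in>V. l a \<noteq> l b"
  proof (rule ccontr)
    assume "\<not> ?thesis"
    then have same: "\<And>a b. a \<in> V \<Longrightarrow> b \<in> V \<Longrightarrow> l a = l b" by blast
    obtain z where z: "z \<in> V" using k V by fastforce
    have "(\<Sum>x\<in>A. l x) = real k * l z" if "A \<in> nsets V k" for A
    proof -
      have "(\<Sum>x\<in>A. l x) = (\<Sum>x\<in>A. l z)"
        by (rule sum.cong[OF refl], rule same) (use z that in \<open>auto simp: nsets_def\<close>)
      then show ?thesis using that by (simp add: nsets_def)
    qed
    from this[of A0] this[of A1] show False using A01 l[of A0] l[of A1] by simp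
  qed
  then obtain a' b' where ab': "a' \<in> V" "b' \<in> V" "l a' \<noteq> l b'" by blast
  then have "l a' = l b' + 1 \<or> l b' = l a' + 1" using diff1[of a' b'] by metis
  then obtain a b where ab: "a \<in> V" "b \<in> V" "l a = l b + 1" using ab' by blast
  have two: "l z = l b \<or> l z = l b + 1" if "z \<in> V" for z
  proof (cases "z = a \<or> z = b")
    case False
    then show ?thesis using diff1[of z a] diff1[of z b] ab that by argo
  qed (use ab in auto)
  \<comment> \<open>The double exchange: \<open>{a, x}\<close> against \<open>{b, y}\<close> with
    \<open>k - 2\<close> common further vertices.\<close>
  have "\<not> (\<exists>x y. x \<in> V \<and> y \<in> V \<and> x \<noteq> a \<and> y \<noteq> b \<and> l x = l b + 1 \<and> l y = l b)"
  proof
    assume "\<exists>x y. x \<in> V \<and> y \<in> V \<and> x \<noteq> a \<and> y \<noteq> b \<and> l x = l b + 1 \<and> l y = l b"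
    then obtain x y where xy: "x \<in> V" "y \<in> V" "x \<noteq> a" "y \<noteq> b" "l x = l b + 1" "l y = l b" by blast
    then have d: "x \<noteq> b" "y \<noteq> a" "x \<noteq> y" "a \<noteq> b" using ab by auto
    have "card {a, b, x, y} = 4" using xy d by simp
    then have "k - 2 \<le> card (V - {a, b, x, y})" using V k xy ab by (subst card_Diff_subset) auto
    then obtain B where B: "B \<in> nsets (V - {a, b, x, y}) (k - 2)" using nsets_obtain V by (metis finite_Diff)
    have fB: "finite B" "x \<notin> B" "y \<notin> B" "a \<notin> B" "b \<notin> B" "card B = k - 2" "B \<subseteq> V" using B by (auto simp: nsets_def)
    have "insert a (insert x B) \<in> nsets V k" "insert b (insert y B) \<in> nsets V k"
      using fB xy ab k d by (auto simp: nsets_def)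
    from l[OF this(1)] l[OF this(2)] show False using fB xy ab d by (auto split: if_splits)
  qed
  then consider "\<forall>x\<in>V - {a}. l x = l b" | "\<forall>y\<in>V - {b}. l y = l b + 1"
    using two by blast
  then show ?thesis
  proof cases
    case 1
    have s: "(\<Sum>x\<in>A. l x) = real k * l b + (if a \<in> A then 1 else 0)" if A: "A \<in> nsets V k" for A
    proof -
      have fA: "finite A" "card A = k" using A by (auto simp: nsets_def)
      have "(\<Sum>x\<in>A. l x) = (\<Sum>x\<in>A. l b + (if x = a then 1 else 0))"
        by (rule sum.cong) (use 1 ab A in \<open>auto simp: nsets_def\<close>)
      then show ?thesis using fA by (simp add: sum.distrib)
    qed
    have "A \<in> H \<longleftrightarrow> a \<in> A" if "A \<in> nsets V k" for A
      using s[OF that] l[OF that] s[OF A01(2)] l[OF A01(2)] s[OF A01(3)] l[OF A01(3)] A01(1,4)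
      by (auto split: if_splits)
    then have "H = {A \<in> nsets V k. a \<in> A}" using H by blast
    then show ?thesis using ab by blast
  next
    case 2
    have s: "(\<Sum>x\<in>A. l x) = real k * (l b + 1) - (if b \<in> A then 1 else 0)" if A: "A \<in> nsets V k" for A
    proof -
      have fA: "finite A" "card A = k" using A by (auto simp: nsets_def)
      have "(\<Sum>x\<in>A. l x) = (\<Sum>x\<in>A. (l b + 1) - (if x = b then 1 else 0))"
        by (rule sum.cong) (use 2 ab A in \<open>auto simp: nsets_def\<close>)
      then show ?thesis using fA by (simp add: sum_subtractf)
    qed
    have "A \<in> H \<longleftrightarrow> b \<notin> A" if "A \<in> nsets V k" for A
      using s[OF that] l[OF that] s[OF A01(2)] l[OF A01(2)] s[OF A01(3)] l[OF A01(3)] A01(1,4)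
      by (auto split: if_splits)
    then have "H = {A \<in> nsets V k. b \<notin> A}" using H by blast
    then show ?thesis using ab by blast
  qed
qed

definition star_co2 :: "nat \<Rightarrow> nat \<Rightarrow> nat" where
  "star_co2 n k = (n - 1 choose (k - 1)) * (1 + (n - k + 1) * (k - 1))"

text \<open>Since \<open>k * C = n * N\<close>, the quadratic term of \<open>co2_bound\<close>
  equals \<open>k * E * (E / N)\<close>, at most \<open>k * E\<close> for at most \<open>N\<close>
  edges. What results is linear in \<open>E\<close> and gives the value of the star at
  \<open>E = N\<close>; equality therefore forces \<open>E = N\<close> and a degree one
  indicator.\<close>

lemma co2_le_star_co2:
  assumes k: "2 \<le> k" "k + 2 \<le> n" and H: "H \<subseteq> nsets {1..n} k" and e: "card H \<le> (n - 1 choose (k - 1))"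
  shows "co2 n k H \<le> star_co2 n k"
    and "co2 n k H = star_co2 n k \<Longrightarrow> \<exists>c\<in>{1..n}. H = {A \<in> nsets {1..n} k. c \<in> A} \<or>
      n = 2 * k \<and> H = {A \<in> nsets {1..n} k. c \<notin> A}"
proof -
  obtain j where j: "k = Suc j" using k by (cases k) auto
  define N where "N = real (n - 1 choose j)"
  define C where "C = real (n choose Suc j)"
  define E where "E = real (card H)"
  define q where "q = real j * (real n - real (Suc j)) + real (Suc j)"
  have N: "N > 0" and C0: "C > 0" using k j by (auto simp: N_def C_def)
  have E: "E \<le> N" "E \<ge> 0" using e j by (simp_all add: N_def E_def)
  have "Suc j * (n choose Suc j) = n * (n - 1 choose j)"
    using binomial_absorption[of j n] by simp
  then have C: "real (Suc j) * C = real n * N" unfolding C_def N_def by (metis of_nat_mult)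
  have q: "q > 0" unfolding q_def using k j by (intro add_nonneg_pos mult_nonneg_nonneg) auto
  have t: "real (star_co2 n k) = N * q"
  proof -
    obtain m where "n = Suc j + m" using k j by (metis add_leD1 le_Suc_ex)
    then show ?thesis unfolding star_co2_def N_def q_def using j by (simp add: algebra_simps)
  qed
  have nE: "real n * E\<^sup>2 / C = real (Suc j) * E * (E / N)"
  proof -
    have "real n = real (Suc j) * C / N" using C N by (simp add: field_simps)
    then have "real n * E\<^sup>2 / C = (real (Suc j) * C / N) * E\<^sup>2 / C" by (simp only:)
    also have "\<dots> = real (Suc j) * E * (E / N)" using C0 by (simp add: power2_eq_square)
    finally show ?thesis .
  qed
  have EN: "E / N \<le> 1" using E N by simp
  have b: "real (co2 n k H) \<le> real j * (real n - real (Suc j)) * E + real n * E\<^sup>2 / C"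
    "real (co2 n k H) = real j * (real n - real (Suc j)) * E + real n * E\<^sup>2 / C \<Longrightarrow>
      (\<exists>l. \<forall>A\<in>nsets {1..n} k. (if A \<in> H then 1 else 0) - E / C = (\<Sum>x\<in>A. l x))"
    using co2_bound[of j n H] H k j unfolding E_def C_def by auto
  have b2: "real j * (real n - real (Suc j)) * E + real n * E\<^sup>2 / C \<le> q * E"
    using mult_left_mono[OF EN, of "real (Suc j) * E"] E unfolding nE q_def by (simp add: algebra_simps)
  have b3: "q * E \<le> N * q" using E q by simp
  show "co2 n k H \<le> star_co2 n k" using b(1) b2 b3 t by linarith
  assume eq: "co2 n k H = star_co2 n k"
  then have "q * E = N * q" and eq2: "real (co2 n k H) = real j * (real n - real (Suc j)) * E + real n * E\<^sup>2 / C"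
    using b(1) b2 b3 t by linarith+
  then have EN: "E = N" using q by simp
  obtain l where l: "\<forall>A\<in>nsets {1..n} k. (if A \<in> H then 1 else 0) - E / C = (\<Sum>x\<in>A. l x)"
    using b(2)[OF eq2] by blast
  have NC: "N < C"
  proof -
    have "real (Suc j) * N < real n * N" using N k j by simp
    then show ?thesis using C by (metis mult_less_cancel_left_pos of_nat_0_less_iff zero_less_Suc)
  qed
  have "H \<noteq> {}" using EN N by (auto simp: E_def)
  moreover have "H \<noteq> nsets {1..n} k" using EN NC j by (auto simp: E_def C_def card_nsets)
  moreover have "(\<Sum>x\<in>A. l x) = (if A \<in> H then 1 - E / C else 1 - E / C - 1)" if "A \<in> nsets {1..n} k" for A
    using l[rule_format, OF that] by (simp split: if_splits)
  ultimately have "\<exists>c\<in>{1..n}. H = {A \<in> nsets {1..n} k. c \<in> A} \<or> H = {A \<in> nsets {1..n} k. c \<notin> A}"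
    using k H by (intro degree_one_two_valued[of "{1..n}" k H l "1 - E / C"]) simp_all
  then obtain c where c: "c \<in> {1..n}" "H = {A \<in> nsets {1..n} k. c \<in> A} \<or> H = {A \<in> nsets {1..n} k. c \<notin> A}"
    by blast
  show "\<exists>c\<in>{1..n}. H = {A \<in> nsets {1..n} k. c \<in> A} \<or> n = 2 * k \<and> H = {A \<in> nsets {1..n} k. c \<notin> A}"
  proof (cases "H = {A \<in> nsets {1..n} k. c \<in> A}")
    case False
    then have H': "H = {A \<in> nsets {1..n} k. c \<notin> A}" using c by blast
    then have "H = nsets ({1..n} - {c}) k" by (auto simp: nsets_def)
    then have "card H = (n - 1 choose k)" using c by (simp add: card_nsets)
    \<comment> \<open>The complement of a star has \<open>N\<close> edges only if two neighbouring
      binomials of \<open>n - 1\<close> agree, which happens in the middle: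
      \<open>n - 1 = 2 * k - 1\<close>.\<close>
    then have "(n - 1 choose k) = (n - 1 choose j)" using EN by (simp add: E_def N_def)
    moreover have "k * (n - 1 choose k) = (n - 1 - j) * (n - 1 choose j)"
      using binomial_absorb_comp[of "n - 1" j] binomial_absorption[of j "n - 1"] j by simp
    ultimately have "k = n - 1 - j" using N by (simp add: N_def)
    then have "n = 2 * k" using j k by linarith
    then show ?thesis using c(1) H' by blast
  qed (use c in blast)
qed

section \<open>Families with intersecting members\<close>

definition arc :: "nat \<Rightarrow> nat \<Rightarrow> nat \<Rightarrow> nat set" where
  "arc m k p = (\<lambda>i. (p + i) mod m) ` {..<k}"

definition thicken :: "nat \<Rightarrow> nat \<Rightarrow> nat set \<Rightarrow> nat set" where
  "thicken m t P = {(p + s) mod m |p s. p \<in> P \<and> s \<le> t}"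

lemma bij_betw_shift:
  fixes m c :: nat
  assumes "0 < m"
  shows "bij_betw (\<lambda>a. (a + c) mod m) {..<m} {..<m}"
proof -
  have "inj_on (\<lambda>a. (a + c) mod m) {..<m}"
  proof (rule inj_onI)
    fix x y assume xy: "x \<in> {..<m}" "y \<in> {..<m}" "(x + c) mod m = (y + c) mod m"
    then have "[x + c = y + c] (mod m)" by (simp add: cong_def)
    then have "[x = y] (mod m)" by (simp add: cong_add_rcancel_nat)
    then show "x = y" using xy by (simp add: cong_def)
  qed
  moreover have "(\<lambda>a. (a + c) mod m) ` {..<m} \<subseteq> {..<m}" using assms by auto
  ultimately show ?thesis by (simp add: bij_betw_def endo_inj_surj)
qed

text \<open>Every further step adds a residue unless the set is closed under adding one, and then it
  contains all residues.\<close>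

lemma card_thicken:
  assumes "0 < m" "P \<subseteq> {..<m}" "P \<noteq> {}"
  shows "min m (card P + t) \<le> card (thicken m t P)"
proof (induction t)
  case 0
  have "P \<subseteq> thicken m 0 P" using assms(2) by (force simp: thicken_def)
  moreover have "thicken m 0 P \<subseteq> {..<m}" using assms(1) by (auto simp: thicken_def)
  ultimately have "card P \<le> card (thicken m 0 P)" by (meson card_mono finite_lessThan finite_subset)
  then show ?case by simp
next
  case (Suc t)
  have sub: "thicken m s P \<subseteq> {..<m}" for s using assms(1) by (auto simp: thicken_def)
  have fin: "finite (thicken m s P)" for s using sub finite_subset by blast
  have mono: "thicken m t P \<subseteq> thicken m (Suc t) P" unfolding thicken_def by fastforce
  show ?case
  proof (cases "thicken m t P = {..<m}")
    case True
    then have "thicken m (Suc t) P = {..<m}" using mono sub[of "Suc t"] by blast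
    then show ?thesis by simp
  next
    case False
    have shift: "(x + 1) mod m \<in> thicken m (Suc t) P" if "x \<in> thicken m t P" for x
    proof -
      obtain p s where ps: "x = (p + s) mod m" "p \<in> P" "s \<le> t" using \<open>x \<in> thicken m t P\<close> unfolding thicken_def by blast
      have "(x + 1) mod m = (p + Suc s) mod m" unfolding ps(1) by (simp add: mod_Suc_eq)
      then show ?thesis unfolding thicken_def using ps(2,3) Suc_le_mono by blast
    qed
    have "thicken m t P \<noteq> thicken m (Suc t) P"
    proof
      assume eq: "thicken m t P = thicken m (Suc t) P"
      obtain x where x: "x \<in> thicken m t P" using assms(3) unfolding thicken_def by blast
      have "(x + i) mod m \<in> thicken m t P" for i
      proof (induction i)
        case 0
        then show ?case using x sub[of t] by auto
      next
        case (Suc i)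
        then have "((x + i) mod m + 1) mod m \<in> thicken m t P" using shift eq by blast
        then show ?case by (simp add: mod_Suc_eq)
      qed
      moreover have "\<exists>i. y = (x + i) mod m" if "y < m" for y
        by (rule exI[of _ "m - x + y"]) (use x sub[of t] that in auto)
      ultimately have "{..<m} \<subseteq> thicken m t P" by auto
      then show False using False sub[of t] by blast
    qed
    then have "card (thicken m t P) < card (thicken m (Suc t) P)"
      using mono fin by (meson psubsetI psubset_card_mono)
    then show ?thesis using Suc by simp
  qed
qed

text \<open>Arcs have a common point unless their complements, arcs of length \<open>m - k\<close>,
  cover the circle. With more than \<open>k\<close> starting points there are \<open>r\<close>
  complements that do cover it.\<close>

lemma arcs_r_wise_intersecting:
  assumes m: "0 < m" and k: "k \<le> m" and r: "m \<le> r * (m - k)" and P: "P \<subseteq> {..<m}"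
    and int: "\<And>p. \<forall>i<r. p i \<in> P \<Longrightarrow> \<exists>z. \<forall>i<r. z \<in> arc m k (p i)"
  shows "card P \<le> k"
proof (rule ccontr)
  assume "\<not> card P \<le> k"
  then have Pk: "k + 1 \<le> card P" by simp
  then have P0: "P \<noteq> {}" by auto
  have r0: "r > 0" using m r by (cases r) auto
  \<comment> \<open>\<open>m / r\<close> rounded up: \<open>r\<close> consecutive arcs of length
    \<open>l\<close> cover the circle, and by hypothesis \<open>r\<close> such an arc fits into the
    complement of an arc of length \<open>k\<close>.\<close>
  define l where "l = (m + r - 1) div r"
  have l1: "m \<le> r * l" "r * l < m + r"
  proof -
    have "(m + r - 1) mod r < r" "r * l + (m + r - 1) mod r = m + r - 1"
      using r0 by (simp_all add: l_def)
    then show "m \<le> r * l" "r * l < m + r" using r0 by linarith+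
  qed
  have ll: "l \<le> m - k"
  proof (rule ccontr)
    assume "\<not> ?thesis"
    then have "r * (m - k) + r \<le> r * l" by (metis Suc_leI linorder_not_le mult_Suc_right add.commute mult_le_mono2)
    then show False using l1 r by linarith
  qed
  have l0: "0 < l" using l1 m by (cases l) auto
  \<comment> \<open>For \<open>s \<le> t\<close> the arc of length \<open>l\<close> starting at
    \<open>p + s + k\<close> stays in the complement of \<open>arc m k p\<close>. Up to the shift by
    \<open>k\<close>, \<open>Q\<close> is the set of starting points obtained in this way.\<close>
  define t where "t = m - k - l"
  define Q where "Q = thicken m t P"
  have Q: "Q \<subseteq> {..<m}" using m by (auto simp: Q_def thicken_def)
  have "m + 1 \<le> card Q + l"
    using card_thicken[OF m P P0, of t] Pk ll k l0 unfolding Q_def t_def by linarith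
  then have cQ: "m - card Q \<le> l - 1" by linarith
  \<comment> \<open>Each of the \<open>r\<close> equally spaced positions misses \<open>Q\<close>
    for at most \<open>l - 1\<close> values of \<open>a\<close>, and
    \<open>r * (l - 1) < m\<close>.\<close>
  have "\<exists>a<m. \<forall>i<r. (a + i * l) mod m \<in> Q"
  proof (rule ccontr)
    assume "\<not> ?thesis"
    then have sub: "{..<m} \<subseteq> (\<Union>i<r. {a\<in>{..<m}. (a + i * l) mod m \<in> {..<m} - Q})" using m by fastforce
    have "card {..<m} \<le> card (\<Union>i<r. {a\<in>{..<m}. (a + i * l) mod m \<in> {..<m} - Q})"
      by (rule card_mono[OF _ sub]) simp
    then have "m \<le> card (\<Union>i<r. {a\<in>{..<m}. (a + i * l) mod m \<in> {..<m} - Q})"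
      by (simp only: card_lessThan)
    also have "\<dots> \<le> (\<Sum>i<r. card {a\<in>{..<m}. (a + i * l) mod m \<in> {..<m} - Q})"
      by (rule card_UN_le) simp
    also have "\<dots> \<le> (\<Sum>i<r. l - 1)"
    proof (rule sum_mono)
      fix i
      have "card {a\<in>{..<m}. (a + i * l) mod m \<in> {..<m} - Q} \<le> card ({..<m} - Q)"
      proof (rule card_inj_on_le[of "\<lambda>a. (a + i * l) mod m"])
        show "inj_on (\<lambda>a. (a + i * l) mod m) {a\<in>{..<m}. (a + i * l) mod m \<in> {..<m} - Q}"
          by (rule inj_on_subset[OF bij_betw_imp_inj_on[OF bij_betw_shift[OF m]]]) blast
      qed auto
      also have "\<dots> \<le> l - 1" using Q cQ by (simp add: card_Diff_subset finite_subset)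
      finally show "card {a\<in>{..<m}. (a + i * l) mod m \<in> {..<m} - Q} \<le> l - 1" .
    qed
    also have "\<dots> = r * l - r" by (simp add: diff_mult_distrib2)
    finally show False using l1 m by linarith
  qed
  then obtain a where a: "\<forall>i<r. (a + i * l) mod m \<in> Q" by blast
  then have "\<forall>i. \<exists>p s. i < r \<longrightarrow> (a + i * l) mod m = (p + s) mod m \<and> p \<in> P \<and> s \<le> t"
    unfolding Q_def thicken_def by blast
  then obtain p s where ps: "\<And>i. i < r \<Longrightarrow> (a + i * l) mod m = (p i + s i) mod m \<and> p i \<in> P \<and> s i \<le> t"
    by metis
  obtain z where z: "\<forall>i<r. z \<in> arc m k (p i)" using int[of p] ps by blast
  have zm: "z < m" using z r0 m by (auto simp: arc_def)
  obtain w where w: "w < m" "z = (w + (a + k)) mod m"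
  proof -
    have "z \<in> (\<lambda>w. (w + (a + k)) mod m) ` {..<m}"
      using bij_betw_imp_surj_on[OF bij_betw_shift[OF m, of "a + k"]] zm by simp
    then show ?thesis using that by blast
  qed
  \<comment> \<open>\<open>z\<close> lies in the block of length \<open>l\<close> with number
    \<open>i\<close>, counted from \<open>a + k\<close>; this block is disjoint from the arc
    starting at \<open>p i\<close>.\<close>
  define i where "i = w div l"
  have i: "i < r" using w(1) l1 l0 unfolding i_def by (simp add: less_mult_imp_div_less)
  define w' where "w' = w mod l"
  have w': "w' < l" "w = i * l + w'" using l0 by (simp_all add: w'_def i_def)
  have "[z = w + (a + k)] (mod m)" using w(2) by (simp add: cong_def)
  also have "w + (a + k) = (a + i * l) + (k + w')" using w'(2) by simp
  also have "[(a + i * l) + (k + w') = (p i + s i) + (k + w')] (mod m)"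
    by (rule cong_add[OF _ cong_refl]) (use ps[OF i] in \<open>simp add: cong_def\<close>)
  finally have 1: "[z = p i + (s i + k + w')] (mod m)" by (simp add: ac_simps)
  obtain j where j: "j < k" "z = (p i + j) mod m" using z i by (auto simp: arc_def)
  then have "[p i + j = p i + (s i + k + w')] (mod m)" using 1 by (simp add: cong_def)
  then have "[j = s i + k + w'] (mod m)" by (simp add: cong_add_lcancel_nat)
  moreover have "s i + k + w' < m" using ps[OF i] w' ll l0 k unfolding t_def by linarith
  ultimately show False using j by (simp add: cong_def)
qed

section \<open>Averaging over permutations\<close>

lemma exists_permutes_image:
  assumes "finite V" "A \<subseteq> V" "A' \<subseteq> V" "card A = card A'"
  obtains q where "q permutes V" "q ` A = A'"
proof -
  have fin: "finite A" "finite A'" using assms finite_subset by blast+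
  obtain f where f: "bij_betw f A A'" using assms fin finite_same_card_bij by blast
  have "card (V - A) = card (V - A')" using assms fin by (simp add: card_Diff_subset)
  then obtain g where g: "bij_betw g (V - A) (V - A')" using assms finite_same_card_bij by blast
  define q where "q = (\<lambda>x. if x \<in> A then f x else if x \<in> V then g x else x)"
  have "bij_betw q A A'" using f by (subst bij_betw_cong[of A q f]) (auto simp: q_def)
  moreover have "bij_betw q (V - A) (V - A')" using g by (subst bij_betw_cong[of "V - A" q g]) (auto simp: q_def)
  ultimately have "bij_betw q (A \<union> (V - A)) (A' \<union> (V - A'))" by (intro bij_betw_combine) auto
  moreover have "A \<union> (V - A) = V" "A' \<union> (V - A') = V" using assms by auto
  ultimately have "q permutes V" using assms by (intro bij_imp_permutes) (auto simp: q_def)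
  moreover have "q ` A = A'" using \<open>bij_betw q A A'\<close> by (simp add: bij_betw_def)
  ultimately show ?thesis using that by blast
qed

text \<open>Composition with a permutation that carries \<open>B\<close> to \<open>B'\<close> shows
  that all \<open>k\<close>-sets are images of \<open>I\<close> equally often.\<close>

lemma card_permutes_image:
  assumes V: "finite V" and I: "I \<in> nsets V k" and A: "A \<in> nsets V k"
  shows "card {p. p permutes V \<and> p ` I = A} * (card V choose k) = fact (card V)"
proof -
  let ?c = "\<lambda>A. card {p. p permutes V \<and> p ` I = A}"
  have finp: "finite {p. p permutes V \<and> Q p}" for Q
    using finite_permutations[OF V] by simp
  have le: "?c B \<le> ?c B'" if B: "B \<in> nsets V k" "B' \<in> nsets V k" for B B'
  proof -
    obtain q where q: "q permutes V" "q ` B = B'"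
      using B exists_permutes_image[OF V, of B B'] by (auto simp: nsets_def)
    show ?thesis
    proof (rule card_inj_on_le[of "\<lambda>p. q \<circ> p"])
      show "inj_on (\<lambda>p. q \<circ> p) {p. p permutes V \<and> p ` I = B}"
        using permutes_inj[OF q(1)] by (auto simp: inj_on_def fun_eq_iff)
      show "(\<lambda>p. q \<circ> p) ` {p. p permutes V \<and> p ` I = B} \<subseteq> {p. p permutes V \<and> p ` I = B'}"
        using q permutes_compose by (auto simp: image_comp[symmetric])
    qed (rule finp)
  qed
  have "{p. p permutes V} = (\<Union>B\<in>nsets V k. {p. p permutes V \<and> p ` I = B})"
  proof -
    have "p ` I \<in> nsets V k" if "p permutes V" for p
    proof -
      have "card (p ` I) = card I" by (rule card_image) (use permutes_inj_on[OF that] in blast)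
      moreover have "p ` I \<subseteq> V" using I permutes_image[OF that] by (auto simp: nsets_def)
      ultimately show ?thesis using I by (simp add: nsets_def)
    qed
    then show ?thesis by blast
  qed
  then have "fact (card V) = card (\<Union>B\<in>nsets V k. {p. p permutes V \<and> p ` I = B})"
    using card_permutations[OF refl V] by simp
  also have "\<dots> = (\<Sum>B\<in>nsets V k. ?c B)"
    by (rule card_UN_disjoint) (use finp V in \<open>auto simp: finite_imp_finite_nsets\<close>)
  also have "\<dots> = (\<Sum>B\<in>nsets V k. ?c A)"
    by (rule sum.cong) (use le A in \<open>auto intro: antisym\<close>)
  finally show ?thesis using V by (simp add: card_nsets)
qed

text \<open>Katona's cycle method as a double count: every index \<open>j\<close> and every member
  of \<open>F\<close> are matched by the same number of permutations.\<close>

lemma permutation_average: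
  assumes V: "finite V" and F: "F \<subseteq> nsets V k" and I: "\<And>j. j < m \<Longrightarrow> I j \<in> nsets V k"
    and b: "\<And>p. p permutes V \<Longrightarrow> card {j\<in>{..<m}. p ` I j \<in> F} \<le> b"
  shows "m * card F \<le> b * (card V choose k)"
proof -
  let ?P = "{p. p permutes V}" and ?C = "card V choose k"
  have finP: "finite ?P" using V by (rule finite_permutations)
  have finF: "finite F" using F V finite_imp_finite_nsets finite_subset by blast
  have "(\<Sum>p\<in>?P. card {j\<in>{..<m}. p ` I j \<in> F}) = (\<Sum>p\<in>?P. \<Sum>j<m. \<Sum>A\<in>F. if p ` I j = A then 1 else 0)"
    using finF by (intro sum.cong) (auto simp: card_eq_sum sum.If_cases Int_def simp del: sum_constant)
  also have "\<dots> = (\<Sum>j<m. \<Sum>A\<in>F. \<Sum>p\<in>?P. if p ` I j = A then 1 else 0)"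
    by (subst sum.swap, rule sum.cong[OF refl], subst sum.swap) simp
  also have "\<dots> = (\<Sum>j<m. \<Sum>A\<in>F. card {p. p permutes V \<and> p ` I j = A})"
    using finP by (simp add: sum.If_cases Int_def)
  finally have eq: "(\<Sum>p\<in>?P. card {j\<in>{..<m}. p ` I j \<in> F}) = (\<Sum>j<m. \<Sum>A\<in>F. card {p. p permutes V \<and> p ` I j = A})" .
  have "m * card F * fact (card V) = (\<Sum>j<m. \<Sum>A\<in>F. card {p. p permutes V \<and> p ` I j = A}) * ?C"
    unfolding sum_distrib_right using card_permutes_image[OF V I] F by (simp add: subset_iff)
  also have "\<dots> = (\<Sum>p\<in>?P. card {j\<in>{..<m}. p ` I j \<in> F}) * ?C" by (simp only: eq)
  also have "\<dots> \<le> (\<Sum>p\<in>?P. b) * ?C" by (intro mult_right_mono sum_mono b) auto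
  also have "\<dots> = b * ?C * fact (card V)" using card_permutations[OF refl V] by simp
  finally show ?thesis by simp
qed

text \<open>Hypothesis \<open>r\<close> says that \<open>k\<close> is at most the fraction
  \<open>(r - 1) / r\<close> of \<open>card V\<close>. Of the \<open>m\<close> arcs in a cyclic
  arrangement at most \<open>k\<close> are members, so averaging bounds the density of
  \<open>F\<close> by \<open>k / m\<close>. The cases used are \<open>r = 2\<close>, Erdos-Ko-Rado,
  and \<open>r = 3\<close>, due to Frankl.\<close>

theorem r_wise_intersecting_bound:
  assumes V: "finite V" and F: "F \<subseteq> nsets V k" and k: "0 < k" and r: "card V \<le> r * (card V - k)"
    and int: "\<And>p. \<forall>i<r. p i \<in> F \<Longrightarrow> (\<Inter>i<r. p i) \<noteq> {}"
  shows "card F \<le> (card V - 1 choose (k - 1))"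
proof (cases "k \<le> card V")
  case False
  then have "nsets V k = {}" using V by (simp add: nsets_eq_empty)
  then have "F = {}" using F by blast
  then show ?thesis by simp
next
  case True
  define m where "m = card V"
  have m: "0 < m" using True k by (simp add: m_def)
  obtain h where h: "bij_betw h {..<m} V"
    using ex_bij_betw_nat_finite[OF V] by (auto simp: m_def lessThan_atLeast0)
  define I where "I = (\<lambda>j. h ` arc m k j)"
  have arc_sub: "arc m k j \<subseteq> {..<m}" for j using m by (auto simp: arc_def)
  have carc: "card (arc m k j) = k" for j
  proof -
    have "inj_on (\<lambda>i. (j + i) mod m) {..<m}" using bij_betw_shift[OF m, of j] by (simp add: bij_betw_def add.commute)
    then have "inj_on (\<lambda>i. (j + i) mod m) {..<k}" by (rule inj_on_subset) (use True in \<open>auto simp: m_def\<close>)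
    then show ?thesis unfolding arc_def by (simp add: card_image)
  qed
  have I: "I j \<in> nsets V k" for j
  proof -
    have "inj_on h (arc m k j)" using h arc_sub by (auto simp: bij_betw_def intro: inj_on_subset)
    then have "card (I j) = k" by (simp add: I_def card_image carc)
    moreover have "I j \<subseteq> V" using h arc_sub[of j] by (auto simp: I_def bij_betw_def)
    ultimately show ?thesis using V k by (simp add: nsets_def finite_subset)
  qed
  have "m * card F \<le> k * (card V choose k)"
  proof (rule permutation_average[OF V F I])
    fix p assume p: "p permutes V"
    let ?P = "{j\<in>{..<m}. p ` I j \<in> F}"
    show "card ?P \<le> k"
    proof (rule arcs_r_wise_intersecting[OF m])
      fix q assume q: "\<forall>i<r. q i \<in> ?P"
      obtain y where y: "\<forall>i<r. y \<in> p ` I (q i)" using int[of "\<lambda>i. p ` I (q i)"] q by auto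
      have r0: "0 < r" using m r by (cases r) (auto simp: m_def)
      obtain z where z: "z \<in> {..<m}" "y = p (h z)" using y r0 arc_sub by (force simp: I_def)
      have "inj_on (\<lambda>z. p (h z)) {..<m}"
        using h permutes_inj[OF p] by (auto simp: bij_betw_def inj_on_def)
      then have "z \<in> arc m k (q i)" if ir: "i < r" for i
      proof -
        obtain z' where z': "z' \<in> arc m k (q i)" "y = p (h z')" using y ir by (auto simp: I_def)
        then show ?thesis using \<open>inj_on (\<lambda>z. p (h z)) {..<m}\<close> z arc_sub[of "q i"] by (auto simp: inj_on_def)
      qed
      then show "\<exists>z. \<forall>i<r. z \<in> arc m k (q i)" by blast
    qed (use True r in \<open>auto simp: m_def\<close>)
  qed
  also have "k * (card V choose k) = m * (m - 1 choose (k - 1))"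
    unfolding m_def using k by (rule times_binomial_minus1_eq)
  finally show ?thesis using m by (simp add: m_def)
qed

corollary Erdos_Ko_Rado_bound:
  assumes "finite V" "F \<subseteq> nsets V k" "0 < k" "2 * k \<le> card V"
    and "\<And>A B. A \<in> F \<Longrightarrow> B \<in> F \<Longrightarrow> A \<inter> B \<noteq> {}"
  shows "card F \<le> (card V - 1 choose (k - 1))"
proof (rule r_wise_intersecting_bound[of V F k 2])
  fix p :: "nat \<Rightarrow> 'a set" assume "\<forall>i<2. p i \<in> F"
  then have "p 0 \<inter> p 1 \<noteq> {}" using assms(5) by simp
  then show "(\<Inter>i<2. p i) \<noteq> {}" by (auto simp: less_2_cases_iff)
qed (use assms in auto)

corollary three_wise_intersecting_bound:
  assumes "finite V" "F \<subseteq> nsets V k" "0 < k" "3 * k \<le> 2 * card V"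
    and "\<And>A B C. A \<in> F \<Longrightarrow> B \<in> F \<Longrightarrow> C \<in> F \<Longrightarrow> A \<inter> B \<inter> C \<noteq> {}"
  shows "card F \<le> (card V - 1 choose (k - 1))"
proof (rule r_wise_intersecting_bound[of V F k 3])
  fix p :: "nat \<Rightarrow> 'a set" assume "\<forall>i<3. p i \<in> F"
  then have "p 0 \<inter> p 1 \<inter> p 2 \<noteq> {}" using assms(5) by simp
  moreover have "{..<3} = {0, 1, 2::nat}" by auto
  ultimately show "(\<Inter>i<3. p i) \<noteq> {}" by (simp add: Int_assoc)
qed (use assms in auto)

section \<open>Stars and forbidden configurations\<close>

definition star_at :: "nat \<Rightarrow> nat \<Rightarrow> nat \<Rightarrow> nat set set" where
  "star_at n k c = {A \<in> nsets {1..n} k. c \<in> A}"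

lemma star_eq_star_at: "star n k = star_at n k 1"
  by (simp add: star_def star_at_def)

lemma isomorphic_on_star_iff:
  assumes "1 \<le> n"
  shows "isomorphic_on n H (star n k) \<longleftrightarrow> (\<exists>c\<in>{1..n}. H = star_at n k c)"
proof -
  have img: "(\<lambda>E. f ` E) ` star_at n k a = star_at n k (f a)" if f: "bij_betw f {1..n} {1..n}" and a: "a \<in> {1..n}" for f a
  proof (intro equalityI subsetI)
    fix A assume "A \<in> (\<lambda>E. f ` E) ` star_at n k a"
    then obtain E where E: "A = f ` E" "E \<in> nsets {1..n} k" "a \<in> E" by (auto simp: star_at_def)
    have "inj_on f E" using E f by (auto simp: nsets_def bij_betw_def intro: inj_on_subset)
    then show "A \<in> star_at n k (f a)" using E f by (auto simp: star_at_def nsets_def card_image bij_betw_def)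
  next
    fix A assume A: "A \<in> star_at n k (f a)"
    then have "A \<subseteq> f ` {1..n}" using f by (auto simp: star_at_def nsets_def bij_betw_def)
    then obtain E where E: "E \<subseteq> {1..n}" "A = f ` E" by (meson subset_imageE)
    have inj: "inj_on f E" using E f by (auto simp: bij_betw_def intro: inj_on_subset)
    then have "card E = k" "finite E" using A E by (auto simp: star_at_def nsets_def card_image finite_image_iff)
    moreover have "a \<in> E"
      using A E a f by (auto simp: star_at_def bij_betw_def dest: inj_onD)
    ultimately show "A \<in> (\<lambda>E. f ` E) ` star_at n k a" using E by (auto simp: star_at_def nsets_def)
  qed
  show ?thesis
  proof
    assume "isomorphic_on n H (star n k)"
    then obtain f where f: "bij_betw f {1..n} {1..n}" "H = (\<lambda>E. f ` E) ` star_at n k 1"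
      by (auto simp: isomorphic_on_def star_eq_star_at)
    then show "\<exists>c\<in>{1..n}. H = star_at n k c"
      using img[OF f(1), of 1] assms bij_betwE[OF f(1)] by (intro bexI[of _ "f 1"]) auto
  next
    assume "\<exists>c\<in>{1..n}. H = star_at n k c"
    then obtain c where c: "c \<in> {1..n}" "H = star_at n k c" by blast
    have "transpose 1 c permutes {1..n}" using assms c by (intro permutes_swap_id) auto
    then have "bij_betw (transpose 1 c) {1..n} {1..n}" by (rule permutes_imp_bij)
    moreover from this have "H = (\<lambda>E. transpose 1 c ` E) ` star n k"
      using img[of "transpose 1 c" 1] assms c by (simp add: star_eq_star_at)
    ultimately show "isomorphic_on n H (star n k)" unfolding isomorphic_on_def by blast
  qed
qed

lemma co2_star_at:
  assumes "2 \<le> k" "k \<le> n" and c: "c \<in> {1..n}"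
  shows "co2 n k (star_at n k c) = star_co2 n k"
proof -
  let ?V = "{1..n}" and ?J = "nsets {1..n} (k - 1)"
  obtain j where j: "k = Suc (Suc j)" using assms(1) by (metis add_2_eq_Suc le_Suc_ex)
  have finJ: "finite ?J" by (simp add: finite_imp_finite_nsets)
  have sub: "star_at n k c \<subseteq> nsets ?V (Suc (k - 1))" using j by (auto simp: star_at_def)
  have deg: "degree (star_at n k c) E = (if c \<in> E then n - k + 1 else 1)" if E: "E \<in> ?J" for E
  proof -
    have fE: "finite E" "card E = k - 1" "E \<subseteq> ?V" using E by (auto simp: nsets_def)
    have iff: "insert x E \<in> star_at n k c \<longleftrightarrow> c \<in> insert x E" if "x \<in> ?V - E" for x
      using nsets_insertI[OF E that] j by (auto simp: star_at_def)
    have "real (degree (star_at n k c) E) = (\<Sum>x\<in>?V - E. if c \<in> insert x E then 1 else 0)"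
      unfolding degree_up_sum[OF _ sub E, simplified] up_sum_def by (rule sum.cong) (use iff in auto)
    also have "\<dots> = (if c \<in> E then real (card (?V - E)) else 1)"
    proof (cases "c \<in> E")
      case False
      then have "(\<Sum>x\<in>?V - E. if c \<in> insert x E then 1 else 0) = (\<Sum>x\<in>?V - E. if c = x then 1 else (0::real))"
        by (intro sum.cong) auto
      then show ?thesis using False c by simp
    qed simp
    finally show ?thesis using fE assms by (auto simp: card_Diff_subset)
  qed
  have 1: "card {E \<in> ?J. c \<in> E} = (n - 1 choose j)"
  proof -
    have "{E \<in> ?J. c \<in> E} = insert c ` nsets (?V - {c}) j"
    proof (intro equalityI subsetI)
      fix E assume E: "E \<in> {E \<in> ?J. c \<in> E}"
      then have "E - {c} \<in> nsets (?V - {c}) j" "E = insert c (E - {c})" using j by (auto simp: nsets_def)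
      then show "E \<in> insert c ` nsets (?V - {c}) j" by blast
    next
      fix E assume "E \<in> insert c ` nsets (?V - {c}) j"
      then obtain B where B: "E = insert c B" "B \<subseteq> ?V - {c}" "finite B" "card B = j" by (auto simp: nsets_def)
      moreover from this have "c \<notin> B" by blast
      ultimately show "E \<in> {E \<in> ?J. c \<in> E}" using c j by (auto simp: nsets_def subset_iff)
    qed
    moreover have "inj_on (insert c) (nsets (?V - {c}) j)" by (auto simp: inj_on_def nsets_def)
    ultimately show ?thesis using c by (simp add: card_image card_nsets)
  qed
  have 2: "card {E \<in> ?J. c \<notin> E} = (n - 1 choose (k - 1))"
  proof -
    have "{E \<in> ?J. c \<notin> E} = nsets (?V - {c}) (k - 1)" by (auto simp: nsets_def)
    then show ?thesis using c by (simp add: card_nsets)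
  qed
  have "co2 n k (star_at n k c) = (\<Sum>E\<in>?J. if c \<in> E then (n - k + 1)\<^sup>2 else 1)"
    unfolding co2_def by (rule sum.cong) (auto simp: deg)
  also have "\<dots> = (n - 1 choose j) * (n - k + 1)\<^sup>2 + (n - 1 choose (k - 1))"
    using finJ 1 2 by (simp add: sum.If_cases Int_def)
  also have "(n - 1 choose j) * (n - k + 1)\<^sup>2 = (n - k + 1) * ((n - k + 1) * (n - 1 choose j))"
    by (simp only: power2_eq_square ac_simps)
  also have "(n - k + 1) * (n - 1 choose j) = (k - 1) * (n - 1 choose (k - 1))"
  proof -
    have "n - 1 - j = n - k + 1" using j assms by linarith
    then show ?thesis
      using binomial_absorb_comp[of "n - 1" j] binomial_absorption[of j "n - 1"] j by simp
  qed
  finally have co: "co2 n k (star_at n k c) = (n - k + 1) * ((k - 1) * (n - 1 choose (k - 1))) + (n - 1 choose (k - 1))" .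
  have "a * (b * N) + N = N * (1 + a * b)" for a b N :: nat by (simp add: algebra_simps)
  with co show ?thesis by (simp only: star_co2_def)
qed

section \<open>Reduction of the extremal problem to a bound on the number of edges\<close>

lemma finite_free_hypergraphs: "finite (free_hypergraphs n k \<F>)"
  by (rule finite_subset[of _ "Pow (nsets {1..n} k)"])
    (auto simp: free_hypergraphs_def finite_imp_finite_nsets)

text \<open>Hypergraphs with few edges are governed by \<open>co2_le_star_co2\<close>, so for the
  others it is enough to stay below the star. The last premise removes the second equality case,
  present only for \<open>n = 2 * k\<close>; it guards uniqueness and not the value.\<close>

lemma extremal_iff_star:
  assumes k: "3 \<le> k" "k + 2 \<le> n"
    and star: "\<And>c. c \<in> {1..n} \<Longrightarrow> star_at n k c \<in> free_hypergraphs n k \<F>"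
    and bound: "\<And>H. H \<in> free_hypergraphs n k \<F> \<Longrightarrow> card H \<le> (n - 1 choose (k - 1)) \<or> co2 n k H < star_co2 n k"
  shows "exco2 n k \<F> = star_co2 n k" "extremal n k \<F> (star n k)"
    and "(n = 2 * k \<Longrightarrow> \<forall>c\<in>{1..n}. {A \<in> nsets {1..n} k. c \<notin> A} \<notin> free_hypergraphs n k \<F>) \<Longrightarrow>
      extremal n k \<F> H \<longleftrightarrow> isomorphic_on n H (star n k)"
proof -
  let ?F = "free_hypergraphs n k \<F>"
  have co_star: "co2 n k (star_at n k c) = star_co2 n k" if "c \<in> {1..n}" for c
    using co2_star_at that k by simp
  have sub: "H \<subseteq> nsets {1..n} k" if "H \<in> ?F" for H using that by (auto simp: free_hypergraphs_def)
  have le: "co2 n k H \<le> star_co2 n k" if "H \<in> ?F" for H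
    using bound[OF that] co2_le_star_co2(1)[of k n H] sub[OF that] k by fastforce
  show ex: "exco2 n k \<F> = star_co2 n k"
    unfolding exco2_def
  proof (rule Max_eqI)
    have "1 \<in> {1..n}" using k by simp
    then show "star_co2 n k \<in> co2 n k ` ?F" using co_star[of 1] star[of 1] by (metis image_eqI)
  qed (use le finite_free_hypergraphs in auto)
  show "extremal n k \<F> (star n k)"
    using star[of 1] co_star[of 1] k by (simp add: extremal_def ex star_eq_star_at)
  assume anti: "n = 2 * k \<Longrightarrow> \<forall>c\<in>{1..n}. {A \<in> nsets {1..n} k. c \<notin> A} \<notin> ?F"
  show "extremal n k \<F> H \<longleftrightarrow> isomorphic_on n H (star n k)"
  proof
    assume "extremal n k \<F> H"
    then have H: "H \<in> ?F" "co2 n k H = star_co2 n k" by (auto simp: extremal_def ex)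
    then have "card H \<le> (n - 1 choose (k - 1))" using bound by force
    then obtain c where c: "c \<in> {1..n}" "H = star_at n k c \<or> n = 2 * k \<and> H = {A \<in> nsets {1..n} k. c \<notin> A}"
      using co2_le_star_co2(2)[of k n H] sub[OF H(1)] k H(2) unfolding star_at_def by auto
    then have "H = star_at n k c" using anti H(1) by blast
    then show "isomorphic_on n H (star n k)" using c(1) k by (subst isomorphic_on_star_iff) auto
  next
    assume "isomorphic_on n H (star n k)"
    then obtain c where "c \<in> {1..n}" "H = star_at n k c" using k by (subst (asm) isomorphic_on_star_iff) auto
    then show "extremal n k \<F> H" using star co_star by (simp add: extremal_def ex)
  qed
qed

section \<open>Recognising copies of the forbidden configurations\<close>

text \<open>The centre has the same preimage in every edge of the copy because the embedding is
  injective on all vertices.\<close>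

lemma contains_copy_star_at:
  assumes "contains_copy (star_at n k c) G" "G \<noteq> {}"
  obtains z where "\<And>E. E \<in> G \<Longrightarrow> z \<in> E"
proof -
  obtain f where f: "inj_on f (\<Union>G)" "(\<lambda>E. f ` E) ` G \<subseteq> star_at n k c"
    using assms(1) unfolding contains_copy_def by blast
  have ex: "\<exists>z\<in>E. f z = c" if "E \<in> G" for E
  proof -
    have "c \<in> f ` E" using f(2) that unfolding star_at_def by blast
    then show ?thesis by blast
  qed
  obtain E0 where E0: "E0 \<in> G" using assms(2) by blast
  obtain z where z: "z \<in> E0" "f z = c" using ex[OF E0] by blast
  have "z \<in> E" if EG: "E \<in> G" for E
  proof -
    obtain y where "y \<in> E" "f y = c" using ex[OF EG] by blast
    then show ?thesis using inj_onD[OF f(1), of y z] z E0 EG by auto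
  qed
  then show ?thesis using that by blast
qed

lemma contains_copyI: "G \<subseteq> H \<Longrightarrow> contains_copy H G"
  unfolding contains_copy_def by (rule exI[of _ id]) auto

lemma atLeastAtMost_1_3: "{1..3} = {1, 2, 3::nat}" and atLeastAtMost_1_4: "{1..4} = {1, 2, 3, 4::nat}"
  by auto

lemma minimal_cycles_3I:
  assumes "A \<in> nsets UNIV k" "B \<in> nsets UNIV k" "C \<in> nsets UNIV k"
    and "A \<inter> B \<noteq> {}" "B \<inter> C \<noteq> {}" "C \<inter> A \<noteq> {}" "A \<inter> B \<inter> C = {}"
  shows "{A, B, C} \<in> minimal_cycles k 3"
proof -
  define E where "E = (\<lambda>i::nat. if i = 1 then A else if i = 2 then B else C)"
  obtain x y z where xyz: "x \<in> A \<inter> B" "y \<in> B \<inter> C" "z \<in> C \<inter> A" using assms by blast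
  define v where "v = (\<lambda>i::nat. if i = 1 then x else if i = 2 then y else z)"
  have E: "E 1 = A" "E 2 = B" "E 3 = C" "v 1 = x" "v 2 = y" "v 3 = z" by (simp_all add: E_def v_def)
  have d: "A \<noteq> B" "B \<noteq> C" "A \<noteq> C" "x \<noteq> y" "y \<noteq> z" "x \<noteq> z" using assms xyz by auto
  have lt: "{1..<3} = {1, 2::nat}" by auto
  have "Berge_cycle k 3 E"
    unfolding Berge_cycle_def atLeastAtMost_1_3 lt
  proof (intro conjI exI[of _ v])
    show "\<forall>i\<in>{1, 2}. v i \<in> E i \<inter> E (i + 1)" using xyz E by (simp add: numeral_3_eq_3 numeral_2_eq_2)
  qed (use assms xyz d E in \<open>auto simp: inj_on_def\<close>)
  moreover have "\<forall>i\<in>{1..3}. \<forall>j\<in>{1..3}. i \<noteq> j \<longrightarrow> (E i \<inter> E j \<noteq> {} \<longleftrightarrow> cyclically_adjacent 3 i j)"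
    unfolding atLeastAtMost_1_3 using assms by (simp add: E cyclically_adjacent_def Int_commute insert_commute del: One_nat_def)
  moreover have "(\<Inter>i\<in>{1..3}. E i) = {}" "E ` {1..3} = {A, B, C}"
    unfolding atLeastAtMost_1_3 using assms(7) by (simp_all add: E Int_assoc del: One_nat_def)
  ultimately show ?thesis unfolding minimal_cycles_def mem_Collect_eq by (intro exI[of _ E] conjI) simp_all
qed

lemma linear_cycles_3I:
  assumes "A \<in> nsets UNIV k" "B \<in> nsets UNIV k" "C \<in> nsets UNIV k"
    and "card (A \<inter> B) = 1" "card (B \<inter> C) = 1" "card (C \<inter> A) = 1" "A \<inter> B \<inter> C = {}"
  shows "{A, B, C} \<in> linear_cycles k 3"
proof -
  define E where "E = (\<lambda>i::nat. if i = 1 then A else if i = 2 then B else C)"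
  obtain x y z where xyz: "x \<in> A \<inter> B" "y \<in> B \<inter> C" "z \<in> C \<inter> A"
    using assms(4-6) by (metis card_1_singletonE insertI1)
  define v where "v = (\<lambda>i::nat. if i = 1 then x else if i = 2 then y else z)"
  have E: "E 1 = A" "E 2 = B" "E 3 = C" "v 1 = x" "v 2 = y" "v 3 = z" by (simp_all add: E_def v_def)
  have d: "A \<noteq> B" "B \<noteq> C" "A \<noteq> C" "x \<noteq> y" "y \<noteq> z" "x \<noteq> z" using assms(7) xyz by auto
  have lt: "{1..<3} = {1, 2::nat}" by auto
  have "Berge_cycle k 3 E"
    unfolding Berge_cycle_def atLeastAtMost_1_3 lt
  proof (intro conjI exI[of _ v])
    show "\<forall>i\<in>{1, 2}. v i \<in> E i \<inter> E (i + 1)" using xyz E by (simp add: numeral_3_eq_3 numeral_2_eq_2)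
  qed (use assms xyz d E in \<open>auto simp: inj_on_def\<close>)
  moreover have "\<forall>i\<in>{1..3}. \<forall>j\<in>{1..3}. i \<noteq> j \<longrightarrow>
      card (E i \<inter> E j) = (if cyclically_adjacent 3 i j then 1 else 0)"
    unfolding atLeastAtMost_1_3 using assms by (simp add: E cyclically_adjacent_def Int_commute insert_commute del: One_nat_def)
  moreover have "E ` {1..3} = {A, B, C}"
    unfolding atLeastAtMost_1_3 by (simp add: E del: One_nat_def)
  ultimately show ?thesis unfolding linear_cycles_def mem_Collect_eq by (intro exI[of _ E] conjI) simp_all
qed

text \<open>A path on three edges is closed up to a 4-cycle by an edge through fresh vertices.\<close>

lemma close_path:
  assumes A: "A \<in> nsets UNIV k" and B: "B \<in> nsets UNIV k" and C: "C \<in> nsets (UNIV :: nat set) k" and k: "2 \<le> k"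
    and AB: "A \<inter> B \<noteq> {}" and BC: "B \<inter> C \<noteq> {}" and AC: "A \<inter> C = {}"
  obtains E where "E 1 = A" "E 2 = B" "E 3 = C" "Berge_cycle k 4 E"
    "card (E 3 \<inter> E 4) = 1" "card (E 4 \<inter> E 1) = 1" "E 2 \<inter> E 4 = {}"
proof -
  have fin: "finite A" "finite B" "finite C" and crd: "card A = k" "card B = k" "card C = k"
    using A B C by (auto simp: nsets_def)
  have "A \<noteq> B" "B \<noteq> C" using AB BC AC by auto
  then have "\<not> A \<subseteq> B" "\<not> C \<subseteq> B" using fin crd card_subset_eq by metis+
  then obtain a c where ac: "a \<in> A" "a \<notin> B" "c \<in> C" "c \<notin> B" by blast
  \<comment> \<open>The closing edge may leave the vertex set of the host: the families of
    configurations live on all of \<open>nat\<close>, and only the three path edges have to lie in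
    the hypergraph. Its attaching vertices \<open>a\<close> and \<open>c\<close> were chosen off
    \<open>B\<close>, so it misses \<open>B\<close>.\<close>
  have "infinite (UNIV - (A \<union> B \<union> C))" using fin by (simp add: Diff_infinite_finite)
  then obtain S where S: "S \<subseteq> UNIV - (A \<union> B \<union> C)" "finite S" "card S = k - 2"
    by (meson infinite_arbitrarily_large)
  define D where "D = insert a (insert c S)"
  define E where "E = (\<lambda>i::nat. if i = 1 then A else if i = 2 then B else if i = 3 then C else D)"
  obtain x y where xy: "x \<in> A \<inter> B" "y \<in> B \<inter> C" using AB BC by blast
  define v where "v = (\<lambda>i::nat. if i = 1 then x else if i = 2 then y else if i = 3 then c else a)"
  have E: "E 1 = A" "E 2 = B" "E 3 = C" "E 4 = D" "v 1 = x" "v 2 = y" "v 3 = c" "v 4 = a" by (simp_all add: E_def v_def)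
  have aS: "a \<notin> S" "c \<notin> S" "a \<noteq> c" using S ac AC by auto
  have D: "D \<in> nsets UNIV k" using S aS k by (auto simp: nsets_def D_def)
  have CD: "C \<inter> D = {c}" and DA: "D \<inter> A = {a}" and BD: "B \<inter> D = {}" using S ac AC by (auto simp: D_def)
  have d: "A \<noteq> B" "B \<noteq> C" "A \<noteq> C" "D \<noteq> A" "D \<noteq> B" "D \<noteq> C" "x \<noteq> y" "x \<noteq> c" "x \<noteq> a" "y \<noteq> c" "y \<noteq> a" "c \<noteq> a"
    using AB BC AC ac xy aS by (auto simp: D_def)
  have lt: "{1..<4} = {1, 2, 3::nat}" by auto
  have "Berge_cycle k 4 E"
    unfolding Berge_cycle_def atLeastAtMost_1_4 lt
  proof (intro conjI exI[of _ v])
    show "\<forall>i\<in>{1, 2, 3}. v i \<in> E i \<inter> E (i + 1)" using xy E CD by (auto simp: E_def v_def)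
    show "inj_on E {1, 2, 3, 4}" "inj_on v {1, 2, 3, 4}"
      using d E by (simp_all add: inj_on_def)
    show "v 4 \<in> E 4 \<inter> E 1" using E DA by auto
  qed (use A B C D E in auto)
  then show ?thesis using that[of E] E CD DA BD by (metis card_1_singleton_iff is_singletonI is_singleton_altdef)
qed

lemma minimal_paths_3I:
  assumes "A \<in> nsets UNIV k" "B \<in> nsets UNIV k" "C \<in> nsets UNIV k" "2 \<le> k"
    and "A \<inter> B \<noteq> {}" "B \<inter> C \<noteq> {}" "A \<inter> C = {}"
  shows "{A, B, C} \<in> minimal_paths k 3"
proof -
  obtain E where E: "E 1 = A" "E 2 = B" "E 3 = C" "Berge_cycle k 4 E"
    "card (E 3 \<inter> E 4) = 1" "card (E 4 \<inter> E 1) = 1" "E 2 \<inter> E 4 = {}" using close_path[OF assms] by blast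
  have ne: "E 3 \<inter> E 4 \<noteq> {}" "E 4 \<inter> E 1 \<noteq> {}" using E(5,6) by auto
  have "\<forall>i\<in>{1..4}. \<forall>j\<in>{1..4}. i \<noteq> j \<longrightarrow> (E i \<inter> E j \<noteq> {} \<longleftrightarrow> cyclically_adjacent 4 i j)"
    unfolding atLeastAtMost_1_4 using assms(5-7) ne E(7)
    by (simp add: E(1-3) cyclically_adjacent_def Int_commute insert_commute doubleton_eq_iff del: One_nat_def)
  moreover have "(\<Inter>i\<in>{1..4}. E i) = {}" unfolding atLeastAtMost_1_4 using E(7) by auto
  ultimately have "E ` {1..4} \<in> minimal_cycles k (3 + 1)" using E(4)
    unfolding minimal_cycles_def mem_Collect_eq by (intro exI[of _ E] conjI) simp_all
  moreover have "E ` {1..4} - {E 4} = {A, B, C}"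
  proof -
    have "inj_on E {1, 2, 3, 4}" using E(4) unfolding Berge_cycle_def atLeastAtMost_1_4 by (elim conjE)
    then have "E 4 \<noteq> A" "E 4 \<noteq> B" "E 4 \<noteq> C"
      using inj_onD[of E "{1, 2, 3, 4}" 4] E(1-3) by fastforce+
    moreover have "E ` {1..4} = {A, B, C, E 4}" unfolding atLeastAtMost_1_4 using E(1-3) by simp
    ultimately show ?thesis by blast
  qed
  moreover have "E 4 \<in> E ` {1..4}" by simp
  ultimately show ?thesis unfolding minimal_paths_def by blast
qed

lemma linear_paths_3I:
  assumes "A \<in> nsets UNIV k" "B \<in> nsets UNIV k" "C \<in> nsets UNIV k" "2 \<le> k"
    and "card (A \<inter> B) = 1" "card (B \<inter> C) = 1" "A \<inter> C = {}"
  shows "{A, B, C} \<in> linear_paths k 3"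
proof -
  have "A \<inter> B \<noteq> {}" "B \<inter> C \<noteq> {}" using assms by auto
  then obtain E where E: "E 1 = A" "E 2 = B" "E 3 = C" "Berge_cycle k 4 E"
    "card (E 3 \<inter> E 4) = 1" "card (E 4 \<inter> E 1) = 1" "E 2 \<inter> E 4 = {}" using close_path[of A k B C] assms by blast
  have "\<forall>i\<in>{1..4}. \<forall>j\<in>{1..4}. i \<noteq> j \<longrightarrow> card (E i \<inter> E j) = (if cyclically_adjacent 4 i j then 1 else 0)"
    unfolding atLeastAtMost_1_4 using assms(5-7) E(5-7)
    by (simp add: E(1-3) cyclically_adjacent_def Int_commute insert_commute doubleton_eq_iff del: One_nat_def)
  then have "E ` {1..4} \<in> linear_cycles k (3 + 1)" using E(4)
    unfolding linear_cycles_def mem_Collect_eq by (intro exI[of _ E] conjI) simp_all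
  moreover have "E ` {1..4} - {E 4} = {A, B, C}"
  proof -
    have "inj_on E {1, 2, 3, 4}" using E(4) unfolding Berge_cycle_def atLeastAtMost_1_4 by (elim conjE)
    then have "E 4 \<noteq> A" "E 4 \<noteq> B" "E 4 \<noteq> C"
      using inj_onD[of E "{1, 2, 3, 4}" 4] E(1-3) by fastforce+
    moreover have "E ` {1..4} = {A, B, C, E 4}" unfolding atLeastAtMost_1_4 using E(1-3) by simp
    ultimately show ?thesis by blast
  qed
  moreover have "E 4 \<in> E ` {1..4}" by simp
  ultimately show ?thesis unfolding linear_paths_def by blast
qed

section \<open>Stars contain none of the configurations\<close>

lemma star_at_free_minimal_cycles: "star_at n k c \<in> free_hypergraphs n k (minimal_cycles k 3)"
proof -
  have "\<not> contains_copy (star_at n k c) G" if G: "G \<in> minimal_cycles k 3" for G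
  proof
    assume copy: "contains_copy (star_at n k c) G"
    obtain E :: "nat \<Rightarrow> nat set" where E: "G = E ` {1..3}" "(\<Inter>i\<in>{1..3}. E i) = {}" using G unfolding minimal_cycles_def mem_Collect_eq by (elim exE conjE) (rule that)
    have "G \<noteq> {}" using E(1) by simp
    then obtain z where z: "\<And>A. A \<in> G \<Longrightarrow> z \<in> A" using contains_copy_star_at[OF copy] by blast
    have "z \<in> (\<Inter>i\<in>{1..3}. E i)" using z E(1) by simp
    then show False unfolding E(2) by blast
  qed
  then show ?thesis by (auto simp: free_hypergraphs_def star_at_def)
qed

lemma star_at_free_linear_cycles: "star_at n k c \<in> free_hypergraphs n k (linear_cycles k 3)"
proof -
  have "\<not> contains_copy (star_at n k c) G" if G: "G \<in> linear_cycles k 3" for G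
  proof
    assume copy: "contains_copy (star_at n k c) G"
    obtain E :: "nat \<Rightarrow> nat set" where E: "G = E ` {1..3}" "Berge_cycle k 3 E"
      "\<forall>i\<in>{1..3}. \<forall>j\<in>{1..3}. i \<noteq> j \<longrightarrow> card (E i \<inter> E j) = (if cyclically_adjacent 3 i j then 1 else 0)"
      using G unfolding linear_cycles_def mem_Collect_eq by (elim exE conjE) (rule that)
    have "G \<noteq> {}" using E(1) by simp
    then obtain z where "\<And>A. A \<in> G \<Longrightarrow> z \<in> A" using contains_copy_star_at[OF copy] by blast
    then have z: "z \<in> E 1 \<inter> E 2" "z \<in> E 2 \<inter> E 3" using E(1) by auto
    obtain v where v: "inj_on v {1..3}" "\<forall>i\<in>{1..<3}. v i \<in> E i \<inter> E (i + 1)"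
      using E(2) unfolding Berge_cycle_def by blast
    have "v 1 \<in> E 1 \<inter> E (1 + 1)" "v 2 \<in> E 2 \<inter> E (2 + 1)" using v(2)[rule_format, of 1] v(2)[rule_format, of 2] by auto
    then have v12: "v 1 \<in> E 1 \<inter> E 2" "v 2 \<in> E 2 \<inter> E 3" by (simp_all only: one_add_one) (simp add: eval_nat_numeral)
    have "card (E 1 \<inter> E 2) = 1" "card (E 2 \<inter> E 3) = 1"
      using E(3)[rule_format, of 1 2] E(3)[rule_format, of 2 3] by (simp_all add: cyclically_adjacent_def)
    then have "v 1 = z" "v 2 = z" using z v12 by (metis card_1_singletonE singletonD)+
    then show False using inj_onD[OF v(1), of 1 2] by simp
  qed
  then show ?thesis by (auto simp: free_hypergraphs_def star_at_def)
qed

text \<open>Deleting one edge of a 4-cycle leaves one of its two pairs of opposite edges intact.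
  These are disjoint, while a copy in a star has a vertex common to all edges.\<close>

lemma star_at_no_copy_of_path:
  fixes E :: "nat \<Rightarrow> nat set"
  assumes C: "C = E ` {1..4}" "inj_on E {1..4}" "E 1 \<inter> E 3 = {}" "E 2 \<inter> E 4 = {}" "D \<in> C"
  shows "\<not> contains_copy (star_at n k c) (C - {D})"
proof
  assume copy: "contains_copy (star_at n k c) (C - {D})"
  obtain m where m: "m \<in> {1..4}" "D = E m" using C by blast
  have mem: "E i \<in> C - {D}" if "i \<in> {1..4}" "i \<noteq> m" for i
    using that m C(1) inj_onD[OF C(2), of i m] by auto
  have ne: "C - {D} \<noteq> {}" using mem[of 1] mem[of 2] by (cases "m = 1") auto
  obtain z where z: "\<And>A. A \<in> C - {D} \<Longrightarrow> z \<in> A" using contains_copy_star_at[OF copy ne] by blast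
  have "m \<noteq> 1 \<and> m \<noteq> 3 \<or> m \<noteq> 2 \<and> m \<noteq> 4" by auto
  then show False
  proof
    assume "m \<noteq> 1 \<and> m \<noteq> 3"
    then have "z \<in> E 1" "z \<in> E 3" using z mem[of 1] mem[of 3] by simp_all
    then show False using C(3) by blast
  next
    assume "m \<noteq> 2 \<and> m \<noteq> 4"
    then have "z \<in> E 2" "z \<in> E 4" using z mem[of 2] mem[of 4] by simp_all
    then show False using C(4) by blast
  qed
qed

lemma star_at_free_minimal_paths: "star_at n k c \<in> free_hypergraphs n k (minimal_paths k 3)"
proof -
  have "\<not> contains_copy (star_at n k c) G" if G: "G \<in> minimal_paths k 3" for G
  proof -
    have "\<exists>C D. G = C - {D} \<and> C \<in> minimal_cycles k 4 \<and> D \<in> C"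
      using that by (simp add: minimal_paths_def)
    then obtain C D where G: "G = C - {D}" "C \<in> minimal_cycles k 4" "D \<in> C" by blast
    then obtain E :: "nat \<Rightarrow> nat set" where E: "C = E ` {1..4}" "inj_on E {1..4}"
      "\<forall>i\<in>{1..4}. \<forall>j\<in>{1..4}. i \<noteq> j \<longrightarrow> (E i \<inter> E j \<noteq> {} \<longleftrightarrow> cyclically_adjacent 4 i j)"
      unfolding minimal_cycles_def Berge_cycle_def by (simp only: mem_Collect_eq) blast
    have "E 1 \<inter> E 3 = {}" "E 2 \<inter> E 4 = {}"
      using E(3)[rule_format, of 1 3] E(3)[rule_format, of 2 4]
      by (auto simp: cyclically_adjacent_def doubleton_eq_iff)
    then show ?thesis using star_at_no_copy_of_path E G by metis
  qed
  then show ?thesis by (auto simp: free_hypergraphs_def star_at_def)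
qed

lemma star_at_free_linear_paths: "star_at n k c \<in> free_hypergraphs n k (linear_paths k 3)"
proof -
  have "\<not> contains_copy (star_at n k c) G" if G: "G \<in> linear_paths k 3" for G
  proof -
    have "\<exists>C D. G = C - {D} \<and> C \<in> linear_cycles k 4 \<and> D \<in> C"
      using that by (simp add: linear_paths_def)
    then obtain C D where G: "G = C - {D}" "C \<in> linear_cycles k 4" "D \<in> C" by blast
    then obtain E :: "nat \<Rightarrow> nat set" where E: "C = E ` {1..4}" "inj_on E {1..4}" "\<forall>i\<in>{1..4}. E i \<in> nsets UNIV k"
      "\<forall>i\<in>{1..4}. \<forall>j\<in>{1..4}. i \<noteq> j \<longrightarrow> card (E i \<inter> E j) = (if cyclically_adjacent 4 i j then 1 else 0)"
      unfolding linear_cycles_def Berge_cycle_def by (simp only: mem_Collect_eq) blast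
    have "finite (E 1)" "finite (E 2)" using E(3) by (auto simp: nsets_def)
    then have "E 1 \<inter> E 3 = {}" "E 2 \<inter> E 4 = {}"
      using E(4)[rule_format, of 1 3] E(4)[rule_format, of 2 4]
      by (auto simp: cyclically_adjacent_def doubleton_eq_iff card_eq_0_iff)
    then show ?thesis using star_at_no_copy_of_path E G by metis
  qed
  then show ?thesis by (auto simp: free_hypergraphs_def star_at_def)
qed

section \<open>Intersection properties of hypergraphs without the configurations\<close>

lemma nsets_UNIV: "A \<in> nsets V k \<Longrightarrow> A \<in> nsets UNIV k"
  by (auto simp: nsets_def)

lemma free_no_triangle:
  assumes "H \<in> free_hypergraphs n k (minimal_cycles k 3)" "A \<in> H" "B \<in> H" "C \<in> H"
    "A \<inter> B \<noteq> {}" "B \<inter> C \<noteq> {}" "C \<inter> A \<noteq> {}"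
  shows "A \<inter> B \<inter> C \<noteq> {}"
proof
  assume "A \<inter> B \<inter> C = {}"
  moreover have "A \<in> nsets UNIV k" "B \<in> nsets UNIV k" "C \<in> nsets UNIV k"
    using assms(1-4) nsets_UNIV unfolding free_hypergraphs_def by blast+
  ultimately have "{A, B, C} \<in> minimal_cycles k 3" using minimal_cycles_3I assms by blast
  moreover have "contains_copy H {A, B, C}" using assms by (intro contains_copyI) auto
  ultimately show False using assms(1) by (auto simp: free_hypergraphs_def)
qed

lemma free_no_linear_triangle:
  assumes "H \<in> free_hypergraphs n k (linear_cycles k 3)" "A \<in> H" "B \<in> H" "C \<in> H"
    "card (A \<inter> B) = 1" "card (B \<inter> C) = 1" "card (C \<inter> A) = 1"
  shows "A \<inter> B \<inter> C \<noteq> {}"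
proof
  assume "A \<inter> B \<inter> C = {}"
  moreover have "A \<in> nsets UNIV k" "B \<in> nsets UNIV k" "C \<in> nsets UNIV k"
    using assms(1-4) nsets_UNIV unfolding free_hypergraphs_def by blast+
  ultimately have "{A, B, C} \<in> linear_cycles k 3" using linear_cycles_3I assms by blast
  moreover have "contains_copy H {A, B, C}" using assms by (intro contains_copyI) auto
  ultimately show False using assms(1) by (auto simp: free_hypergraphs_def)
qed

lemma free_no_path:
  assumes "H \<in> free_hypergraphs n k (minimal_paths k 3)" "2 \<le> k" "A \<in> H" "B \<in> H" "C \<in> H"
    "A \<inter> B \<noteq> {}" "B \<inter> C \<noteq> {}"
  shows "A \<inter> C \<noteq> {}"
proof
  assume "A \<inter> C = {}"
  moreover have "A \<in> nsets UNIV k" "B \<in> nsets UNIV k" "C \<in> nsets UNIV k"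
    using assms(1,3-5) nsets_UNIV unfolding free_hypergraphs_def by blast+
  ultimately have "{A, B, C} \<in> minimal_paths k 3" using minimal_paths_3I assms by blast
  moreover have "contains_copy H {A, B, C}" using assms by (intro contains_copyI) auto
  ultimately show False using assms(1) by (auto simp: free_hypergraphs_def)
qed

lemma free_no_linear_path:
  assumes "H \<in> free_hypergraphs n k (linear_paths k 3)" "2 \<le> k" "A \<in> H" "B \<in> H" "C \<in> H"
    "card (A \<inter> B) = 1" "card (B \<inter> C) = 1"
  shows "A \<inter> C \<noteq> {}"
proof
  assume "A \<inter> C = {}"
  moreover have "A \<in> nsets UNIV k" "B \<in> nsets UNIV k" "C \<in> nsets UNIV k"
    using assms(1,3-5) nsets_UNIV unfolding free_hypergraphs_def by blast+
  ultimately have "{A, B, C} \<in> linear_paths k 3" using linear_paths_3I assms by blast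
  moreover have "contains_copy H {A, B, C}" using assms by (intro contains_copyI) auto
  ultimately show False using assms(1) by (auto simp: free_hypergraphs_def)
qed

section \<open>Minimal paths\<close>

text \<open>Says that \<open>(m - 1 choose j) / m\<close> does not decrease with \<open>m\<close>.
  This compares the bound on a small support with its proportional share of the bound on all
  vertices.\<close>

lemma binomial_ratio_mono:
  fixes p n j :: nat
  assumes "1 \<le> j" "1 \<le> p" "p \<le> n"
  shows "n * (p - 1 choose j) \<le> p * (n - 1 choose j)"
  using assms(3)
proof (induction n rule: dec_induct)
  case (step n)
  have "(n + 1) * (n - 1 choose j) \<le> n * (n choose j)"
  proof (cases "j \<le> n")
    case True
    have "n * (n choose j) = (n - j) * (n choose j) + j * (n choose j)"
      using True by (simp flip: distrib_right)
    also have "\<dots> = n * (n - 1 choose j) + j * (n choose j)" by (simp add: binomial_absorb_comp)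
    finally have "n * (n choose j) = n * (n - 1 choose j) + j * (n choose j)" .
    moreover have "1 * (n - 1 choose j) \<le> j * (n choose j)" using assms(1) by (intro mult_mono binomial_right_mono) auto
    ultimately show ?thesis by simp
  next
    case False
    then have "n - 1 choose j = 0" by (intro binomial_eq_0) simp
    then show ?thesis by (simp only: mult_0_right)
  qed
  then have "p * ((n + 1) * (n - 1 choose j)) \<le> p * (n * (n choose j))" by (rule mult_le_mono2)
  moreover have "(n + 1) * (n * (p - 1 choose j)) \<le> (n + 1) * (p * (n - 1 choose j))" by (intro mult_le_mono2 step.IH)
  ultimately have "n * ((n + 1) * (p - 1 choose j)) \<le> n * (p * (n choose j))" by (simp only: ac_simps)
  moreover have "0 < n" using step assms by linarith
  ultimately show ?case by simp
qed simp

lemma binomial_add_ge: "(a choose Suc r) + j * (a choose r) \<le> (a + j choose Suc r)"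
proof (induction j)
  case (Suc j)
  have "a choose r \<le> a + j choose r" by (intro binomial_right_mono) simp
  with Suc show ?case by simp
qed simp

text \<open>The bound is the share \<open>card U / n\<close> of the target, so that the bounds for
  disjoint supports add up. At least \<open>k\<close> vertices outside the support make up for the
  missing Erdos-Ko-Rado bound when \<open>card U < 2 * k\<close>.\<close>

lemma card_le_of_small_support:
  assumes "finite U" "c \<subseteq> nsets U k" and c: "\<And>A B. A \<in> c \<Longrightarrow> B \<in> c \<Longrightarrow> A \<inter> B \<noteq> {}"
    and k: "3 \<le> k" "k \<le> card U" "card U + k \<le> n"
  shows "n * card c \<le> card U * (n - 1 choose (k - 1))"
proof (cases "2 * k \<le> card U")
  case True
  have "card c \<le> (card U - 1 choose (k - 1))"
    using Erdos_Ko_Rado_bound[of U c k] assms True by auto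
  then have "n * card c \<le> n * (card U - 1 choose (k - 1))" by simp
  also have "\<dots> \<le> card U * (n - 1 choose (k - 1))" using k by (intro binomial_ratio_mono) auto
  finally show ?thesis .
next
  case False
  define p where "p = card U"
  define r where "r = k - 2"
  have r: "k = Suc (Suc r)" "1 \<le> r" using k by (auto simp: r_def)
  have p: "k \<le> p" "p < 2 * k" "p + k \<le> n" using k False by (auto simp: p_def)
  \<comment> \<open>Below \<open>2 * k\<close> any two \<open>k\<close>-subsets of \<open>U\<close>
    meet, so only the trivial bound is available.\<close>
  have "card c \<le> card (nsets U k)" using assms by (intro card_mono finite_imp_finite_nsets)
  then have c1: "card c \<le> (p choose k)" using assms(1) by (simp add: card_nsets p_def)
  have abs: "k * (p choose k) = p * (p - 1 choose (k - 1))"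
    using binomial_absorption[of "k - 1" p] k by simp
  have "(k - 1) * (p - 1 choose (k - 1)) = (p - 1 - r) * (p - 1 choose r)"
    using binomial_absorption[of r "p - 1"] binomial_absorb_comp[of "p - 1" r] r by simp
  also have "\<dots> \<le> k * (p - 1 choose r)" using p r by (intro mult_right_mono) auto
  finally have "2 * (p - 1 choose (k - 1)) \<le> k * (p - 1 choose r)"
    using mult_right_mono[of 2 "k - 1" "p - 1 choose (k - 1)"] k by linarith
  moreover have "(p - 1 choose (k - 1)) + k * (p - 1 choose r) \<le> (p - 1 + k choose (k - 1))"
    using binomial_add_ge[of "p - 1" r k] r by simp
  moreover have "p - 1 + k = p + k - 1" using p k by simp
  ultimately have "3 * (p - 1 choose (k - 1)) \<le> (p + k - 1 choose (k - 1))" by simp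
  then have "k * (3 * (p - 1 choose (k - 1))) \<le> k * (p + k - 1 choose (k - 1))" by (rule mult_le_mono2)
  moreover have "(p + k) * (p - 1 choose (k - 1)) \<le> (3 * k) * (p - 1 choose (k - 1))" using p by (intro mult_le_mono1) simp
  ultimately have a: "(p + k) * (p - 1 choose (k - 1)) \<le> k * (p + k - 1 choose (k - 1))" by (simp only: ac_simps)
  \<comment> \<open>\<open>a\<close> is the estimate for \<open>n = p + k\<close>, where
    \<open>p + k < 3 * k\<close> is met by the factor 3 gained above; the ratio lemma extends it to
    larger \<open>n\<close>.\<close>
  have b: "n * (p + k - 1 choose (k - 1)) \<le> (p + k) * (n - 1 choose (k - 1))"
    using p k by (intro binomial_ratio_mono) auto
  have "(p + k) * (n * (p - 1 choose (k - 1))) \<le> n * (k * (p + k - 1 choose (k - 1)))"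
    using mult_le_mono2[OF a, of n] by (simp only: ac_simps)
  also have "\<dots> \<le> (p + k) * (k * (n - 1 choose (k - 1)))"
    using mult_le_mono2[OF b, of k] by (simp only: ac_simps)
  finally have "n * (p - 1 choose (k - 1)) \<le> k * (n - 1 choose (k - 1))" using k by simp
  then have "p * (n * (p - 1 choose (k - 1))) \<le> p * (k * (n - 1 choose (k - 1)))" by (rule mult_le_mono2)
  then have "k * (n * (p choose k)) \<le> k * (p * (n - 1 choose (k - 1)))"
    using arg_cong[OF abs, of "\<lambda>t. n * t"] by (simp only: ac_simps)
  then have "n * (p choose k) \<le> p * (n - 1 choose (k - 1))" using k by simp
  with c1 show ?thesis unfolding p_def by (meson le_trans mult_le_mono2)
qed

definition meeting_transitive :: "'a set set \<Rightarrow> bool" where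
  "meeting_transitive F \<longleftrightarrow> (\<forall>A\<in>F. \<forall>B\<in>F. \<forall>C\<in>F. A \<inter> B \<noteq> {} \<longrightarrow> B \<inter> C \<noteq> {} \<longrightarrow> A \<inter> C \<noteq> {})"

lemma meeting_transitiveD:
  "meeting_transitive F \<Longrightarrow> A \<in> F \<Longrightarrow> B \<in> F \<Longrightarrow> C \<in> F \<Longrightarrow> A \<inter> B \<noteq> {} \<Longrightarrow> B \<inter> C \<noteq> {} \<Longrightarrow> A \<inter> C \<noteq> {}"
  unfolding meeting_transitive_def by blast

lemma meeting_transitive_mono: "meeting_transitive F \<Longrightarrow> G \<subseteq> F \<Longrightarrow> meeting_transitive G"
  unfolding meeting_transitive_def by blast

lemma meeting_class:
  assumes V: "finite V" "F \<subseteq> nsets V k" "0 < k" "A \<in> F"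
    and mt: "meeting_transitive F"
  defines "c \<equiv> {B \<in> F. B \<inter> A \<noteq> {}}"
  shows "A \<in> c" "\<And>B C. B \<in> c \<Longrightarrow> C \<in> c \<Longrightarrow> B \<inter> C \<noteq> {}" "c \<subseteq> nsets (\<Union>c) k" "\<Union>c \<subseteq> V"
    "k \<le> card (\<Union>c)" "F - c \<subseteq> nsets (V - \<Union>c) k"
proof -
  note tr = meeting_transitiveD[OF mt]
  have Fk: "finite B" "card B = k" "B \<subseteq> V" "B \<noteq> {}" if "B \<in> F" for B
    using V that by (auto simp: nsets_def)
  show Ac: "A \<in> c" using V(4) Fk by (auto simp: c_def)
  show "B \<inter> C \<noteq> {}" if "B \<in> c" "C \<in> c" for B C using tr[of B A C] that V(4) unfolding c_def by blast
  show "c \<subseteq> nsets (\<Union>c) k"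
  proof
    fix B assume B: "B \<in> c"
    then have "B \<in> F" unfolding c_def by blast
    moreover have "B \<subseteq> \<Union>c" using B by blast
    ultimately show "B \<in> nsets (\<Union>c) k" using Fk unfolding nsets_def by blast
  qed
  show UV: "\<Union>c \<subseteq> V" using Fk unfolding c_def by blast
  then have "finite (\<Union>c)" using V(1) finite_subset by blast
  then show "k \<le> card (\<Union>c)" using card_mono[of "\<Union>c" A] Ac Fk[OF V(4)] Union_upper[of A c] by simp
  show "F - c \<subseteq> nsets (V - \<Union>c) k"
  proof
    fix B assume B: "B \<in> F - c"
    then have "B \<inter> C = {}" if "C \<in> c" for C using tr[of B C A] that V(4) B unfolding c_def by blast
    then have "B \<subseteq> V - \<Union>c" using Fk(3)[of B] B by blast
    then show "B \<in> nsets (V - \<Union>c) k" using Fk[of B] B unfolding nsets_def by blast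
  qed
qed

text \<open>Removes one class and its support at a time; the premise on \<open>card V + k\<close>
  survives because \<open>V\<close> shrinks. It fails for the full vertex set, so the first class
  has to be split off separately.\<close>

lemma card_le_of_transitive_meeting:
  assumes "finite V" "F \<subseteq> nsets V k" "3 \<le> k" "card V + k \<le> n"
    and "meeting_transitive F"
  shows "n * card F \<le> card V * (n - 1 choose (k - 1))"
  using assms
proof (induction "card V" arbitrary: V F rule: less_induct)
  case less
  show ?case
  proof (cases "F = {}")
    case False
    then obtain A where A: "A \<in> F" by blast
    define c where "c = {B \<in> F. B \<inter> A \<noteq> {}}"
    define U where "U = \<Union>c"
    note mc = meeting_class[OF less.prems(1,2) _ A less.prems(5), folded c_def U_def]
    have k: "0 < k" using less.prems by simp
    note mc = mc[OF k]
    have fU: "finite U" using less.prems(1) mc(4) finite_subset by blast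
    have cU: "card U \<le> card V" using less.prems(1) mc(4) card_mono by blast
    have "n * card c \<le> card U * (n - 1 choose (k - 1))"
      using card_le_of_small_support[of U c k n] fU mc less.prems cU by fastforce
    moreover have "n * card (F - c) \<le> card (V - U) * (n - 1 choose (k - 1))"
    proof (rule less.hyps)
      show "card (V - U) < card V" using fU mc(4,5) k cU by (simp add: card_Diff_subset)
      then show "card (V - U) + k \<le> n" using less.prems by simp
    qed (use less.prems mc meeting_transitive_mono[of F "F - c"] in auto)
    moreover have "finite F" using less.prems finite_subset finite_imp_finite_nsets by metis
    then have "card F = card c + card (F - c)"
      by (subst card_Un_disjoint[symmetric]) (auto simp: c_def intro: arg_cong[where f = card])
    moreover have "card V = card U + card (V - U)" using fU cU mc(4) by (simp add: card_Diff_subset)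
    ultimately show ?thesis by (simp add: distrib_left distrib_right)
  qed simp
qed

text \<open>Without a path, meeting is transitive. A single class is an intersecting family on
  \<open>n \<ge> 2 * k\<close> vertices. With more classes, an edge outside the first class and the
  support of the first class each occupy \<open>k\<close> vertices, so both parts satisfy the
  premise of the proportional bound.\<close>

lemma minimal_path_free_card_le:
  assumes k: "3 \<le> k" "2 * k \<le> n" and H: "H \<in> free_hypergraphs n k (minimal_paths k 3)"
  shows "card H \<le> (n - 1 choose (k - 1))"
proof (cases "H = {}")
  case False
  let ?V = "{1..n}"
  have HV: "H \<subseteq> nsets ?V k" using H by (auto simp: free_hypergraphs_def)
  have tr: "meeting_transitive H"
    unfolding meeting_transitive_def
  proof (intro ballI impI)
    fix A B C assume "A \<in> H" "B \<in> H" "C \<in> H" "A \<inter> B \<noteq> {}" "B \<inter> C \<noteq> {}"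
    with k show "A \<inter> C \<noteq> {}" by (intro free_no_path[OF H, of A B C]) simp_all
  qed
  obtain A where A: "A \<in> H" using False by blast
  define c where "c = {B \<in> H. B \<inter> A \<noteq> {}}"
  define U where "U = \<Union>c"
  have k0: "0 < k" using k by simp
  note mc = meeting_class[OF finite_atLeastAtMost HV k0 A tr, folded c_def U_def]
  have fU: "finite U" using mc(4) finite_subset by blast
  show ?thesis
  proof (cases "c = H")
    case True
    then show ?thesis using Erdos_Ko_Rado_bound[of ?V H k] HV mc(2) k by auto
  next
    case False
    then obtain B where B: "B \<in> H - c" by (auto simp: c_def)
    then have BU: "B \<subseteq> ?V - U" "card B = k" using mc(6) by (auto simp: nsets_def)
    have "card (?V - U) = n - card U" using fU mc(4) by (simp add: card_Diff_subset)
    moreover have "k \<le> card (?V - U)" using card_mono[of "?V - U" B] BU by simp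
    ultimately have cU: "card U + k \<le> n" "card (?V - U) + k \<le> n" "card (?V - U) + card U = n"
      using mc(5) k by linarith+
    have "n * card c \<le> card U * (n - 1 choose (k - 1))"
      using card_le_of_small_support[of U c k n] fU mc k cU by fastforce
    moreover have "n * card (H - c) \<le> card (?V - U) * (n - 1 choose (k - 1))"
      by (rule card_le_of_transitive_meeting) (use mc k cU meeting_transitive_mono[OF tr, of "H - c"] in auto)
    moreover have "finite H" using HV finite_subset finite_imp_finite_nsets finite_atLeastAtMost by metis
    then have "card H = card c + card (H - c)"
      by (subst card_Un_disjoint[symmetric]) (auto simp: c_def intro: arg_cong[where f = card])
    ultimately have "n * card H \<le> (card (?V - U) + card U) * (n - 1 choose (k - 1))"
      by (simp add: distrib_left distrib_right)
    then show ?thesis using cU k by simp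
  qed
qed simp

theorem exco2_minimal_paths:
  assumes k: "3 \<le> k" "2 * k \<le> n"
  shows "exco2 n k (minimal_paths k 3) = star_co2 n k" "extremal n k (minimal_paths k 3) (star n k)"
    and "2 * k < n \<Longrightarrow> extremal n k (minimal_paths k 3) H \<longleftrightarrow> isomorphic_on n H (star n k)"
proof -
  have kn: "k + 2 \<le> n" using k by simp
  note ex = extremal_iff_star[OF k(1) kn star_at_free_minimal_paths disjI1[OF minimal_path_free_card_le[OF k]]]
  show "exco2 n k (minimal_paths k 3) = star_co2 n k" "extremal n k (minimal_paths k 3) (star n k)"
    by (rule ex; assumption)+
  show "extremal n k (minimal_paths k 3) H \<longleftrightarrow> isomorphic_on n H (star n k)" if "2 * k < n"
    using ex(3) that by simp
qed

section \<open>Minimal cycles\<close>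

lemma sum_card_incidence:
  assumes "finite A" "finite U"
  shows "(\<Sum>v\<in>U. card {W \<in> A. v \<in> W}) = (\<Sum>W\<in>A. card (W \<inter> U))"
proof -
  have "(\<Sum>v\<in>U. card {W \<in> A. v \<in> W}) = (\<Sum>v\<in>U. \<Sum>W\<in>A. if v \<in> W then 1 else 0)"
    using assms by (intro sum.cong refl) (simp add: sum.If_cases Int_def)
  also have "\<dots> = (\<Sum>W\<in>A. \<Sum>v\<in>U. if v \<in> W then 1 else 0)" by (rule sum.swap)
  also have "\<dots> = (\<Sum>W\<in>A. card (W \<inter> U))"
    using assms by (intro sum.cong refl) (simp add: sum.If_cases Int_commute)
  finally show ?thesis .
qed

lemma nsets_trace_eq_image:
  assumes "a \<in> T" "T \<subseteq> X" "0 < r"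
  shows "{W \<in> nsets X r. W \<inter> T = {a}} = insert a ` nsets (X - T) (r - 1)"
proof (intro equalityI subsetI)
  fix W assume W: "W \<in> {W \<in> nsets X r. W \<inter> T = {a}}"
  then have "a \<in> W" by blast
  then have "W = insert a (W - {a})" "W - {a} \<in> nsets (X - T) (r - 1)" using W by (auto simp: nsets_def)
  then show "W \<in> insert a ` nsets (X - T) (r - 1)" by blast
next
  fix W assume "W \<in> insert a ` nsets (X - T) (r - 1)"
  then obtain B where B: "W = insert a B" "B \<subseteq> X - T" "finite B" "card B = r - 1" by (auto simp: nsets_def)
  then have "a \<notin> B" using assms by blast
  then show "W \<in> {W \<in> nsets X r. W \<inter> T = {a}}" using assms B by (auto simp: nsets_def)
qed

lemma card_nsets_trace:
  assumes "finite X" "a \<in> T" "T \<subseteq> X" "0 < r"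
  shows "card {W \<in> nsets X r. W \<inter> T = {a}} = (card X - card T choose (r - 1))"
proof -
  have "inj_on (insert a) (nsets (X - T) (r - 1))"
  proof (rule inj_onI)
    fix A B assume "A \<in> nsets (X - T) (r - 1)" "B \<in> nsets (X - T) (r - 1)" "insert a A = insert a B"
    moreover from this have "a \<notin> A" "a \<notin> B" using assms(2) by (auto simp: nsets_def)
    ultimately show "A = B" by (metis insert_ident)
  qed
  moreover have "finite T" using assms finite_subset by blast
  ultimately show ?thesis
    using assms by (simp add: nsets_trace_eq_image card_image card_nsets card_Diff_subset)
qed

lemma card_nsets_containing:
  assumes "finite X" "a \<in> X" "0 < r"
  shows "card {W \<in> nsets X r. a \<in> W} = (card X - 1 choose (r - 1))"
proof -
  have "{W \<in> nsets X r. a \<in> W} = {W \<in> nsets X r. W \<inter> {a} = {a}}" by auto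
  then show ?thesis using card_nsets_trace[of X a "{a}" r] assms by simp
qed

lemma binomial_ge_upper:
  assumes "1 \<le> j" "j < v"
  shows "v \<le> (v choose j)"
  using assms
proof (induction v arbitrary: j)
  case (Suc v)
  obtain i where i: "j = Suc i" using Suc.prems by (cases j) auto
  show ?case
  proof (cases "j = v")
    case True
    then show ?thesis by (simp add: binomial_symmetric[of v "Suc v"])
  next
    case False
    then have "v \<le> (v choose j)" using Suc by simp
    moreover have "0 < (v choose i)" using i Suc.prems by simp
    ultimately show ?thesis unfolding i binomial_Suc_Suc by linarith
  qed
qed simp

lemma binomial_ge_Suc_upper:
  assumes "2 \<le> j" "j + 2 \<le> v"
  shows "v + 1 \<le> (v choose j)"
proof -
  obtain i w where iw: "j = Suc i" "v = Suc w" using assms by (cases j; cases v) auto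
  have "w \<le> (w choose j)" "w \<le> (w choose i)" using assms iw by (auto intro!: binomial_ge_upper)
  then show ?thesis using iw assms by simp
qed

text \<open>A variant with \<open>m - r\<close> in the denominator, as required by the factor
  \<open>card X - r\<close> in the link bounds. A single step reduces to
  \<open>(m + 1 - r) * (m + 1 - r) \<le> (m - r) * m\<close>, and there \<open>3 \<le> r\<close> and
  \<open>2 * r \<le> m\<close> enter.\<close>

lemma binomial_ratio_mono':
  fixes p m r :: nat
  assumes r: "3 \<le> r" "2 * r \<le> p" and "p \<le> m"
  shows "(m - r) * (p - 1 choose (r - 1)) \<le> (p - r) * (m - 1 choose (r - 1))"
  using assms(3)
proof (induction m rule: dec_induct)
  case (step m)
  define q where "q = r - 1"
  have key: "(m + 1 - r) * (m - 1 choose q) \<le> (m - r) * (m choose q)"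
  proof -
    obtain d where d: "m = 2 * r + d" using step r le_Suc_ex[of "2 * r" m] by auto
    obtain s where s: "r = 3 + s" using r le_Suc_ex by blast
    have "(m + 1 - r) * (m + 1 - r) \<le> (m - r) * m"
      unfolding d s by (simp add: algebra_simps)
    then have "(m + 1 - r) * (m + 1 - r) * (m - 1 choose q) \<le> (m - r) * m * (m - 1 choose q)" by (rule mult_le_mono1)
    also have "\<dots> = (m - r) * ((m - q) * (m choose q))" using binomial_absorb_comp[of m q] by simp
    also have "m - q = m + 1 - r" using r by (simp add: q_def)
    finally have "(m + 1 - r) * ((m + 1 - r) * (m - 1 choose q)) \<le> (m + 1 - r) * ((m - r) * (m choose q))"
      by (simp only: ac_simps)
    moreover have "0 < m + 1 - r" using d r by simp
    ultimately show ?thesis by (metis nat_mult_le_cancel1)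
  qed
  have "(m + 1 - r) * ((m - r) * (p - 1 choose q)) \<le> (m + 1 - r) * ((p - r) * (m - 1 choose q))"
    using step.IH unfolding q_def by (rule mult_le_mono2)
  also have "\<dots> \<le> (p - r) * ((m - r) * (m choose q))"
    using mult_le_mono2[OF key, of "p - r"] by (simp only: ac_simps)
  finally have "(m - r) * ((m + 1 - r) * (p - 1 choose q)) \<le> (m - r) * ((p - r) * (m choose q))"
    by (simp only: ac_simps)
  moreover have "0 < m - r" using step r by simp
  ultimately show ?case by (simp add: q_def)
qed simp

text \<open>The link of a vertex: \<open>S\<close> consists of the members contained in an edge that misses the
  vertex, and \<open>C Y\<close> is such an edge for \<open>Y\<close>. The last assumption says that there is no triangle.\<close>

locale link_family =
  fixes X :: "'a set" and r :: nat and G S :: "'a set set" and C :: "'a set \<Rightarrow> 'a set"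
  assumes finite_X: "finite X" and r_ge: "2 \<le> r" and X_ge: "2 * r + 1 \<le> card X"
    and G_sub: "G \<subseteq> nsets X r" and S_sub: "S \<subseteq> G"
    and C_nsets: "Y \<in> S \<Longrightarrow> C Y \<in> nsets X (r + 1)" and sub_C: "Y \<in> S \<Longrightarrow> Y \<subseteq> C Y"
    and no_triangle: "Y \<in> S \<Longrightarrow> W \<in> G \<Longrightarrow> W' \<in> G \<Longrightarrow> W \<inter> C Y \<noteq> {} \<Longrightarrow> W' \<inter> C Y \<noteq> {} \<Longrightarrow> W \<inter> W' \<inter> C Y \<noteq> {}"
begin

abbreviation "nonmembers \<equiv> nsets X r - G"

abbreviation "codegree v \<equiv> card {W \<in> nonmembers. v \<in> W}"

abbreviation "cls Y \<equiv> {Z \<in> S. Z \<inter> Y \<noteq> {}}"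

lemma finite_nonmembers: "finite nonmembers" and finite_G: "finite G" and finite_S: "finite S"
  using finite_X finite_imp_finite_nsets[of X r] G_sub S_sub by (auto intro: finite_subset)

lemma meets_C_meets:
  assumes "Y \<in> S" "W \<in> G" "W \<inter> C Y \<noteq> {}"
  shows "W \<inter> Y \<noteq> {}"
proof -
  have "Y \<in> G" "Y \<noteq> {}" using assms(1) S_sub G_sub r_ge by (auto simp: nsets_def)
  then show ?thesis using no_triangle[of Y W Y] assms sub_C[of Y] by blast
qed

lemma meets_trans:
  assumes "Y \<in> S" "W \<in> G" "W' \<in> G" "W \<inter> Y \<noteq> {}" "W' \<inter> Y \<noteq> {}"
  shows "W \<inter> W' \<noteq> {}"
  using no_triangle[of Y W W'] assms sub_C[of Y] by blast

lemma meeting_transitive_S: "meeting_transitive S"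
  unfolding meeting_transitive_def
proof (intro ballI impI)
  fix A B D assume "A \<in> S" "B \<in> S" "D \<in> S" "A \<inter> B \<noteq> {}" "B \<inter> D \<noteq> {}"
  then show "A \<inter> D \<noteq> {}" using meets_trans[of B A D] S_sub by blast
qed

lemma cls_facts:
  assumes "Y \<in> S"
  shows "Y \<in> cls Y" "cls Y \<subseteq> nsets (\<Union>(cls Y)) r" "\<Union>(cls Y) \<subseteq> X"
    "r \<le> card (\<Union>(cls Y))" "S - cls Y \<subseteq> nsets (X - \<Union>(cls Y)) r" "finite (\<Union>(cls Y))"
    and "\<And>W Z. W \<in> G \<Longrightarrow> W \<inter> \<Union>(cls Y) \<noteq> {} \<Longrightarrow> Z \<in> cls Y \<Longrightarrow> W \<inter> Z \<noteq> {}"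
    and "\<And>W W'. W \<in> G \<Longrightarrow> W' \<in> G \<Longrightarrow> W \<inter> \<Union>(cls Y) \<noteq> {} \<Longrightarrow> W' \<inter> \<Union>(cls Y) \<noteq> {} \<Longrightarrow> W \<inter> W' \<noteq> {}"
proof -
  have "S \<subseteq> nsets X r" "0 < r" using S_sub G_sub r_ge by auto
  note mc = meeting_class[OF finite_X this assms meeting_transitive_S]
  show "Y \<in> cls Y" "cls Y \<subseteq> nsets (\<Union>(cls Y)) r" "\<Union>(cls Y) \<subseteq> X"
    "r \<le> card (\<Union>(cls Y))" "S - cls Y \<subseteq> nsets (X - \<Union>(cls Y)) r" by (rule mc)+
  show "finite (\<Union>(cls Y))" using mc(4) finite_X finite_subset by blast
  show W: "W \<inter> Z \<noteq> {}" if WZ: "W \<in> G" "W \<inter> \<Union>(cls Y) \<noteq> {}" "Z \<in> cls Y" for W Z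
  proof -
    obtain Z0 where Z0: "Z0 \<in> cls Y" "W \<inter> Z0 \<noteq> {}" using WZ(2) by blast
    have "Z \<inter> Z0 \<noteq> {}" using mc(2)[OF WZ(3) Z0(1)] .
    then show ?thesis using meets_trans[of Z0 W Z] WZ Z0 S_sub by blast
  qed
  show "W \<inter> W' \<noteq> {}" if "W \<in> G" "W' \<in> G" "W \<inter> \<Union>(cls Y) \<noteq> {}" "W' \<inter> \<Union>(cls Y) \<noteq> {}" for W W'
    using meets_trans[of Y W W'] W[of W Y] W[of W' Y] that mc(1) assms by blast
qed

lemma sum_codegree:
  assumes "U \<subseteq> X"
  shows "(\<Sum>v\<in>U. codegree v) = (\<Sum>W\<in>nonmembers. card (W \<inter> U))"
  using sum_card_incidence[OF finite_nonmembers] assms finite_X finite_subset by blast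

lemma sum_codegree_X: "(\<Sum>v\<in>X. codegree v) + r * card G = r * (card X choose r)"
proof -
  have "(\<Sum>v\<in>X. codegree v) = (\<Sum>W\<in>nonmembers. r)"
    unfolding sum_codegree[OF subset_refl] by (rule sum.cong) (auto simp: nsets_def Int_absorb2)
  moreover have "card nonmembers + card G = (card X choose r)"
    using card_Diff_subset[OF finite_G G_sub] card_mono[OF _ G_sub] finite_X
    by (simp add: card_nsets finite_imp_finite_nsets)
  ultimately show ?thesis by (simp flip: distrib_left add: mult.commute[of _ r])
qed

lemma codegree_add_degree:
  assumes "v \<in> X"
  shows "codegree v + card {W \<in> G. v \<in> W} = (card X - 1 choose (r - 1))"
proof -
  have "{W \<in> nsets X r. v \<in> W} = {W \<in> nonmembers. v \<in> W} \<union> {W \<in> G. v \<in> W}" using G_sub by blast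
  moreover have "card ({W \<in> nonmembers. v \<in> W} \<union> {W \<in> G. v \<in> W}) = codegree v + card {W \<in> G. v \<in> W}"
    using finite_nonmembers finite_G by (intro card_Un_disjoint) auto
  ultimately show ?thesis using card_nsets_containing[of X v r] finite_X assms r_ge by simp
qed

text \<open>All members of \<open>G\<close> that touch the support meet each other, so by
  Erdos-Ko-Rado there are few of them and the support has large codegree. The class itself is
  intersecting on the support and obeys the same theorem there.\<close>

lemma large_class_bound:
  assumes Y: "Y \<in> S" and r: "3 \<le> r" and p: "2 * r \<le> card (\<Union>(cls Y))"
  shows "(card X - r) * card (cls Y) \<le> (\<Sum>v\<in>\<Union>(cls Y). codegree v)"
proof -
  define U where "U = \<Union>(cls Y)"
  define E0 where "E0 = (card X - 1 choose (r - 1))"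
  note cf = cls_facts[OF Y, folded U_def]
  have UX: "card U \<le> card X" using cf(3) finite_X card_mono by blast
  define M where "M = {W \<in> G. W \<inter> U \<noteq> {}}"
  have "card M \<le> E0"
    unfolding E0_def
  proof (rule Erdos_Ko_Rado_bound)
    show "A \<inter> B \<noteq> {}" if "A \<in> M" "B \<in> M" for A B using cf(8)[of A B] that unfolding M_def by blast
  qed (use finite_X G_sub r_ge X_ge in \<open>auto simp: M_def\<close>)
  moreover have "(\<Sum>v\<in>U. card {W \<in> G. v \<in> W}) \<le> (\<Sum>W\<in>M. r)"
  proof -
    have "(\<Sum>v\<in>U. card {W \<in> G. v \<in> W}) = (\<Sum>W\<in>G. card (W \<inter> U))"
      using sum_card_incidence finite_G cf(6) by blast
    also have "\<dots> = (\<Sum>W\<in>M. card (W \<inter> U))" using finite_G by (intro sum.mono_neutral_right) (auto simp: M_def)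
    also have "\<dots> \<le> (\<Sum>W\<in>M. r)"
    proof (rule sum_mono)
      fix W assume "W \<in> M"
      then have "finite W" "card W = r" using G_sub by (auto simp: M_def nsets_def)
      then show "card (W \<inter> U) \<le> r" using card_mono[of W "W \<inter> U"] by simp
    qed
    finally show ?thesis .
  qed
  moreover have "card M * r \<le> r * E0" using \<open>card M \<le> E0\<close> by (metis mult.commute mult_le_mono1)
  ultimately have deg: "(\<Sum>v\<in>U. card {W \<in> G. v \<in> W}) \<le> r * E0"
    unfolding sum_constant of_nat_id by linarith
  have "(\<Sum>v\<in>U. codegree v) + (\<Sum>v\<in>U. card {W \<in> G. v \<in> W}) = (\<Sum>v\<in>U. E0)"
    unfolding sum.distrib[symmetric] E0_def by (intro sum.cong codegree_add_degree) (use cf(3) in auto)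
  then have "card U * E0 \<le> (\<Sum>v\<in>U. codegree v) + r * E0" using deg by simp
  then have "(card U - r) * E0 \<le> (\<Sum>v\<in>U. codegree v)" by (simp add: diff_mult_distrib)
  moreover have "(card X - r) * (card U - 1 choose (r - 1)) \<le> (card U - r) * E0"
    unfolding E0_def using r p UX by (intro binomial_ratio_mono') (auto simp: U_def)
  moreover have "card (cls Y) \<le> (card U - 1 choose (r - 1))"
  proof (rule Erdos_Ko_Rado_bound)
    show "A \<inter> B \<noteq> {}" if "A \<in> cls Y" "B \<in> cls Y" for A B
      using cf(7)[of A B] that S_sub r_ge cf(2) unfolding U_def nsets_def by fastforce
    show "2 * r \<le> card U" using p by (simp add: U_def)
  qed (use cf(2,6) r in simp_all)
  ultimately show ?thesis unfolding U_def using mult_le_mono2 le_trans by meson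
qed

text \<open>A member meeting the union of a class meets every set of the class, so the sets agreeing
  with the complement of some class element inside that union are nonmembers.\<close>

lemma medium_class:
  assumes Y: "Y \<in> S" and p: "r < card (\<Union>(cls Y))" "card (\<Union>(cls Y)) < 2 * r"
  obtains P where "P \<subseteq> nonmembers"
    "card P = card (cls Y) * (card X - card (\<Union>(cls Y)) choose (2 * r - card (\<Union>(cls Y))))"
    "\<And>W. W \<in> P \<Longrightarrow> card (W \<inter> \<Union>(cls Y)) = card (\<Union>(cls Y)) - r"
proof -
  define U where "U = \<Union>(cls Y)"
  define j where "j = 2 * r - card U"
  note cf = cls_facts[OF Y, folded U_def]
  define h where "h = (\<lambda>(Z, J). (U - Z) \<union> J)"
  define D where "D = cls Y \<times> nsets (X - U) j"
  have Z: "Z \<subseteq> U" "card Z = r" "finite Z" if "Z \<in> cls Y" for Z using cf(2) that by (auto simp: nsets_def)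
  have J: "J \<subseteq> X - U" "card J = j" "finite J" if "J \<in> nsets (X - U) j" for J using that by (auto simp: nsets_def)
  have tr: "((U - Z) \<union> J) \<inter> U = U - Z" if "J \<in> nsets (X - U) j" for Z J using J[OF that] by blast
  have "h ` D \<subseteq> nonmembers"
  proof
    fix W assume "W \<in> h ` D"
    then obtain A J where AJ: "A \<in> cls Y" "J \<in> nsets (X - U) j" "W = (U - A) \<union> J" by (auto simp: h_def D_def)
    note zz = Z[OF AJ(1)] J[OF AJ(2)]
    have "card (U - A) = card U - r" using zz cf(6) by (simp add: card_Diff_subset)
    then have cd: "card W = r" "finite W" using zz AJ cf(6) p card_Un_disjoint[of "U - A" J] by (auto simp: j_def U_def)
    have "card (U - A) \<noteq> 0" using \<open>card (U - A) = card U - r\<close> p unfolding U_def by linarith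
    then have "U - A \<noteq> {}" by (intro notI) simp
    then have "W \<inter> U \<noteq> {}" "W \<inter> A = {}" using AJ zz by blast+
    then have "W \<notin> G" using cf(7)[of W A] AJ(1) by blast
    then show "W \<in> nonmembers" using cd AJ zz cf(3) by (auto simp: nsets_def)
  qed
  moreover have "card (h ` D) = card (cls Y) * (card X - card U choose j)"
  proof -
    have "inj_on h D"
    proof (rule inj_onI)
      fix a b assume ab: "a \<in> D" "b \<in> D" "h a = h b"
      obtain A I where a: "a = (A, I)" "A \<in> cls Y" "I \<in> nsets (X - U) j" using ab(1) by (auto simp: D_def)
      obtain B J where b: "b = (B, J)" "B \<in> cls Y" "J \<in> nsets (X - U) j" using ab(2) by (auto simp: D_def)
      have eq: "(U - A) \<union> I = (U - B) \<union> J" using ab(3) a b by (simp add: h_def)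
      then have "U - A = U - B" using tr[OF a(3), of A] tr[OF b(3), of B] by simp
      then have "A = B" using Z(1)[OF a(2)] Z(1)[OF b(2)] by blast
      moreover have "I = J" using eq J(1)[OF a(3)] J(1)[OF b(3)] by blast
      ultimately show "a = b" using a b by simp
    qed
    then have "card (h ` D) = card D" by (rule card_image)
    then show ?thesis using finite_X cf(3,6) by (simp add: D_def card_nsets card_cartesian_product card_Diff_subset)
  qed
  moreover have "card (W \<inter> U) = card U - r" if W: "W \<in> h ` D" for W
  proof -
    obtain A J where AJ: "A \<in> cls Y" "J \<in> nsets (X - U) j" "W = (U - A) \<union> J" using W by (auto simp: h_def D_def)
    then show ?thesis using tr[OF AJ(2), of A] Z[OF AJ(1)] cf(6) by (simp add: card_Diff_subset)
  qed
  ultimately show ?thesis using that unfolding U_def j_def by blast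
qed

text \<open>Each nonmember from \<open>medium_class\<close> has \<open>b = card U - r\<close>
  incidences with the support, so \<open>b + v \<le> (v choose j) * b\<close> suffices. For
  \<open>b = 1\<close> and \<open>v = j + 1\<close> this fails by one; that is the excluded
  case.\<close>

lemma medium_class_bound:
  assumes Y: "Y \<in> S" and r: "3 \<le> r" and p: "r < card (\<Union>(cls Y))" "card (\<Union>(cls Y)) < 2 * r"
    and ne: "\<not> (card (\<Union>(cls Y)) = r + 1 \<and> card X = 2 * r + 1)"
  shows "(card X - r) * card (cls Y) \<le> (\<Sum>v\<in>\<Union>(cls Y). codegree v)"
proof -
  define U where "U = \<Union>(cls Y)"
  note cf = cls_facts[OF Y, folded U_def]
  have UX: "card U \<le> card X" using cf(3) finite_X card_mono by blast
  obtain P where P: "P \<subseteq> nonmembers" "card P = card (cls Y) * (card X - card U choose (2 * r - card U))"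
    "\<And>W. W \<in> P \<Longrightarrow> card (W \<inter> U) = card U - r"
    using medium_class[OF Y p] unfolding U_def by blast
  define b where "b = card U - r"
  define v where "v = card X - card U"
  define j where "j = 2 * r - card U"
  have bvj: "1 \<le> b" "b + j = r" "1 \<le> j" "j < v" "card X - r = b + v"
    using p UX X_ge unfolding b_def v_def j_def U_def by linarith+
  have "b + v \<le> (v choose j) * b"
  proof (cases "b = 1")
    case True
    then have "j + 2 \<le> v" using ne bvj unfolding b_def v_def j_def U_def by linarith
    then show ?thesis using binomial_ge_Suc_upper[of j v] True bvj r by simp
  next
    case False
    obtain b' v' where bv: "b = b' + 2" "v = v' + 2" using False bvj le_Suc_ex[of 2 b] le_Suc_ex[of 2 v] by (auto simp: add.commute)
    have "v * b \<le> (v choose j) * b" using binomial_ge_upper[of j v] bvj by (intro mult_le_mono1) auto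
    moreover have "b + v \<le> v * b" unfolding bv by (simp add: algebra_simps)
    ultimately show ?thesis by linarith
  qed
  then have "card (cls Y) * (b + v) \<le> card (cls Y) * ((v choose j) * b)" by (rule mult_le_mono2)
  also have "\<dots> = (\<Sum>W\<in>P. card (W \<inter> U))" using P by (simp add: b_def v_def j_def)
  also have "\<dots> \<le> (\<Sum>W\<in>nonmembers. card (W \<inter> U))" using P finite_nonmembers by (intro sum_mono2) auto
  finally show ?thesis using sum_codegree[OF cf(3)] bvj by (simp add: U_def mult.commute)
qed

text \<open>A class with a support of \<open>r\<close> vertices is the single set \<open>Y\<close>.
  By \<open>no_triangle\<close>, members of \<open>G\<close> cannot have two different singletons as
  traces on \<open>C Y\<close>. So for all vertices of \<open>Y\<close> but one, every
  \<open>r\<close>-set with this trace is a nonmember.\<close>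

lemma small_class_bound:
  assumes Y: "Y \<in> S" and r: "3 \<le> r" and p: "card (\<Union>(cls Y)) = r"
  shows "(card X - r) * card (cls Y) \<le> (\<Sum>v\<in>\<Union>(cls Y). codegree v)"
proof -
  note cf = cls_facts[OF Y]
  have all: "Z = \<Union>(cls Y)" if "Z \<in> cls Y" for Z
    using cf(2,6) that p card_subset_eq[of "\<Union>(cls Y)" Z] by (auto simp: nsets_def)
  have UY: "\<Union>(cls Y) = Y" using all[OF cf(1)] by simp
  have "cls Y = {Y}"
  proof (intro equalityI subsetI)
    fix Z assume "Z \<in> cls Y"
    then show "Z \<in> {Y}" using all[of Z] UY by simp
  qed (use cf(1) in blast)
  have CY: "C Y \<subseteq> X" "card (C Y) = r + 1" "Y \<subseteq> C Y" using C_nsets[OF Y] sub_C[OF Y] by (auto simp: nsets_def)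
  have fY: "finite Y" "card Y = r" using UY cf(6) p by auto
  define A0 where "A0 = {a \<in> Y. \<forall>W\<in>G. W \<inter> C Y \<noteq> {a}}"
  have "card (Y - A0) \<le> 1"
  proof (rule ccontr)
    assume "\<not> card (Y - A0) \<le> 1"
    then obtain a b where ab: "a \<in> Y - A0" "b \<in> Y - A0" "a \<noteq> b"
      using card_le_Suc0_iff_eq[of "Y - A0"] fY by auto
    then obtain W W' where W: "W \<in> G" "W \<inter> C Y = {a}" "W' \<in> G" "W' \<inter> C Y = {b}" unfolding A0_def by blast
    have "W \<inter> W' \<inter> C Y = (W \<inter> C Y) \<inter> (W' \<inter> C Y)" by blast
    then have "W \<inter> W' \<inter> C Y = {}" using W ab(3) by simp
    then show False using no_triangle[of Y W W'] Y W by simp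
  qed
  then have A0: "r - 1 \<le> card A0" using fY card_Diff_subset[of A0 Y] finite_subset[of A0 Y] by (auto simp: A0_def)
  have "(card X - (r + 1) choose (r - 1)) \<le> codegree a" if "a \<in> A0" for a
  proof -
    have "{W \<in> nsets X r. W \<inter> C Y = {a}} \<subseteq> {W \<in> nonmembers. a \<in> W}" using that unfolding A0_def by blast
    then have "card {W \<in> nsets X r. W \<inter> C Y = {a}} \<le> codegree a"
      using finite_nonmembers by (intro card_mono finite_subset[of "{W \<in> nonmembers. a \<in> W}" nonmembers]) auto
    then show ?thesis using card_nsets_trace[of X a "C Y" r] finite_X CY that r by (auto simp: A0_def)
  qed
  then have "card A0 * (card X - (r + 1) choose (r - 1)) \<le> (\<Sum>v\<in>A0. codegree v)"
    using sum_mono[of A0 "\<lambda>_. card X - (r + 1) choose (r - 1)" codegree] by simp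
  also have "\<dots> \<le> (\<Sum>v\<in>Y. codegree v)" using fY by (intro sum_mono2) (auto simp: A0_def)
  finally have "card A0 * (card X - (r + 1) choose (r - 1)) \<le> (\<Sum>v\<in>Y. codegree v)" .
  moreover have "2 * (card X - (r + 1)) \<le> card A0 * (card X - (r + 1) choose (r - 1))"
    using A0 r X_ge by (intro mult_le_mono binomial_ge_upper) auto
  ultimately show ?thesis using \<open>cls Y = {Y}\<close> UY X_ge r by simp
qed

text \<open>By \<open>sum_codegree_X\<close> the claim is a lower bound on the sum of the codegrees.
  The classes of \<open>S\<close> have disjoint supports, so each class may be charged to the
  codegrees in its own support.\<close>

lemma link_bound:
  assumes r: "3 \<le> r"
  shows "(card X - r) * card S + r * card G \<le> r * (card X choose r)"
proof -
  have "(card X - r) * card S \<le> (\<Sum>v\<in>X. codegree v)"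
  proof (cases "\<exists>Y\<in>S. card (\<Union>(cls Y)) = r + 1 \<and> card X = 2 * r + 1")
    case True
    then obtain Y where Y: "Y \<in> S" "card (\<Union>(cls Y)) = r + 1" "card X = 2 * r + 1" by blast
    note cf = cls_facts[OF Y(1)]
    \<comment> \<open>The case left open by \<open>medium_class_bound\<close>. A second class would
      give \<open>r + 1\<close> vertices of some \<open>C Z\<close> disjoint from a support of size
      \<open>r + 1\<close>, too many for \<open>card X\<close>. With a single class all incidences
      of the nonmembers may be counted, not only those in the support.\<close>
    have "Z \<in> cls Y" if Z: "Z \<in> S" for Z
    proof (rule ccontr)
      assume n: "Z \<notin> cls Y"
      have "C Z \<inter> \<Union>(cls Y) = {}"
      proof (rule ccontr)
        assume "C Z \<inter> \<Union>(cls Y) \<noteq> {}"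
        then obtain B where B: "B \<in> cls Y" "B \<inter> C Z \<noteq> {}" by blast
        then have "B \<inter> Z \<noteq> {}" using meets_C_meets[of Z B] Z S_sub by blast
        then show False using n Z B cf(5) unfolding nsets_def by blast
      qed
      then have "card (C Z \<union> \<Union>(cls Y)) = 2 * r + 2"
        using C_nsets[OF Z] cf(6) Y by (subst card_Un_disjoint) (auto simp: nsets_def)
      moreover have "C Z \<union> \<Union>(cls Y) \<subseteq> X" using C_nsets[OF Z] cf(3) by (auto simp: nsets_def)
      ultimately show False using card_mono[OF finite_X, of "C Z \<union> \<Union>(cls Y)"] Y by simp
    qed
    then have SY: "cls Y = S" by blast
    have "r < card (\<Union>(cls Y))" "card (\<Union>(cls Y)) < 2 * r" unfolding Y(2) using r by linarith+
    then obtain P where "P \<subseteq> nonmembers" "card P = card (cls Y) * (card X - card (\<Union>(cls Y)) choose (2 * r - card (\<Union>(cls Y))))"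
      by (rule medium_class[OF Y(1)])
    then have P: "P \<subseteq> nonmembers" "card P = card (cls Y) * (card X - (r + 1) choose (2 * r - (r + 1)))"
      unfolding Y(2) by simp_all
    have "card X - (r + 1) = r" "2 * r - (r + 1) = r - 1" using Y by auto
    then have "card P = card S * r" using P(2) SY r binomial_symmetric[of "r - 1" r] by simp
    moreover have "card P \<le> card nonmembers" using P finite_nonmembers card_mono by blast
    moreover have "r * card nonmembers = (\<Sum>v\<in>X. codegree v)"
    proof -
      have "(\<Sum>v\<in>X. codegree v) = (\<Sum>W\<in>nonmembers. r)"
        unfolding sum_codegree[OF subset_refl] by (rule sum.cong) (auto simp: nsets_def Int_absorb2)
      then show ?thesis by (simp add: mult.commute)
    qed
    ultimately have "r * (card S * r) \<le> (\<Sum>v\<in>X. codegree v)" using mult_le_mono2 by metis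
    moreover have "(r + 1) * card S \<le> (r * r) * card S"
    proof (rule mult_le_mono1)
      have "3 * r \<le> r * r" using r by (rule mult_le_mono1)
      then show "r + 1 \<le> r * r" using r by linarith
    qed
    ultimately show ?thesis using Y by (simp add: ac_simps)
  next
    case False
    have cb: "(card X - r) * card (cls Y) \<le> (\<Sum>v\<in>\<Union>(cls Y). codegree v)" if Y: "Y \<in> S" for Y
    proof -
      consider "2 * r \<le> card (\<Union>(cls Y))" | "r < card (\<Union>(cls Y))" "card (\<Union>(cls Y)) < 2 * r" | "card (\<Union>(cls Y)) = r"
        using cls_facts(4)[OF Y] by linarith
      then show ?thesis
        using large_class_bound[OF Y r] medium_class_bound[OF Y r] small_class_bound[OF Y r] False Y by cases blast+
    qed
    \<comment> \<open>Induction over unions of classes; the second premise on \<open>S'\<close>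
      expresses that it is such a union.\<close>
    have "(card X - r) * card S' \<le> (\<Sum>v\<in>\<Union>S'. codegree v)"
      if "S' \<subseteq> S" "\<And>Y Z. Y \<in> S' \<Longrightarrow> Z \<in> S \<Longrightarrow> Z \<inter> Y \<noteq> {} \<Longrightarrow> Z \<in> S'" for S'
      using that
    proof (induction "card S'" arbitrary: S' rule: less_induct)
      case less
      show ?case
      proof (cases "S' = {}")
        case False
        then obtain Y where Y: "Y \<in> S'" by blast
        then have YS: "Y \<in> S" using less.prems by blast
        note cf = cls_facts[OF YS]
        have sub: "cls Y \<subseteq> S'" using less.prems(2)[OF Y] by blast
        have fS': "finite S'" using less.prems(1) finite_S finite_subset by blast
        have card: "card S' = card (cls Y) + card (S' - cls Y)"
          using card_Un_disjoint[of "cls Y" "S' - cls Y"] sub fS' finite_subset[OF sub] by (simp add: Un_absorb1)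
        moreover have "0 < card (cls Y)" using cf(1) finite_S by (auto simp: card_gt_0_iff)
        moreover have "(card X - r) * card (S' - cls Y) \<le> (\<Sum>v\<in>\<Union>(S' - cls Y). codegree v)"
        proof (rule less.hyps)
          show "card (S' - cls Y) < card S'" using card \<open>0 < card (cls Y)\<close> by linarith
          show "S' - cls Y \<subseteq> S" using less.prems by blast
          fix A Z assume A: "A \<in> S' - cls Y" "Z \<in> S" "Z \<inter> A \<noteq> {}"
          have "Z \<notin> cls Y"
          proof
            assume Z: "Z \<in> cls Y"
            then have "A \<inter> Y \<noteq> {}" using meeting_transitiveD[OF meeting_transitive_S, of A Z Y] A less.prems(1) YS by blast
            then show False using A less.prems(1) by blast
          qed
          then show "Z \<in> S' - cls Y" using less.prems(2)[of A Z] A by blast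
        qed
        moreover have "(\<Sum>v\<in>\<Union>S'. codegree v) = (\<Sum>v\<in>\<Union>(cls Y). codegree v) + (\<Sum>v\<in>\<Union>(S' - cls Y). codegree v)"
        proof -
          have "S' = cls Y \<union> (S' - cls Y)" using sub by (simp only: Diff_partition)
          then have "\<Union>S' = \<Union>(cls Y) \<union> \<Union>(S' - cls Y)" by (metis Union_Un_distrib)
          moreover have "\<Union>(S' - cls Y) \<subseteq> X - \<Union>(cls Y)" 
          proof (rule Union_least)
            fix B assume "B \<in> S' - cls Y"
            then have "B \<in> nsets (X - \<Union>(cls Y)) r" using cf(5) less.prems(1) by blast
            then show "B \<subseteq> X - \<Union>(cls Y)" by (simp add: nsets_def)
          qed
          moreover from this have "finite (\<Union>(S' - cls Y))" using finite_X finite_subset by blast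
          moreover have "\<Union>(cls Y) \<inter> \<Union>(S' - cls Y) = {}"
            using \<open>\<Union>(S' - cls Y) \<subseteq> X - \<Union>(cls Y)\<close> by blast
          ultimately show ?thesis using sum.union_disjoint[of "\<Union>(cls Y)" "\<Union>(S' - cls Y)" codegree] cf(6) by presburger
        qed
        ultimately show ?thesis using cb[OF YS] by (simp add: distrib_left)
      qed simp
    qed
    from this[of S] have "(card X - r) * card S \<le> (\<Sum>v\<in>\<Union>S. codegree v)" by blast
    also have "\<dots> \<le> (\<Sum>v\<in>X. codegree v)"
      using finite_X S_sub G_sub by (intro sum_mono2) (auto simp: nsets_def)
    finally show ?thesis .
  qed
  then show ?thesis using sum_codegree_X by linarith
qed

end

context link_family
begin

text \<open>A pair in \<open>S\<close> either has an end of degree one or lies in a triangle component.\<close>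

lemma link_bound_graph:
  assumes r: "r = 2"
  defines "bad \<equiv> {Y \<in> S. \<exists>c. c \<notin> Y \<and> (\<forall>a\<in>Y. {a, c} \<in> G)}"
  shows "(card X - r) * card S + r * card G \<le> r * (card X choose r) + card bad"
proof -
  define deg where "deg v = card {W \<in> G. v \<in> W}" for v
  have pair: "\<exists>w. W = {a, w} \<and> w \<noteq> a" if "W \<in> G" "a \<in> W" for W a
  proof -
    have "card W = 2" using that(1) G_sub r by (auto simp: nsets_def)
    then obtain p q where "W = {p, q}" "p \<noteq> q" by (meson card_2_iff)
    then show ?thesis using that(2) by auto
  qed
  have degX: "codegree v + deg v = card X - 1" if "v \<in> X" for v
    using codegree_add_degree[OF that] r by (simp add: deg_def)
  have SG: "Y \<in> G" if "Y \<in> S" for Y using that S_sub by blast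
  have GX: "W \<subseteq> X" "finite W" "card W = 2" if "W \<in> G" for W using that G_sub r by (auto simp: nsets_def)
  \<comment> \<open>Otherwise there are further pairs at both ends of \<open>Y\<close>. By
    \<open>no_triangle\<close> they share a vertex, and this vertex closes a triangle over
    \<open>Y\<close>, so \<open>Y\<close> would be bad.\<close>
  have leaf: "\<exists>b\<in>Y. {W \<in> G. b \<in> W} = {Y}" if Y: "Y \<in> S - bad" for Y
  proof (rule ccontr)
    assume n: "\<not> (\<exists>b\<in>Y. {W \<in> G. b \<in> W} = {Y})"
    have YS: "Y \<in> S" using Y by blast
    obtain a b where ab: "Y = {a, b}" "a \<noteq> b" using GX(3)[OF SG[OF YS]] by (meson card_2_iff)
    obtain W where W: "W \<in> G" "a \<in> W" "W \<noteq> Y" using n ab SG[OF YS] by blast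
    obtain W' where W': "W' \<in> G" "b \<in> W'" "W' \<noteq> Y" using n ab SG[OF YS] by blast
    obtain w where w: "W = {a, w}" "w \<noteq> a" using pair W by blast
    obtain w' where w': "W' = {b, w'}" "w' \<noteq> b" using pair W' by blast
    have "a \<in> C Y" "b \<in> C Y" using sub_C[OF YS] ab by auto
    then have "W \<inter> W' \<inter> C Y \<noteq> {}" using no_triangle[OF YS W(1) W'(1)] W(2) W'(2) by blast
    then have "w = w'" using w w' ab W(3) W'(3) by auto
    then have "w \<notin> Y" "\<forall>a\<in>Y. {a, w} \<in> G" using w w' ab W W' by auto
    then have "Y \<in> bad" unfolding bad_def using YS by blast
    then show False using Y by blast
  qed
  \<comment> \<open>Any pair at \<open>v\<close> has to meet the opposite side \<open>{b, c}\<close>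
    of the triangle by \<open>no_triangle\<close>, so it is one of the two sides at
    \<open>v\<close>.\<close>
  have bad2: "deg v = 2" if Y: "Y \<in> bad" and v: "v \<in> Y" for Y v
  proof -
    have YS: "Y \<in> S" using Y unfolding bad_def by blast
    obtain c where c: "c \<notin> Y" "\<forall>a\<in>Y. {a, c} \<in> G" using Y unfolding bad_def by blast
    obtain b where b: "Y = {v, b}" "b \<noteq> v" using pair[OF SG[OF YS] v] by blast
    have vb: "v \<in> C Y" "b \<in> C Y" using sub_C[OF YS] b by auto
    have G: "{v, c} \<in> G" "{b, c} \<in> G" "c \<noteq> v" "c \<noteq> b" using c b by auto
    have "{v, c} \<inter> {b, c} \<inter> C Y \<noteq> {}" using no_triangle[OF YS G(1,2)] vb by blast
    then have cC: "c \<in> C Y" using b by auto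
    have "{W \<in> G. v \<in> W} = {{v, b}, {v, c}}"
    proof (intro equalityI subsetI)
      fix W assume W: "W \<in> {W \<in> G. v \<in> W}"
      then obtain w where w: "W = {v, w}" "w \<noteq> v" using pair by blast
      have "W \<inter> {b, c} \<inter> C Y \<noteq> {}" using no_triangle[OF YS _ G(2), of W] W vb by blast
      then have "w = b \<or> w = c" using w b(2) G(3) by auto
      then show "W \<in> {{v, b}, {v, c}}" using w by auto
    qed (use G SG[OF YS] b in auto)
    moreover have "{v, b} \<noteq> {v, c}" using G b by (auto simp: doubleton_eq_iff)
    ultimately show ?thesis unfolding deg_def by simp
  qed
  define B where "B = \<Union>bad"
  have badG: "bad \<subseteq> G" and badS: "bad \<subseteq> S" using S_sub by (auto simp: bad_def)
  have BX: "B \<subseteq> X" unfolding B_def using badG GX(1) by blast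
  have fin: "finite bad" "finite B" using badS finite_S BX finite_X finite_subset by blast+
  have "2 * card bad \<le> 2 * card B"
  proof -
    have "2 * card bad = (\<Sum>W\<in>bad. card (W \<inter> B))"
    proof -
      have "card (W \<inter> B) = 2" if "W \<in> bad" for W
      proof -
        have "W \<inter> B = W" using that unfolding B_def by blast
        then show ?thesis using GX(3) that badG by auto
      qed
      then show ?thesis by simp
    qed
    also have "\<dots> = (\<Sum>v\<in>B. card {W \<in> bad. v \<in> W})" using sum_card_incidence[OF fin] by simp
    also have "\<dots> \<le> (\<Sum>v\<in>B. 2)"
    proof (rule sum_mono)
      fix v assume "v \<in> B"
      then have "deg v = 2" using bad2 unfolding B_def by blast
      moreover have "card {W \<in> bad. v \<in> W} \<le> deg v"
        unfolding deg_def using finite_G badG by (intro card_mono) auto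
      ultimately show "card {W \<in> bad. v \<in> W} \<le> 2" by simp
    qed
    finally show ?thesis by simp
  qed
  then have cB: "card bad \<le> card B" by simp
  obtain l where l: "\<And>Y. Y \<in> S - bad \<Longrightarrow> l Y \<in> Y \<and> {W \<in> G. l Y \<in> W} = {Y}" using leaf by metis
  define D where "D = l ` (S - bad)"
  have "inj_on l (S - bad)"
  proof (rule inj_onI)
    fix Y Z assume "Y \<in> S - bad" "Z \<in> S - bad" "l Y = l Z"
    then have "{Y} = {Z}" using l[of Y] l[of Z] by metis
    then show "Y = Z" by simp
  qed
  then have cD: "card D = card S - card bad" unfolding D_def
    using fin badS by (simp add: card_image card_Diff_subset)
  have degD: "deg v = 1" if "v \<in> D" for v using that l unfolding D_def deg_def by auto
  have degB: "deg v = 2" if "v \<in> B" for v using that bad2 unfolding B_def by blast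
  have DX: "D \<subseteq> X" unfolding D_def using l GX(1) SG by blast
  have fD: "finite D" using DX finite_X finite_subset by blast
  have disj: "D \<inter> B = {}" using degD degB by force
  \<comment> \<open>A leaf has codegree \<open>card X - 2\<close>, a vertex of a bad pair only
    \<open>card X - 3\<close>. The loss of one per bad pair is the error term of the
    statement.\<close>
  have "(card S - card bad) * (card X - 2) + card bad * (card X - 3) \<le> card D * (card X - 2) + card B * (card X - 3)"
    using cD cB by (intro add_mono mult_le_mono1) auto
  also have "\<dots> = (\<Sum>v\<in>D. codegree v) + (\<Sum>v\<in>B. codegree v)"
  proof -
    have "codegree v = card X - 2" if "v \<in> D" for v using degX[of v] degD[OF that] that DX by auto
    moreover have "codegree v = card X - 3" if "v \<in> B" for v using degX[of v] degB[OF that] that BX by auto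
    ultimately show ?thesis by simp
  qed
  also have "\<dots> = (\<Sum>v\<in>D \<union> B. codegree v)" using fD fin disj by (simp add: sum.union_disjoint)
  also have "\<dots> \<le> (\<Sum>v\<in>X. codegree v)" using finite_X DX BX by (intro sum_mono2) auto
  finally have "(card S - card bad) * (card X - 2) + card bad * (card X - 3) \<le> (\<Sum>v\<in>X. codegree v)" .
  moreover have "card bad * (card X - 3) + card bad = card bad * (card X - 2)"
  proof -
    have "card X - 2 = Suc (card X - 3)" using X_ge r by simp
    then show ?thesis by simp
  qed
  moreover have "(card S - card bad) * (card X - 2) + card bad * (card X - 2) = card S * (card X - 2)"
    using card_mono[OF finite_S badS] by (simp flip: distrib_right)
  ultimately show ?thesis using sum_codegree_X r by (simp add: mult.commute)
qed

end

section \<open>Summing the link bounds over all vertices\<close>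

text \<open>A set of degree \<open>d\<close> belongs to exactly \<open>d\<close> links, so its
  square is \<open>d\<close> counted once in each of them.\<close>

lemma co2_eq_sum_links:
  assumes "finite V" "H \<subseteq> nsets V (Suc j)"
  shows "(\<Sum>E\<in>nsets V j. (degree H E)\<^sup>2) = (\<Sum>x\<in>V. \<Sum>Y\<in>{Y \<in> nsets (V - {x}) j. insert x Y \<in> H}. degree H Y)"
    and "(\<Sum>x\<in>V. card {Y \<in> nsets (V - {x}) j. insert x Y \<in> H}) = Suc j * card H"
proof -
  let ?G = "\<lambda>x. {Y \<in> nsets (V - {x}) j. insert x Y \<in> H}"
  have fJ: "finite (nsets V j)" using assms(1) by (rule finite_imp_finite_nsets)
  have fH: "finite H" using assms finite_imp_finite_nsets finite_subset by metis
  have Gsub: "?G x \<subseteq> nsets V j" for x by (auto simp: nsets_def)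
  have memG: "x \<in> V \<and> Y \<in> ?G x \<longleftrightarrow> x \<in> V - Y \<and> insert x Y \<in> H" if "Y \<in> nsets V j" for x Y
    using that by (auto simp: nsets_def)
  have deg: "degree H Y = (\<Sum>x\<in>V. if Y \<in> ?G x then 1 else 0)" if Y: "Y \<in> nsets V j" for Y
  proof -
    have "real (degree H Y) = (\<Sum>x\<in>V - Y. if insert x Y \<in> H then 1 else 0)"
      using degree_up_sum[OF assms Y] by (simp add: up_sum_def)
    also have "\<dots> = (\<Sum>x\<in>V. if Y \<in> ?G x then 1 else 0)"
    by (rule sum.mono_neutral_cong_left) (use assms memG[OF Y] in auto)
    also have "\<dots> = real (\<Sum>x\<in>V. if Y \<in> ?G x then 1 else 0)" by (simp add: of_nat_sum if_distrib cong: if_cong)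
    finally show ?thesis by (simp only: of_nat_eq_iff)
  qed
  have "(\<Sum>E\<in>nsets V j. (degree H E)\<^sup>2) = (\<Sum>Y\<in>nsets V j. \<Sum>x\<in>V. if Y \<in> ?G x then degree H Y else 0)"
  proof (rule sum.cong[OF refl])
    fix Y assume Y: "Y \<in> nsets V j"
    have "(degree H Y)\<^sup>2 = (\<Sum>x\<in>V. if Y \<in> ?G x then 1 else 0) * degree H Y"
      by (subst (1) deg[OF Y, symmetric]) (simp add: power2_eq_square)
    also have "\<dots> = (\<Sum>x\<in>V. if Y \<in> ?G x then degree H Y else 0)"
      unfolding sum_distrib_right by (rule sum.cong) auto
    finally show "(degree H Y)\<^sup>2 = (\<Sum>x\<in>V. if Y \<in> ?G x then degree H Y else 0)" .
  qed
  also have "\<dots> = (\<Sum>x\<in>V. \<Sum>Y\<in>nsets V j. if Y \<in> ?G x then degree H Y else 0)" by (rule sum.swap)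
  also have "\<dots> = (\<Sum>x\<in>V. \<Sum>Y\<in>?G x. degree H Y)"
  proof (rule sum.cong[OF refl])
    fix x
    have "(\<Sum>Y\<in>nsets V j. if Y \<in> ?G x then degree H Y else 0) = (\<Sum>Y\<in>nsets V j \<inter> ?G x. degree H Y)"
      using fJ by (rule sum.inter_restrict[symmetric])
    also have "nsets V j \<inter> ?G x = ?G x" using Gsub by blast
    finally show "(\<Sum>Y\<in>nsets V j. if Y \<in> ?G x then degree H Y else 0) = (\<Sum>Y\<in>?G x. degree H Y)" .
  qed
  finally show "(\<Sum>E\<in>nsets V j. (degree H E)\<^sup>2) = (\<Sum>x\<in>V. \<Sum>Y\<in>?G x. degree H Y)" .
  have "card (?G x) = card {A \<in> H. x \<in> A}" if "x \<in> V" for x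
  proof (rule bij_betw_same_card)
    have "inj_on (insert x) (?G x)"
    proof (rule inj_onI)
      fix A B assume "A \<in> ?G x" "B \<in> ?G x" "insert x A = insert x B"
      moreover from this have "x \<notin> A" "x \<notin> B" by (auto simp: nsets_def)
      ultimately show "A = B" by (metis insert_ident)
    qed
    moreover have "A \<in> insert x ` ?G x" if "A \<in> H" "x \<in> A" for A
    proof -
      have "A \<in> nsets V (Suc j)" using assms(2) that by blast
      then have "A - {x} \<in> nsets (V - {x}) j" "insert x (A - {x}) = A" using that by (auto simp: nsets_def)
      then show ?thesis using that by (intro image_eqI[of _ _ "A - {x}"]) auto
    qed
    ultimately show "bij_betw (insert x) (?G x) {A \<in> H. x \<in> A}" unfolding bij_betw_def by auto
  qed
  then have "(\<Sum>x\<in>V. card (?G x)) = (\<Sum>x\<in>V. card {A \<in> H. x \<in> A})" by simp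
  also have "\<dots> = (\<Sum>A\<in>H. card (A \<inter> V))" using sum_card_incidence fH assms(1) by blast
  also have "\<dots> = (\<Sum>A\<in>H. Suc j)"
    by (rule sum.cong) (use assms(2) in \<open>auto simp: nsets_def Int_absorb2\<close>)
  finally show "(\<Sum>x\<in>V. card (?G x)) = Suc j * card H" by simp
qed

lemma degree_le:
  assumes "finite V" "H \<subseteq> nsets V (Suc j)" "Y \<in> nsets V j"
  shows "degree H Y \<le> card V - j"
proof -
  have "{F \<in> H. Y \<subseteq> F} \<subseteq> (\<lambda>x. insert x Y) ` (V - Y)"
  proof
    fix F assume F: "F \<in> {F \<in> H. Y \<subseteq> F}"
    then have "F \<subseteq> V" "finite F" "card F = Suc j" "Y \<subseteq> F" "card Y = j" "finite Y" using assms by (auto simp: nsets_def)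
    then have "card (F - Y) = 1" by (simp add: card_Diff_subset)
    then obtain x where "F - Y = {x}" by (auto simp: card_1_singleton_iff)
    then show "F \<in> (\<lambda>x. insert x Y) ` (V - Y)" using \<open>Y \<subseteq> F\<close> \<open>F \<subseteq> V\<close> by blast
  qed
  then have "degree H Y \<le> card ((\<lambda>x. insert x Y) ` (V - Y))" unfolding degree_def using assms(1) by (intro card_mono) auto
  also have "\<dots> \<le> card (V - Y)" using assms(1) by (intro card_image_le) auto
  also have "\<dots> = card V - j" using assms(1,3) finite_subset by (subst card_Diff_subset) (auto simp: nsets_def)
  finally show ?thesis .
qed

definition triangle_free :: "'a set set \<Rightarrow> bool" where
  "triangle_free H \<longleftrightarrow> (\<forall>A\<in>H. \<forall>B\<in>H. \<forall>C\<in>H. A \<inter> B \<noteq> {} \<longrightarrow> B \<inter> C \<noteq> {} \<longrightarrow> C \<inter> A \<noteq> {} \<longrightarrow> A \<inter> B \<inter> C \<noteq> {})"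

lemma triangle_freeD:
  "triangle_free H \<Longrightarrow> A \<in> H \<Longrightarrow> B \<in> H \<Longrightarrow> C \<in> H \<Longrightarrow> A \<inter> B \<noteq> {} \<Longrightarrow> B \<inter> C \<noteq> {} \<Longrightarrow> C \<inter> A \<noteq> {} \<Longrightarrow> A \<inter> B \<inter> C \<noteq> {}"
  unfolding triangle_free_def by blast

text \<open>A set of the link has degree one or lies in \<open>S\<close>, where the degree is at
  most \<open>n - k + 1\<close>; so the bound on \<open>S\<close> and \<open>G\<close> becomes a
  bound on degrees. The coefficient \<open>k - 2\<close> is the one for which the sum over all
  vertices is an equality for the star.\<close>

lemma link_degree_sum_le:
  assumes V: "finite V" "card V = n" and H: "H \<subseteq> nsets V k" and tf: "triangle_free H"
    and k: "3 \<le> k" "2 * k \<le> n" and x: "x \<in> V"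
  defines "G \<equiv> {Y \<in> nsets (V - {x}) (k - 1). insert x Y \<in> H}"
  shows "(\<Sum>Y\<in>G. degree H Y) + (k - 2) * card G \<le> (k - 1) * (n - 1 choose (k - 1))"
proof -
  define S where "S = {Y \<in> G. 2 \<le> degree H Y}"
  have fH: "finite H" using V H finite_imp_finite_nsets finite_subset by metis
  have Hk: "A \<subseteq> V" "finite A" "card A = k" if "A \<in> H" for A using that H by (auto simp: nsets_def)
  have SG: "S \<subseteq> G" unfolding S_def by blast
  have Gk: "Y \<subseteq> V - {x}" "finite Y" "card Y = k - 1" "insert x Y \<in> H" "x \<notin> Y" if "Y \<in> G" for Y
    using that by (auto simp: G_def nsets_def)
  have "\<exists>C. C \<in> H \<and> Y \<subseteq> C \<and> x \<notin> C" if "Y \<in> S" for Y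
  proof -
    have YG: "Y \<in> G" and d: "2 \<le> card {F \<in> H. Y \<subseteq> F}" using that by (auto simp: S_def degree_def)
    have "\<not> {F \<in> H. Y \<subseteq> F} \<subseteq> {insert x Y}"
    proof
      assume "{F \<in> H. Y \<subseteq> F} \<subseteq> {insert x Y}"
      then have "card {F \<in> H. Y \<subseteq> F} \<le> 1" using card_mono[of "{insert x Y}" "{F \<in> H. Y \<subseteq> F}"] by simp
      then show False using d by simp
    qed
    then obtain C where C: "C \<in> H" "Y \<subseteq> C" "C \<noteq> insert x Y" by blast
    have "x \<notin> C"
    proof
      assume "x \<in> C"
      then have "insert x Y \<subseteq> C" using C by blast
      then have "insert x Y = C" using Hk[OF C(1)] Hk[OF Gk(4)[OF YG]] by (metis card_subset_eq)
      then show False using C by blast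
    qed
    then show ?thesis using C by blast
  qed
  then obtain C where C: "\<And>Y. Y \<in> S \<Longrightarrow> C Y \<in> H \<and> Y \<subseteq> C Y \<and> x \<notin> C Y" by metis
  interpret link_family "V - {x}" "k - 1" G S C
  proof
    show "Y \<in> S \<Longrightarrow> C Y \<in> nsets (V - {x}) (k - 1 + 1)" for Y
      using C[of Y] Hk[of "C Y"] k by (auto simp: nsets_def)
    fix Y W W' assume A: "Y \<in> S" "W \<in> G" "W' \<in> G" "W \<inter> C Y \<noteq> {}" "W' \<inter> C Y \<noteq> {}"
    \<comment> \<open>\<open>x\<close> lies in the first two edges but not in \<open>C Y\<close>, so
      the common vertex of all three belongs to the link.\<close>
    have "insert x W \<inter> insert x W' \<inter> C Y \<noteq> {}"
      by (rule triangle_freeD[OF tf]) (use A C[OF A(1)] Gk in auto)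
    then show "W \<inter> W' \<inter> C Y \<noteq> {}" using C[OF A(1)] by auto
  qed (use V x k C SG in \<open>auto simp: G_def\<close>)
  define bad where "bad = (if k = 3 then {Y \<in> S. \<exists>c. c \<notin> Y \<and> (\<forall>a\<in>Y. {a, c} \<in> G)} else {})"
  have cX: "card (V - {x}) = n - 1" using V x by simp
  have bound: "(n - k) * card S + (k - 1) * card G \<le> (k - 1) * (n - 1 choose (k - 1)) + card bad"
  proof (cases "k = 3")
    case True
    have "card (V - {x}) - (k - 1) = n - k" using cX k by simp
    then show ?thesis using link_bound_graph True unfolding cX bad_def by simp
  next
    case False
    have "card (V - {x}) - (k - 1) = n - k" using cX k by simp
    then show ?thesis using link_bound False k unfolding cX bad_def by simp
  qed
  have bS: "bad \<subseteq> S" by (auto simp: bad_def)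
  have d1: "degree H Y = 1" if "Y \<in> G - S" for Y
  proof -
    have "insert x Y \<in> {F \<in> H. Y \<subseteq> F}" using Gk that by blast
    then have "0 < degree H Y" unfolding degree_def using fH by (auto simp: card_gt_0_iff)
    moreover have "degree H Y < 2" using that by (auto simp: S_def)
    ultimately show ?thesis by simp
  qed
  \<comment> \<open>This pays for the error term of \<open>link_bound_graph\<close>: an edge over a
    bad pair that avoids \<open>x\<close> must contain the apex \<open>c\<close>, so only two edges
    are possible instead of \<open>n - k + 1\<close>.\<close>
  have d2: "degree H Y \<le> 2" if Y: "Y \<in> bad" for Y
  proof -
    have k3: "k = 3" using Y by (auto simp: bad_def split: if_splits)
    then obtain c where YS: "Y \<in> S" and c: "c \<notin> Y" "\<forall>a\<in>Y. {a, c} \<in> G" using Y by (auto simp: bad_def)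
    have YG: "Y \<in> G" using YS SG by blast
    obtain a b where ab: "Y = {a, b}" "a \<noteq> b" using Gk(3)[OF YG] k3 by (metis card_2_iff diff_Suc_1 numeral_2_eq_2 numeral_3_eq_3)
    have g: "{a, c} \<in> G" "{b, c} \<in> G" using c ab by auto
    have "{F \<in> H. Y \<subseteq> F} \<subseteq> {insert x Y, insert c Y}"
    proof
      fix F assume F: "F \<in> {F \<in> H. Y \<subseteq> F}"
      show "F \<in> {insert x Y, insert c Y}"
      proof (cases "x \<in> F")
        case True
        then have "insert x Y = F" using F Hk[of F] Hk[OF Gk(4)[OF YG]] by (intro card_subset_eq) auto
        then show ?thesis by simp
      next
        case False
        have "insert x {a, c} \<inter> insert x {b, c} \<inter> F \<noteq> {}"
          by (rule triangle_freeD[OF tf]) (use F ab g Gk(4) in auto)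
        then have "c \<in> F" using False ab c by auto
        moreover have "card (insert c Y) = k" using c(1) Gk(2,3)[OF YG] k by simp
        ultimately have "insert c Y = F" using F Hk[of F] by (intro card_subset_eq) auto
        then show ?thesis by simp
      qed
    qed
    then have "degree H Y \<le> card {insert x Y, insert c Y}" unfolding degree_def by (intro card_mono) auto
    then show ?thesis using card_insert_le_m1[of 2 "{insert c Y}" "insert x Y"] by simp
  qed
  have dn: "degree H Y \<le> n - k + 1" if "Y \<in> G" for Y
  proof -
    have "H \<subseteq> nsets V (Suc (k - 1))" "Y \<in> nsets V (k - 1)" using H k that by (auto simp: G_def nsets_def)
    then show ?thesis using degree_le[OF V(1), of H "k - 1" Y] V(2) k by simp
  qed
  have "(\<Sum>Y\<in>G. degree H Y) = (\<Sum>Y\<in>G - S. degree H Y) + ((\<Sum>Y\<in>S - bad. degree H Y) + (\<Sum>Y\<in>bad. degree H Y))"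
    using sum.subset_diff[OF SG finite_G, of "degree H"] sum.subset_diff[OF bS finite_S, of "degree H"] by simp
  also have "\<dots> \<le> (\<Sum>Y\<in>G - S. 1) + ((\<Sum>Y\<in>S - bad. n - k + 1) + (\<Sum>Y\<in>bad. 2))"
    using d1 d2 dn SG by (intro add_mono sum_mono) auto
  also have "\<dots> = (card G - card S) + ((card S - card bad) * (n - k + 1) + 2 * card bad)"
    using finite_S SG bS finite_subset[OF bS] by (simp add: card_Diff_subset)
  finally have 1: "(\<Sum>Y\<in>G. degree H Y) \<le> (card G - card S) + ((card S - card bad) * (n - k + 1) + 2 * card bad)" .
  have cc: "card S \<le> card G" "card bad \<le> card S" using SG bS finite_G finite_S by (auto intro: card_mono)
  obtain s where s: "card S = card bad + s" using cc le_Suc_ex by blast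
  obtain g where g: "card G = card bad + s + g" using cc s le_Suc_ex by metis
  obtain i where i: "k = i + 3" using k le_Suc_ex by (metis add.commute)
  obtain d where d: "n = 2 * k + d" using k le_Suc_ex by blast
  have "(\<Sum>Y\<in>G. degree H Y) \<le> g + (s * (n - k + 1) + 2 * card bad)" using 1 s g by simp
  moreover have "n - k = i + 3 + d" "k - 1 = i + 2" "k - 2 = i + 1" using d i by auto
  ultimately show ?thesis using bound by (simp add: s g algebra_simps)
qed

text \<open>The summed link bounds limit the degree square sum plus \<open>k * (k - 2)\<close> times
  the number of edges by the value of this expression for the star. If the first summand is at least
  that of the star, the number of edges is at most that of the star.\<close>

lemma triangle_free_card_or_co2:
  assumes H: "H \<subseteq> nsets {1..n} k" and tf: "triangle_free H" and k: "3 \<le> k" "2 * k \<le> n"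
  shows "card H \<le> (n - 1 choose (k - 1)) \<or> co2 n k H < star_co2 n k"
proof (rule disjCI)
  assume "\<not> co2 n k H < star_co2 n k"
  then have ge: "star_co2 n k \<le> co2 n k H" by simp
  define N where "N = (n - 1 choose (k - 1))"
  let ?V = "{1..n}"
  let ?G = "\<lambda>x. {Y \<in> nsets (?V - {x}) (k - 1). insert x Y \<in> H}"
  have Hs: "H \<subseteq> nsets ?V (Suc (k - 1))" using H k by simp
  note sl = co2_eq_sum_links[OF finite_atLeastAtMost Hs]
  have "(\<Sum>x\<in>?V. (\<Sum>Y\<in>?G x. degree H Y) + (k - 2) * card (?G x)) \<le> (\<Sum>x\<in>?V. (k - 1) * N)"
    unfolding N_def by (rule sum_mono) (use link_degree_sum_le[OF _ _ H tf k] in auto)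
  then have "co2 n k H + (k - 2) * (k * card H) \<le> n * ((k - 1) * N)"
    using sl k by (simp add: sum.distrib co2_def flip: sum_distrib_left)
  then have le: "N * (1 + (n - k + 1) * (k - 1)) + (k - 2) * (k * card H) \<le> n * ((k - 1) * N)"
    using ge by (simp add: star_co2_def N_def)
  obtain i where i: "k = i + 3" using k le_Suc_ex by (metis add.commute)
  obtain d where d: "n = 2 * k + d" using k le_Suc_ex by blast
  have "n * ((k - 1) * N) = N * (1 + (n - k + 1) * (k - 1)) + (k - 2) * (k * N)"
    unfolding d i by (simp add: algebra_simps)
  with le have "(k - 2) * (k * card H) \<le> (k - 2) * (k * N)" by linarith
  then show "card H \<le> (n - 1 choose (k - 1))" using k by (simp add: N_def)
qed

lemma meet_of_card:
  assumes "finite V" "A \<subseteq> V" "B \<subseteq> V" "card V < card A + card B"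
  shows "A \<inter> B \<noteq> {}"
proof
  assume "A \<inter> B = {}"
  moreover have "finite A" "finite B" using assms finite_subset by blast+
  ultimately have "card (A \<union> B) = card A + card B" by (simp add: card_Un_disjoint)
  moreover have "card (A \<union> B) \<le> card V" using assms by (intro card_mono) auto
  ultimately show False using assms by simp
qed

text \<open>Below \<open>2 * k\<close> vertices any two edges meet, so the absence of triangles
  makes the family 3-wise intersecting.\<close>

lemma triangle_free_card_le:
  assumes V: "finite V" and H: "H \<subseteq> nsets V k" and tf: "triangle_free H" and k: "0 < k" "3 * k \<le> 2 * card V" "card V < 2 * k"
  shows "card H \<le> (card V - 1 choose (k - 1))"
proof -
  have "A \<inter> B \<noteq> {}" if "A \<in> H" "B \<in> H" for A B
  proof -
    have "A \<in> nsets V k" "B \<in> nsets V k" using H that by auto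
    then show ?thesis using meet_of_card[OF V, of A B] k by (simp add: nsets_def)
  qed
  then have "A \<inter> B \<inter> C \<noteq> {}" if "A \<in> H" "B \<in> H" "C \<in> H" for A B C
    using triangle_freeD[OF tf that] that by simp
  then show ?thesis using three_wise_intersecting_bound[OF V H k(1,2)] by simp
qed

lemma free_minimal_cycles_triangle_free:
  "H \<in> free_hypergraphs n k (minimal_cycles k 3) \<Longrightarrow> triangle_free H"
  unfolding triangle_free_def using free_no_triangle by blast

theorem exco2_minimal_cycles:
  assumes k: "3 \<le> k" "3 * k \<le> 2 * n"
  shows "exco2 n k (minimal_cycles k 3) = star_co2 n k"
    and "extremal n k (minimal_cycles k 3) H \<longleftrightarrow> isomorphic_on n H (star n k)"
proof -
  have kn: "k + 2 \<le> n" using k by simp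
  have bound: "card H \<le> (n - 1 choose (k - 1)) \<or> co2 n k H < star_co2 n k"
    if H: "H \<in> free_hypergraphs n k (minimal_cycles k 3)" for H
  proof -
    have Hs: "H \<subseteq> nsets {1..n} k" using H by (simp add: free_hypergraphs_def)
    show ?thesis
      using triangle_free_card_or_co2[OF Hs free_minimal_cycles_triangle_free[OF H] k(1)]
        triangle_free_card_le[OF _ Hs free_minimal_cycles_triangle_free[OF H]] k by fastforce
  qed
  note ex = extremal_iff_star[OF k(1) kn star_at_free_minimal_cycles bound]
  show "exco2 n k (minimal_cycles k 3) = star_co2 n k" by (rule ex(1))
  \<comment> \<open>For \<open>n = 2 * k\<close> the complement of a star is complete on
    \<open>2 * k - 1\<close> vertices. There \<open>triangle_free_card_le\<close> applies, and it
    has too many edges.\<close>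
  have "\<forall>c\<in>{1..n}. {A \<in> nsets {1..n} k. c \<notin> A} \<notin> free_hypergraphs n k (minimal_cycles k 3)" if n: "n = 2 * k"
  proof (intro ballI notI)
    fix c assume c: "c \<in> {1..n}"
      and fr: "{A \<in> nsets {1..n} k. c \<notin> A} \<in> free_hypergraphs n k (minimal_cycles k 3)"
    have eq: "{A \<in> nsets {1..n} k. c \<notin> A} = nsets ({1..n} - {c}) k" by (auto simp: nsets_def)
    have cV: "card ({1..n} - {c}) = 2 * k - 1" using c n by simp
    have "card (nsets ({1..n} - {c}) k) \<le> (2 * k - 1 - 1 choose (k - 1))"
      using triangle_free_card_le[of "{1..n} - {c}" "nsets ({1..n} - {c}) k" k]
        free_minimal_cycles_triangle_free[OF fr] cV k unfolding eq by simp
    then have le: "(2 * k - 1 choose k) \<le> (2 * k - 1 - 1 choose (k - 1))" using cV by (simp add: card_nsets)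
    obtain i where i: "k = i + 3" using k le_Suc_ex by (metis add.commute)
    have "(2 * k - 1 choose k) = (2 * k - 1 - 1 choose (k - 1)) + (2 * k - 1 - 1 choose k)"
      unfolding i by (simp add: numeral_eq_Suc)
    moreover have "0 < (2 * k - 1 - 1 choose k)" using k by simp
    ultimately show False using le by linarith
  qed
  then show "extremal n k (minimal_cycles k 3) H \<longleftrightarrow> isomorphic_on n H (star n k)"
    using extremal_iff_star(3)[OF k(1) kn star_at_free_minimal_cycles bound] by blast
qed

section \<open>Stability\<close>

locale uniform_hypergraph =
  fixes V :: "'a set" and k :: nat and F :: "'a set set"
  assumes finite_V: "finite V" and F_sub: "F \<subseteq> nsets V k" and k_ge: "2 \<le> k"
begin

text \<open>The contribution of an edge when the degree square sum is distributed over the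
  edges.\<close>

definition weight :: "'a set \<Rightarrow> nat" where
  "weight A = (\<Sum>y\<in>A. degree F (A - {y}))"

lemma finite_F: "finite F"
  using F_sub finite_V finite_imp_finite_nsets finite_subset by metis

lemma edgeD:
  assumes "A \<in> F"
  shows "A \<subseteq> V" "finite A" "card A = k"
  using assms F_sub by (auto simp: nsets_def)

lemma edge_minus: "A \<in> F \<Longrightarrow> y \<in> A \<Longrightarrow> A - {y} \<in> nsets V (k - 1)"
  using edgeD[of A] by (auto simp: nsets_def)

lemma F_sub_Suc: "F \<subseteq> nsets V (Suc (k - 1))"
  using F_sub k_ge by simp

lemma degree_eq:
  assumes "Y \<in> nsets V (k - 1)"
  shows "degree F Y = card {v \<in> V - Y. insert v Y \<in> F}"
proof -
  have "real (degree F Y) = (\<Sum>x\<in>V - Y. if insert x Y \<in> F then 1 else 0)"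
    using degree_up_sum[OF finite_V F_sub_Suc assms] by (simp add: up_sum_def)
  also have "\<dots> = real (card {v \<in> V - Y. insert v Y \<in> F})"
    using finite_V by (simp add: sum.If_cases Int_def)
  finally show ?thesis by simp
qed

lemma degree_edge:
  assumes "A \<in> F" "y \<in> A"
  shows "degree F (A - {y}) = Suc (card {v \<in> V - A. insert v (A - {y}) \<in> F})"
proof -
  have "{v \<in> V - (A - {y}). insert v (A - {y}) \<in> F} = insert y {v \<in> V - A. insert v (A - {y}) \<in> F}"
    using assms edgeD[OF assms(1)] by (auto simp: insert_absorb)
  then show ?thesis using degree_eq[OF edge_minus[OF assms]] finite_V assms(2) by simp
qed

lemma degree_edge_le:
  assumes "A \<in> F" "y \<in> A"
  shows "degree F (A - {y}) \<le> card V - k + 1"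
  using degree_le[OF finite_V F_sub_Suc edge_minus[OF assms]] k_ge card_mono[OF finite_V edgeD(1)[OF assms(1)]]
    edgeD(3)[OF assms(1)] by linarith

lemma weight_le:
  assumes "A \<in> F"
  shows "weight A \<le> k * (card V - k + 1)"
  using sum_bounded_above[of A "\<lambda>y. degree F (A - {y})" "card V - k + 1"] degree_edge_le[OF assms] edgeD[OF assms]
  by (simp add: weight_def)

lemma sum_over_facets:
  assumes "A \<in> F"
  shows "(\<Sum>Y\<in>{Y \<in> nsets V (k - 1). Y \<subseteq> A}. f Y) = (\<Sum>y\<in>A. f (A - {y}))"
proof (rule sum.reindex_bij_betw[symmetric])
  show "bij_betw (\<lambda>y. A - {y}) A {Y \<in> nsets V (k - 1). Y \<subseteq> A}"
    unfolding bij_betw_def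
  proof (intro conjI)
    show "inj_on (\<lambda>y. A - {y}) A" by (auto simp: inj_on_def)
    have "Y \<in> (\<lambda>y. A - {y}) ` A" if Y: "Y \<in> nsets V (k - 1)" "Y \<subseteq> A" for Y
    proof -
      have "finite Y" "card Y = k - 1" using Y by (auto simp: nsets_def)
      then have "card (A - Y) = 1" using edgeD[OF assms] Y(2) k_ge by (simp add: card_Diff_subset)
      then obtain y where "A - Y = {y}" by (auto simp: card_1_singleton_iff)
      then have "Y = A - {y}" "y \<in> A" using Y(2) by blast+
      then show ?thesis by blast
    qed
    then show "(\<lambda>y. A - {y}) ` A = {Y \<in> nsets V (k - 1). Y \<subseteq> A}" using edge_minus[OF assms] by blast
  qed
qed

lemma sum_degree_mult:
  fixes f :: "'a set \<Rightarrow> 'b :: comm_semiring_1"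
  shows "(\<Sum>Y\<in>nsets V (k - 1). of_nat (degree F Y) * f Y) = (\<Sum>A\<in>F. \<Sum>y\<in>A. f (A - {y}))"
proof -
  have "(\<Sum>Y\<in>nsets V (k - 1). of_nat (degree F Y) * f Y) = (\<Sum>Y\<in>nsets V (k - 1). \<Sum>A\<in>{A \<in> F. Y \<subseteq> A}. f Y)"
    by (simp add: degree_def)
  also have "\<dots> = (\<Sum>A\<in>F. \<Sum>Y\<in>{Y \<in> nsets V (k - 1). Y \<subseteq> A}. f Y)"
    by (rule sum.swap_restrict) (use finite_V finite_F in \<open>auto intro: finite_imp_finite_nsets\<close>)
  also have "\<dots> = (\<Sum>A\<in>F. \<Sum>y\<in>A. f (A - {y}))"
    by (intro sum.cong sum_over_facets) auto
  finally show ?thesis .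
qed

lemma sum_degree_sq: "(\<Sum>Y\<in>nsets V (k - 1). (degree F Y)\<^sup>2) = (\<Sum>A\<in>F. weight A)"
  using sum_degree_mult[of "degree F"] by (simp add: weight_def power2_eq_square)

lemma own_degree:
  assumes "A \<in> F" "y \<in> A" "\<And>E. E \<in> F \<Longrightarrow> A - {y} \<subseteq> E \<Longrightarrow> E = A"
  shows "degree F (A - {y}) = 1"
proof -
  have "{E \<in> F. A - {y} \<subseteq> E} = {A}" using assms by blast
  then show ?thesis by (simp add: degree_def)
qed

text \<open>A facet in no other edge contributes one instead of up to \<open>card V - k + 1\<close>.
  The resulting maximum is the weight of an edge of a star.\<close>

lemma weight_own:
  assumes "A \<in> F" "c \<in> A" "\<And>E. E \<in> F \<Longrightarrow> A - {c} \<subseteq> E \<Longrightarrow> E = A"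
  shows "weight A = 1 + (\<Sum>y\<in>A - {c}. degree F (A - {y}))"
    and "weight A \<le> 1 + (k - 1) * (card V - k + 1)"
proof -
  show 1: "weight A = 1 + (\<Sum>y\<in>A - {c}. degree F (A - {y}))"
    unfolding weight_def using edgeD[OF assms(1)] assms(2) own_degree[OF assms] by (simp add: sum.remove)
  have "(\<Sum>y\<in>A - {c}. degree F (A - {y})) \<le> of_nat (card (A - {c})) * (card V - k + 1)"
    by (rule sum_bounded_above) (use degree_edge_le[OF assms(1)] in auto)
  then show "weight A \<le> 1 + (k - 1) * (card V - k + 1)" using 1 edgeD[OF assms(1)] assms(2) by simp
qed

lemma card_own_le:
  assumes "S \<subseteq> F" "\<And>A. A \<in> S \<Longrightarrow> ctr A \<in> A" "\<And>A E. A \<in> S \<Longrightarrow> E \<in> S \<Longrightarrow> A - {ctr A} \<subseteq> E \<Longrightarrow> E = A"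
  shows "card S \<le> (card V choose (k - 1))"
proof -
  have "inj_on (\<lambda>A. A - {ctr A}) S"
  proof (rule inj_onI)
    fix A B assume "A \<in> S" "B \<in> S" "A - {ctr A} = B - {ctr B}"
    moreover from this have "A - {ctr A} \<subseteq> B" by blast
    ultimately show "A = B" using assms(3)[of A B] by blast
  qed
  moreover have "(\<lambda>A. A - {ctr A}) ` S \<subseteq> nsets V (k - 1)" using edge_minus assms by blast
  ultimately have "card S \<le> card (nsets V (k - 1))"
    using finite_V by (intro card_inj_on_le) (auto intro: finite_imp_finite_nsets)
  then show ?thesis using finite_V by (simp add: card_nsets)
qed

lemma binomial_ge_power:
  assumes "2 \<le> j" "j \<le> m"
  shows "m ^ (j - 1) \<le> j ^ (j - 1) * (m - 1 choose (j - 1))"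
proof -
  have "real m / real j \<le> real (m - 1) / real (j - 1)"
    using assms by (simp add: divide_simps of_nat_diff algebra_simps)
  then have "(real m / real j) ^ (j - 1) \<le> (real (m - 1) / real (j - 1)) ^ (j - 1)" by (intro power_mono) auto
  also have "\<dots> \<le> real (m - 1 choose (j - 1))"
    using binomial_ge_n_over_k_pow_k[of "j - 1" "m - 1", where 'a = real] assms by simp
  finally have "real m ^ (j - 1) \<le> real j ^ (j - 1) * real (m - 1 choose (j - 1))"
    using assms by (simp add: power_divide divide_simps mult.commute)
  then show ?thesis by (metis (mono_tags) of_nat_le_iff of_nat_mult of_nat_power)
qed

lemma binomial_le_power: "(m - 1 choose j) \<le> m ^ j"
proof (cases "j \<le> m - 1")
  case True
  then have "(m - 1 choose j) \<le> (m - 1) ^ j" by (rule binomial_le_pow)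
  also have "\<dots> \<le> m ^ j" by (intro power_mono) auto
  finally show ?thesis .
qed (simp add: binomial_eq_0)

text \<open>Since the weights of the members of \<open>S\<close> are close to the maximum on average, some member
  \<open>A\<close> can exchange any vertex other than its centre for almost every vertex of \<open>V\<close> without
  leaving \<open>S\<close>. The own facets force all these exchanged edges to have the same centre.\<close>

lemma dominant_center:
  assumes S: "S \<subseteq> F" and ctr: "\<And>A. A \<in> S \<Longrightarrow> ctr A \<in> A"
    and own: "\<And>A E. A \<in> S \<Longrightarrow> E \<in> F \<Longrightarrow> A - {ctr A} \<subseteq> E \<Longrightarrow> E = A"
    and P: "\<And>A a. A \<in> S \<Longrightarrow> a \<in> A - {ctr A} \<Longrightarrow> P (ctr A) a"
    and few: "card (F - S) \<le> K * card V ^ (k - 2)"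
    and co: "(card V - 1 choose (k - 1)) * (1 + (card V - k + 1) * (k - 1)) \<le> (\<Sum>Y\<in>nsets V (k - 1). (degree F Y)\<^sup>2)"
    and k3: "3 \<le> k" and large: "2 * k \<le> card V" "2 * k ^ k * K \<le> card V"
  obtains A where "A \<in> S" "card {v \<in> V - {ctr A}. \<not> P (ctr A) v} \<le> 2 * k ^ k * (2 * K + 1)"
proof -
  define n where "n = card V"
  define D where "D = 1 + (k - 1) * (n - k + 1)"
  define N where "N = (n - 1 choose (k - 1))"
  define B where "B = F - S"
  \<comment> \<open>Failed exchanges of a vertex \<open>y\<close> other than the centre for a vertex
    \<open>v\<close> outside \<open>A\<close>: the result is no edge (\<open>R1\<close>), an edge
    outside \<open>S\<close> (\<open>R2\<close>), or either of these (\<open>R\<close>).\<close>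
  define R1 where "R1 A = (SIGMA y:A - {ctr A}. {v \<in> V - A. insert v (A - {y}) \<notin> F})" for A
  define R2 where "R2 A = (SIGMA y:A - {ctr A}. {v \<in> V - A. insert v (A - {y}) \<in> B})" for A
  define R where "R A = (SIGMA y:A - {ctr A}. {v \<in> V - A. insert v (A - {y}) \<notin> S})" for A
  have SF: "A \<in> F" if "A \<in> S" for A using that S by blast
  have finR: "finite (R1 A)" "finite (R2 A)" "finite (R A)" if "A \<in> S" for A
    unfolding R1_def R2_def R_def using edgeD(2)[OF SF[OF that]] finite_V by auto
  have finS: "finite S" using S finite_F finite_subset by blast
  have finB: "finite B" unfolding B_def using finite_F by simp
  have n: "2 * k \<le> n" "2 * k ^ k * K \<le> n" using large by (auto simp: n_def)
  have wR1: "weight A + card (R1 A) = D" if A: "A \<in> S" for A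
  proof -
    note eA = edgeD[OF SF[OF A]]
    have c: "card (R1 A) = (\<Sum>y\<in>A - {ctr A}. card {v \<in> V - A. insert v (A - {y}) \<notin> F})"
      unfolding R1_def using eA finite_V by (simp add: card_SigmaI)
    have "weight A + card (R1 A) = 1 + (\<Sum>y\<in>A - {ctr A}. degree F (A - {y}) + card {v \<in> V - A. insert v (A - {y}) \<notin> F})"
      using weight_own(1)[OF SF[OF A] ctr[OF A] own[OF A]] c by (simp add: sum.distrib)
    also have "(\<Sum>y\<in>A - {ctr A}. degree F (A - {y}) + card {v \<in> V - A. insert v (A - {y}) \<notin> F})
        = (\<Sum>y\<in>A - {ctr A}. n - k + 1)"
    proof (rule sum.cong[OF refl])
      fix y assume y: "y \<in> A - {ctr A}"
      have "card (V - A) = card ({v \<in> V - A. insert v (A - {y}) \<in> F} \<union> {v \<in> V - A. insert v (A - {y}) \<notin> F})"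
        by (rule arg_cong[where f = card]) blast
      also have "\<dots> = card {v \<in> V - A. insert v (A - {y}) \<in> F} + card {v \<in> V - A. insert v (A - {y}) \<notin> F}"
        using finite_V by (intro card_Un_disjoint) auto
      finally show "degree F (A - {y}) + card {v \<in> V - A. insert v (A - {y}) \<notin> F} = n - k + 1"
        using degree_edge[OF SF[OF A], of y] y eA finite_V by (simp add: card_Diff_subset n_def)
    qed
    also have "\<dots> = (k - 1) * (n - k + 1)" using eA ctr[OF A] by simp
    finally show ?thesis by (simp add: D_def)
  qed
  have R2: "(\<Sum>A\<in>S. card (R2 A)) \<le> card B * (k * n)"
  proof -
    \<comment> \<open>The resulting edge and the two exchanged vertices determine \<open>A\<close>,
      so each edge of \<open>B\<close> is reached in at most \<open>k * n\<close> ways.\<close>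
    let ?h = "\<lambda>(A, y, v). (insert v (A - {y}), v, y)"
    have "(\<Sum>A\<in>S. card (R2 A)) = card (SIGMA A:S. R2 A)" using finS finR by (simp add: card_SigmaI)
    also have "\<dots> \<le> card (SIGMA E:B. E \<times> V)"
    proof (rule card_inj_on_le)
      show "inj_on ?h (SIGMA A:S. R2 A)"
      proof (rule inj_onI)
        fix s t assume st: "s \<in> (SIGMA A:S. R2 A)" "t \<in> (SIGMA A:S. R2 A)" "?h s = ?h t"
        obtain A y v where s: "s = (A, y, v)" by (metis prod.collapse)
        obtain A' y' v' where t: "t = (A', y', v')" by (metis prod.collapse)
        have eq: "v = v'" "y = y'" "insert v (A - {y}) = insert v (A' - {y})" using st(3) s t by auto
        have "y \<in> A" "v \<notin> A" "y \<in> A'" "v \<notin> A'" using st(1,2) s t eq by (auto simp: R2_def)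
        then have "A = A'" using eq(3) by (metis Diff_iff insert_Diff insert_ident)
        then show "s = t" using s t eq by simp
      qed
      show "?h ` (SIGMA A:S. R2 A) \<subseteq> (SIGMA E:B. E \<times> V)" using edgeD(1)[OF SF] by (auto simp: R2_def)
      show "finite (SIGMA E:B. E \<times> V)" using finB finite_V edgeD(2) by (auto simp: B_def)
    qed
    also have "\<dots> = (\<Sum>E\<in>B. k * n)"
      using finB finite_V edgeD(2,3) by (subst card_SigmaI) (auto simp: B_def card_cartesian_product n_def)
    finally show ?thesis by simp
  qed
  have co': "(\<Sum>Y\<in>nsets V (k - 1). (degree F Y)\<^sup>2) \<le> (\<Sum>A\<in>S. weight A) + card B * (k * n)"
  proof -
    have "(\<Sum>A\<in>F. weight A) = (\<Sum>A\<in>B. weight A) + (\<Sum>A\<in>S. weight A)"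
      unfolding B_def using sum.subset_diff[OF S finite_F] .
    moreover have "(\<Sum>A\<in>B. weight A) \<le> (\<Sum>A\<in>B. k * n)"
    proof (rule sum_mono)
      fix A assume "A \<in> B"
      then have "weight A \<le> k * (card V - k + 1)" using weight_le by (simp add: B_def)
      also have "\<dots> \<le> k * n" using n k_ge by (intro mult_le_mono2) (simp add: n_def)
      finally show "weight A \<le> k * n" .
    qed
    ultimately show ?thesis unfolding sum_degree_sq by simp
  qed
  have sumD: "(\<Sum>A\<in>S. weight A) + (\<Sum>A\<in>S. card (R1 A)) = D * card S"
    using wR1 by (simp flip: sum.distrib add: mult.commute)
  have ND: "N * D + (\<Sum>A\<in>S. card (R1 A)) \<le> D * card S + card B * (k * n)"
    using co co' sumD unfolding N_def D_def n_def by (simp only: mult.commute[of "k - 1"])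
  have nk: "n ^ (k - 1) = n ^ (k - 2) * n" using k3 by (simp flip: power_Suc2 add: Suc_diff_Suc numeral_2_eq_2)
  have cB: "card B * (k * n) \<le> k * K * n ^ (k - 1)"
  proof -
    have "card B \<le> K * n ^ (k - 2)" using few by (simp add: B_def n_def)
    from mult_le_mono1[OF this, of "k * n"] show ?thesis unfolding nk by (simp only: ac_simps)
  qed
  have Dle: "D \<le> k * n" "n \<le> D"
  proof -
    obtain i where i: "k = i + 3" using k3 le_Suc_ex by (metis add.commute)
    obtain d where d: "n = 2 * k + d" using n le_Suc_ex by blast
    show "D \<le> k * n" "n \<le> D" unfolding D_def d i by (simp_all add: algebra_simps)
  qed
  have cS: "card S \<le> N + n ^ (k - 2)"
  proof -
    have "card S \<le> (n choose (k - 1))" unfolding n_def using card_own_le[OF S ctr own] SF by blast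
    also have "\<dots> = N + (n - 1 choose (k - 2))"
    proof -
      obtain m where "n = Suc m" using n k3 by (cases n) auto
      moreover obtain j where "k = 2 + j" using k_ge le_Suc_ex by blast
      ultimately show ?thesis by (simp add: N_def)
    qed
    also have "\<dots> \<le> N + n ^ (k - 2)" using binomial_le_power by simp
    finally show ?thesis .
  qed
  have "(\<Sum>A\<in>S. card (R1 A)) \<le> D * n ^ (k - 2) + k * K * n ^ (k - 1)"
    using ND cB mult_le_mono2[OF cS, of D] unfolding distrib_left mult.commute[of N] by linarith
  also have "D * n ^ (k - 2) \<le> k * n ^ (k - 1)"
    using mult_le_mono1[OF Dle(1), of "n ^ (k - 2)"] unfolding nk by (simp only: ac_simps)
  finally have r1: "(\<Sum>A\<in>S. card (R1 A)) \<le> k * n ^ (k - 1) + k * K * n ^ (k - 1)" by simp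
  have RR: "card (R A) \<le> card (R1 A) + card (R2 A)" if A: "A \<in> S" for A
  proof -
    have "R A \<subseteq> R1 A \<union> R2 A" by (auto simp: R_def R1_def R2_def B_def)
    then have "card (R A) \<le> card (R1 A \<union> R2 A)" using finR[OF A] by (intro card_mono) auto
    also have "\<dots> \<le> card (R1 A) + card (R2 A)" by (rule card_Un_le)
    finally show ?thesis .
  qed
  have "(\<Sum>A\<in>S. card (R A)) \<le> (\<Sum>A\<in>S. card (R1 A)) + (\<Sum>A\<in>S. card (R2 A))"
    using sum_mono[of S "\<lambda>A. card (R A)" "\<lambda>A. card (R1 A) + card (R2 A)"] RR by (simp add: sum.distrib)
  also have "\<dots> \<le> k * n ^ (k - 1) + k * K * n ^ (k - 1) + k * K * n ^ (k - 1)" using r1 R2 cB by linarith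
  finally have tot: "(\<Sum>A\<in>S. card (R A)) \<le> k * (2 * K + 1) * n ^ (k - 1)" by (simp add: algebra_simps)
  \<comment> \<open>\<open>S\<close> has full order: it lacks at most
    \<open>k * K * n ^ (k - 2)\<close> of \<open>N\<close> edges, and \<open>large\<close> keeps
    this below half of the lower bound for \<open>N\<close>.\<close>
  have lower: "n ^ (k - 1) \<le> 2 * k ^ (k - 1) * card S"
  proof -
    have "k * K * n ^ (k - 1) \<le> D * (k * K * n ^ (k - 2))"
      using mult_le_mono1[OF Dle(2), of "k * K * n ^ (k - 2)"] unfolding nk by (simp only: ac_simps)
    then have "D * N \<le> D * (card S + k * K * n ^ (k - 2))"
      using ND cB by (simp only: distrib_left mult.commute[of N])
    moreover have "0 < D" by (simp add: D_def)
    ultimately have "N \<le> card S + k * K * n ^ (k - 2)" by (metis nat_mult_le_cancel1)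
    then have "k ^ (k - 1) * N \<le> k ^ (k - 1) * (card S + k * K * n ^ (k - 2))" by (rule mult_le_mono2)
    also have "\<dots> = k ^ (k - 1) * card S + (k ^ (k - 1) * k) * K * n ^ (k - 2)" by (simp only: distrib_left ac_simps)
    also have "k ^ (k - 1) * k = k ^ k" using k_ge by (simp flip: power_Suc2)
    finally have "n ^ (k - 1) \<le> k ^ (k - 1) * card S + k ^ k * K * n ^ (k - 2)"
      using binomial_ge_power[of k n] k_ge n unfolding N_def by linarith
    moreover have "2 * k ^ k * K * n ^ (k - 2) \<le> n ^ (k - 1)"
      using mult_le_mono1[OF n(2), of "n ^ (k - 2)"] unfolding nk by (simp only: ac_simps)
    ultimately show ?thesis by (simp only: mult.assoc; linarith)
  qed
  have "\<exists>A\<in>S. card (R A) \<le> 2 * k ^ k * (2 * K + 1)"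
  proof (rule ccontr)
    assume "\<not> ?thesis"
    then have "(\<Sum>A\<in>S. 2 * k ^ k * (2 * K + 1) + 1) \<le> (\<Sum>A\<in>S. card (R A))"
      by (intro sum_mono) (use not_less_eq_eq in fastforce)
    then have "card S * (2 * k ^ k * (2 * K + 1) + 1) \<le> k * (2 * K + 1) * n ^ (k - 1)" using tot by simp
    also have "\<dots> \<le> k * (2 * K + 1) * (2 * k ^ (k - 1) * card S)" using lower by (rule mult_le_mono2)
    also have "\<dots> = card S * (2 * (k ^ (k - 1) * k) * (2 * K + 1))" by (simp only: ac_simps)
    also have "k ^ (k - 1) * k = k ^ k" using k_ge by (simp flip: power_Suc2)
    finally have "card S = 0" by simp
    then have "n ^ (k - 1) = 0" using lower by simp
    then show False using n k_ge by simp
  qed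
  then obtain A where A: "A \<in> S" "card (R A) \<le> 2 * k ^ k * (2 * K + 1)" by blast
  note eA = edgeD[OF SF[OF A(1)]]
  have "P (ctr A) v" if v: "v \<in> V - {ctr A}" "v \<notin> snd ` R A" for v
  proof (cases "v \<in> A")
    case True
    then show ?thesis using P[OF A(1)] v by blast
  next
    case False
    have ex: "insert v (A - {y}) \<in> S" if y: "y \<in> A - {ctr A}" for y
    proof (rule ccontr)
      assume "insert v (A - {y}) \<notin> S"
      then have "(y, v) \<in> R A" using y v False by (simp add: R_def)
      then show False using v(2) by force
    qed
    have "card (A - {ctr A}) \<noteq> 0" using eA ctr[OF A(1)] k_ge by simp
    then have "A - {ctr A} \<noteq> {}" by (intro notI) simp
    then obtain y where y: "y \<in> A - {ctr A}" by blast
    \<comment> \<open>Were \<open>v\<close> the centre of \<open>A'\<close>, its own facet would lie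
      in \<open>A\<close>; were it another vertex \<open>z\<close> different from
      \<open>ctr A\<close>, the own facet would lie in the edge \<open>insert v (A - {z})\<close>.
      So \<open>A'\<close> keeps the centre of \<open>A\<close>, and \<open>P\<close> applies to
      \<open>v\<close>.\<close>
    define A' where "A' = insert v (A - {y})"
    have A': "A' \<in> S" using ex[OF y] by (simp add: A'_def)
    define z where "z = ctr A'"
    have z: "z \<in> A'" using ctr[OF A'] by (simp add: z_def)
    have "z \<noteq> v"
    proof
      assume "z = v"
      then have "A' - {ctr A'} \<subseteq> A" by (auto simp: z_def A'_def)
      then have "A = A'" using own[OF A' SF[OF A(1)]] by blast
      then show False using False by (auto simp: A'_def)
    qed
    moreover have "z = ctr A"
    proof (rule ccontr)
      assume ne: "z \<noteq> ctr A"
      then have zA: "z \<in> A - {ctr A}" "z \<noteq> y" using z \<open>z \<noteq> v\<close> by (auto simp: A'_def)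
      have "insert v (A - {z}) \<in> F" using ex[OF zA(1)] SF by blast
      moreover have "A' - {z} \<subseteq> insert v (A - {z})" unfolding A'_def by blast
      then have "A' - {ctr A'} \<subseteq> insert v (A - {z})" by (simp only: z_def)
      ultimately have "insert v (A - {z}) = A'" using own[OF A'] by blast
      moreover have "y \<in> insert v (A - {z})" "y \<notin> A'" using y zA False by (auto simp: A'_def)
      ultimately show False by simp
    qed
    ultimately have "v \<in> A' - {ctr A'}" "ctr A' = ctr A" by (auto simp: A'_def z_def)
    then show ?thesis using P[OF A', of v] by simp
  qed
  then have "{v \<in> V - {ctr A}. \<not> P (ctr A) v} \<subseteq> snd ` R A" by blast
  then have "card {v \<in> V - {ctr A}. \<not> P (ctr A) v} \<le> card (snd ` R A)" using finR[OF A(1)] by (intro card_mono) auto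
  also have "\<dots> \<le> card (R A)" using finR[OF A(1)] by (intro card_image_le)
  finally show ?thesis using that[OF A(1)] A(2) by linarith
qed

end

section \<open>Flexible sets\<close>

text \<open>A substitute for kernels of sunflowers: a kernel with more than \<open>w\<close> petals
  is flexible, since some petal avoids any given \<open>w\<close> vertices.\<close>

definition flex :: "'a set set \<Rightarrow> nat \<Rightarrow> 'a set \<Rightarrow> bool" where
  "flex F w S \<longleftrightarrow> (\<forall>W. finite W \<and> card W \<le> w \<longrightarrow> (\<exists>E\<in>F. S \<subseteq> E \<and> E \<inter> W \<subseteq> S))"

lemma flexD:
  assumes "flex F w S" "finite W" "card W \<le> w"
  obtains E where "E \<in> F" "S \<subseteq> E" "E \<inter> W \<subseteq> S"
  using assms unfolding flex_def by blast

lemma flex_edge: "E \<in> F \<Longrightarrow> flex F w E"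
  unfolding flex_def by blast

definition linear_triangle_free :: "'a set set \<Rightarrow> bool" where
  "linear_triangle_free F \<longleftrightarrow> (\<forall>A\<in>F. \<forall>B\<in>F. \<forall>C\<in>F.
     card (A \<inter> B) = 1 \<longrightarrow> card (B \<inter> C) = 1 \<longrightarrow> card (C \<inter> A) = 1 \<longrightarrow> A \<inter> B \<inter> C \<noteq> {})"

definition linear_path_free :: "'a set set \<Rightarrow> bool" where
  "linear_path_free F \<longleftrightarrow> (\<forall>A\<in>F. \<forall>B\<in>F. \<forall>C\<in>F. card (A \<inter> B) = 1 \<longrightarrow> card (B \<inter> C) = 1 \<longrightarrow> A \<inter> C \<noteq> {})"

lemma linear_triangle_freeD:
  "linear_triangle_free F \<Longrightarrow> A \<in> F \<Longrightarrow> B \<in> F \<Longrightarrow> C \<in> F \<Longrightarrow> card (A \<inter> B) = 1 \<Longrightarrow> card (B \<inter> C) = 1 \<Longrightarrow>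
    card (C \<inter> A) = 1 \<Longrightarrow> A \<inter> B \<inter> C \<noteq> {}"
  unfolding linear_triangle_free_def by blast

lemma linear_path_freeD:
  "linear_path_free F \<Longrightarrow> A \<in> F \<Longrightarrow> B \<in> F \<Longrightarrow> C \<in> F \<Longrightarrow> card (A \<inter> B) = 1 \<Longrightarrow> card (B \<inter> C) = 1 \<Longrightarrow> A \<inter> C \<noteq> {}"
  unfolding linear_path_free_def by blast

text \<open>For a set that is not flexible, \<open>wit\<close> is a bounded set of vertices one of which lies in
  every edge containing the set.\<close>

definition wit :: "'a set set \<Rightarrow> nat \<Rightarrow> 'a set \<Rightarrow> 'a set" where
  "wit F w S = (if flex F w S then {} else SOME W. finite W \<and> card W \<le> w \<and> (\<forall>E\<in>F. S \<subseteq> E \<longrightarrow> \<not> E \<inter> W \<subseteq> S))"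

text \<open>These sets take the place of the kernels inside an edge in the delta-system method: they
  are stable under intersection, and the proper ones are flexible.\<close>

definition wit_closed :: "'a set set \<Rightarrow> nat \<Rightarrow> 'a set \<Rightarrow> 'a set \<Rightarrow> bool" where
  "wit_closed F w A S \<longleftrightarrow> S \<subseteq> A \<and> (\<forall>T\<subseteq>S. wit F w T \<inter> A \<subseteq> S)"

lemma wit_not_flex:
  assumes "\<not> flex F w S"
  shows "finite (wit F w S) \<and> card (wit F w S) \<le> w \<and> (\<forall>E\<in>F. S \<subseteq> E \<longrightarrow> \<not> E \<inter> wit F w S \<subseteq> S)"
proof -
  have "\<exists>W. finite W \<and> card W \<le> w \<and> (\<forall>E\<in>F. S \<subseteq> E \<longrightarrow> \<not> E \<inter> W \<subseteq> S)" using assms by (simp add: flex_def conj_assoc)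
  from someI_ex[OF this] show ?thesis using assms unfolding wit_def by simp
qed

lemma finite_wit: "finite (wit F w S)" and card_wit_le: "card (wit F w S) \<le> w"
  using wit_not_flex[of F w S] by (cases "flex F w S"; simp add: wit_def)+

lemma wit_closed_INT:
  assumes "I \<noteq> {}" "\<And>i. i \<in> I \<Longrightarrow> wit_closed F w A (S i)"
  shows "wit_closed F w A (\<Inter>i\<in>I. S i)"
  unfolding wit_closed_def
proof (intro conjI allI impI)
  show "(\<Inter>i\<in>I. S i) \<subseteq> A" using assms unfolding wit_closed_def by blast
  fix T assume T: "T \<subseteq> (\<Inter>i\<in>I. S i)"
  have "wit F w T \<inter> A \<subseteq> S i" if "i \<in> I" for i
  proof -
    have "T \<subseteq> S i" using T that by blast
    then show ?thesis using assms(2)[OF that] unfolding wit_closed_def by blast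
  qed
  then show "wit F w T \<inter> A \<subseteq> (\<Inter>i\<in>I. S i)" by blast
qed

text \<open>If \<open>S\<close> were not flexible, its witness set would contain a vertex of
  \<open>A\<close> outside \<open>S\<close>; closedness for \<open>T = S\<close> forbids
  this.\<close>

lemma wit_closed_flex:
  assumes "A \<in> F" "wit_closed F w A S" "S \<noteq> A"
  shows "flex F w S"
proof (rule ccontr)
  assume "\<not> flex F w S"
  then have "\<not> A \<inter> wit F w S \<subseteq> S" using wit_not_flex[of F w S] assms(1,2) unfolding wit_closed_def by blast
  then show False using assms(2) unfolding wit_closed_def by blast
qed

section \<open>Edges with many flexible subsets\<close>

text \<open>The size \<open>k - 2\<close> is chosen because failure at \<open>P\<close> leaves
  boundedly many edges over \<open>P\<close>, so the exceptional edges have order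
  \<open>n ^ (k - 2)\<close>.\<close>

definition nice :: "nat \<Rightarrow> 'a set set \<Rightarrow> nat \<Rightarrow> 'a set \<Rightarrow> bool" where
  "nice k F w A \<longleftrightarrow> (\<forall>P\<subseteq>A. card P = k - 2 \<longrightarrow> (\<exists>S. P \<subseteq> S \<and> S \<noteq> A \<and> wit_closed F w A S))"

text \<open>In a large star exactly the facet opposite the centre would be unusable. A single
  blocked vertex is therefore the pattern of an edge with a centre.\<close>

definition blocked :: "'a set set \<Rightarrow> nat \<Rightarrow> 'a set \<Rightarrow> 'a set" where
  "blocked F w A = {x \<in> A. \<not> wit_closed F w A (A - {x})}"

lemma two_points: "2 \<le> card B \<Longrightarrow> \<exists>a b. a \<in> B \<and> b \<in> B \<and> a \<noteq> b"
proof -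
  assume "2 \<le> card B"
  then obtain T where T: "T \<subseteq> B" "card T = 2" using obtain_subset_with_card_n[of 2 B] by blast
  then obtain a b where "T = {a, b}" "a \<noteq> b" by (meson card_2_iff)
  then show ?thesis using T by blast
qed

lemma three_points: "3 \<le> card B \<Longrightarrow> \<exists>a b c. {a, b, c} \<subseteq> B \<and> a \<noteq> b \<and> b \<noteq> c \<and> a \<noteq> c"
proof -
  assume "3 \<le> card B"
  then obtain T where T: "T \<subseteq> B" "card T = 3" using obtain_subset_with_card_n[of 3 B] by blast
  then obtain a b c where "T = {a, b, c}" "a \<noteq> b" "b \<noteq> c" "a \<noteq> c" by (meson card_3_iff)
  then show ?thesis using T by blast
qed

context uniform_hypergraph
begin

definition reach :: "nat \<Rightarrow> 'a set \<Rightarrow> 'a set" where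
  "reach w P = (\<Union>T\<in>Pow P. wit F w T)"

lemma reach: "finite P \<Longrightarrow> finite (reach w P)" "finite P \<Longrightarrow> card P \<le> k \<Longrightarrow> card (reach w P) \<le> 2 ^ k * w"
proof -
  assume P: "finite P"
  show "finite (reach w P)" unfolding reach_def using P finite_wit by blast
  assume "card P \<le> k"
  have "card (reach w P) \<le> (\<Sum>T\<in>Pow P. card (wit F w T))" unfolding reach_def using P by (intro card_UN_le) auto
  also have "\<dots> \<le> of_nat (card (Pow P)) * w" by (rule sum_bounded_above) (rule card_wit_le)
  also have "\<dots> \<le> 2 ^ k * w" using P \<open>card P \<le> k\<close> by (intro mult_le_mono1) (simp add: card_Pow)
  finally show "card (reach w P) \<le> 2 ^ k * w" .
qed

text \<open>If no proper closed subset contains \<open>P\<close>, some witness of a subset of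
  \<open>P\<close> supplies a further vertex \<open>u\<close> of the edge, and some witness of a
  subset of \<open>insert u P\<close> the last one. Each time there are at most
  \<open>2 ^ k * w\<close> choices.\<close>

lemma card_not_nice:
  "card {A \<in> F. \<not> nice k F w A} \<le> (2 ^ k * w)\<^sup>2 * card V ^ (k - 2)"
proof -
  define M where "M = 2 ^ k * w"
  define Q where "Q P = (\<Union>u\<in>reach w P. (\<lambda>v. insert v (insert u P)) ` reach w (insert u P))" for P
  have Q: "finite (Q P)" "card (Q P) \<le> M * M" if P: "P \<in> nsets V (k - 2)" for P
  proof -
    have fP: "finite P" "card P = k - 2" using P by (auto simp: nsets_def)
    then have ci: "card (insert u P) \<le> k" for u using card_insert_le_m1[of k P u] k_ge by simp
    show "finite (Q P)" unfolding Q_def using fP by (intro finite_UN_I finite_imageI reach(1)) auto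
    have "card (Q P) \<le> (\<Sum>u\<in>reach w P. card ((\<lambda>v. insert v (insert u P)) ` reach w (insert u P)))"
      unfolding Q_def using fP reach(1) by (intro card_UN_le) auto
    also have "\<dots> \<le> of_nat (card (reach w P)) * M"
    proof (rule sum_bounded_above)
      fix u
      have "card ((\<lambda>v. insert v (insert u P)) ` reach w (insert u P)) \<le> card (reach w (insert u P))"
        using fP reach(1) by (intro card_image_le) auto
      then show "card ((\<lambda>v. insert v (insert u P)) ` reach w (insert u P)) \<le> M"
        using reach(2)[of "insert u P" w] fP ci unfolding M_def by fastforce
    qed
    also have "\<dots> \<le> M * M" using reach(2)[of P w] fP by (simp add: M_def)
    finally show "card (Q P) \<le> M * M" .
  qed
  have "{A \<in> F. \<not> nice k F w A} \<subseteq> (\<Union>P\<in>nsets V (k - 2). Q P)"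
  proof
    fix A assume "A \<in> {A \<in> F. \<not> nice k F w A}"
    then have A: "A \<in> F" "\<not> nice k F w A" by auto
    note eA = edgeD[OF A(1)]
    obtain P where P: "P \<subseteq> A" "card P = k - 2" "\<And>S. P \<subseteq> S \<Longrightarrow> S \<noteq> A \<Longrightarrow> \<not> wit_closed F w A S"
      using A(2) unfolding nice_def by blast
    have fP: "finite P" using P(1) eA(2) finite_subset by blast
    have step: "\<exists>u\<in>reach w S. u \<in> A - S" if S: "P \<subseteq> S" "S \<subseteq> A" "S \<noteq> A" for S
    proof -
      have "\<not> wit_closed F w A S" using P(3) S by blast
      then obtain T where "T \<subseteq> S" "\<not> wit F w T \<inter> A \<subseteq> S" using S unfolding wit_closed_def by blast
      then show ?thesis unfolding reach_def by blast
    qed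
    have "P \<noteq> A" using P(2) eA k_ge by auto
    then obtain u where u: "u \<in> reach w P" "u \<in> A - P" using step P(1) by blast
    have cu: "card (insert u P) = k - 1" using u P fP k_ge by simp
    then have "insert u P \<noteq> A" using eA k_ge by auto
    then obtain v where v: "v \<in> reach w (insert u P)" "v \<in> A - insert u P" using step[of "insert u P"] u P by blast
    have "card (insert v (insert u P)) = k" using cu v fP k_ge by simp
    then have "insert v (insert u P) = A" using eA u v P(1) by (intro card_subset_eq) auto
    then have "A \<in> Q P" unfolding Q_def using u v by blast
    moreover have "P \<in> nsets V (k - 2)" using P fP eA by (auto simp: nsets_def)
    ultimately show "A \<in> (\<Union>P\<in>nsets V (k - 2). Q P)" by blast
  qed
  then have "card {A \<in> F. \<not> nice k F w A} \<le> card (\<Union>P\<in>nsets V (k - 2). Q P)"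
    using Q finite_V by (intro card_mono) (auto intro!: finite_imp_finite_nsets)
  also have "\<dots> \<le> (\<Sum>P\<in>nsets V (k - 2). card (Q P))"
    using finite_V by (intro card_UN_le finite_imp_finite_nsets)
  also have "\<dots> \<le> of_nat (card (nsets V (k - 2))) * (M * M)" by (rule sum_bounded_above) (rule Q)
  also have "\<dots> = M * M * (card V choose (k - 2))" using finite_V by (simp add: card_nsets)
  also have "\<dots> \<le> M * M * card V ^ (k - 2)"
  proof (rule mult_le_mono2)
    show "(card V choose (k - 2)) \<le> card V ^ (k - 2)"
      by (cases "k - 2 \<le> card V") (auto intro: binomial_le_pow simp: binomial_eq_0)
  qed
  finally show ?thesis by (simp add: M_def power2_eq_square)
qed

text \<open>\<open>S\<close> is obtained as an intersection of closed sets. An unblocked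
  \<open>x\<close> is cut off by \<open>A - {x}\<close>. A blocked \<open>x\<close> is cut off by
  \<open>A - {x, y}\<close> with a second blocked \<open>y\<close> outside \<open>S\<close>: a
  proper closed set over it can be no larger, as neither \<open>A - {x}\<close> nor
  \<open>A - {y}\<close> is closed. Only a single blocked vertex outside \<open>S\<close> obstructs
  this.\<close>

lemma nice_flex:
  assumes A: "A \<in> F" "nice k F w A" and S: "S \<subseteq> A" "S \<noteq> A"
    and "blocked F w A \<subseteq> S \<or> 2 \<le> card (blocked F w A - S)"
  shows "flex F w S"
proof -
  let ?N = "blocked F w A"
  note eA = edgeD[OF A(1)]
  have NA: "?N \<subseteq> A" by (auto simp: blocked_def)
  then have fN: "finite ?N" using eA finite_subset by blast
  have "\<exists>g. wit_closed F w A g \<and> S \<subseteq> g \<and> x \<notin> g" if x: "x \<in> A - S" for x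
  proof (cases "x \<in> ?N")
    case False
    then have "wit_closed F w A (A - {x})" using x by (auto simp: blocked_def)
    then show ?thesis using S x by blast
  next
    case True
    have "\<not> ?N - S \<subseteq> {x}"
    proof
      assume "?N - S \<subseteq> {x}"
      then have "card (?N - S) \<le> 1" using card_mono[of "{x}" "?N - S"] by simp
      then show False using assms(5) True x by auto
    qed
    then obtain y where y: "y \<in> ?N - S" "y \<noteq> x" by blast
    have "card (A - {x, y}) = k - 2" using y True NA x eA k_ge by (subst card_Diff_subset) auto
    with A(2)[unfolded nice_def, rule_format, of "A - {x, y}"]
    obtain T where T: "A - {x, y} \<subseteq> T" "T \<noteq> A" "wit_closed F w A T" by blast
    have TA: "T \<subseteq> A" using T(3) by (simp add: wit_closed_def)
    have "T \<noteq> A - {x}" "T \<noteq> A - {y}" using T(3) True y by (auto simp: blocked_def)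
    then have "x \<notin> T" using T TA by blast
    then show ?thesis using T x y S by blast
  qed
  then obtain g where g: "\<And>x. x \<in> A - S \<Longrightarrow> wit_closed F w A (g x) \<and> S \<subseteq> g x \<and> x \<notin> g x" by metis
  have ne: "A - S \<noteq> {}" using S by blast
  have "(\<Inter>x\<in>A - S. g x) = S"
  proof
    have "g x \<subseteq> A" if "x \<in> A - S" for x using g[OF that] by (simp add: wit_closed_def)
    then show "(\<Inter>x\<in>A - S. g x) \<subseteq> S" using g ne by blast
    show "S \<subseteq> (\<Inter>x\<in>A - S. g x)" using g by blast
  qed
  then have "wit_closed F w A S" using wit_closed_INT[OF ne, of F w A g] g by simp
  then show ?thesis using wit_closed_flex A(1) S(2) by blast
qed

section \<open>Flexible sets without linear triangles or linear paths\<close>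

lemma flexible_in_edge:
  assumes "flex F w S"
  shows "finite S" "card S \<le> k" "S \<subseteq> V"
proof -
  obtain E where E: "E \<in> F" "S \<subseteq> E" using flexD[OF assms, of "{}"] by auto
  then show "finite S" "card S \<le> k" "S \<subseteq> V" using edgeD[OF E(1)] card_mono[of E S] finite_subset by auto
qed

text \<open>The sets extend to edges one after another, each avoiding the other two sets or edges,
  which occupy at most \<open>2 * k\<close> vertices. The pairwise intersections stay as they are,
  and the edges form a linear triangle.\<close>

lemma no_flex_triangle:
  assumes tf: "linear_triangle_free F" and w: "2 * k \<le> w"
    and f: "flex F w S1" "flex F w S2" "flex F w S3"
    and i: "S1 \<inter> S2 = {x}" "S2 \<inter> S3 = {y}" "S3 \<inter> S1 = {z}" "x \<noteq> y"
  shows False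
proof -
  note b = flexible_in_edge[OF f(1)] flexible_in_edge[OF f(2)] flexible_in_edge[OF f(3)]
  have "card (S2 \<union> S3) \<le> w" using card_Un_le[of S2 S3] b w by linarith
  then obtain E1 where E1: "E1 \<in> F" "S1 \<subseteq> E1" "E1 \<inter> (S2 \<union> S3) \<subseteq> S1" using flexD[OF f(1)] b by blast
  note e1 = edgeD[OF E1(1)]
  have "card (E1 \<union> S3) \<le> w" using card_Un_le[of E1 S3] b e1 w by linarith
  then obtain E2 where E2: "E2 \<in> F" "S2 \<subseteq> E2" "E2 \<inter> (E1 \<union> S3) \<subseteq> S2" using flexD[OF f(2)] b e1 by blast
  note e2 = edgeD[OF E2(1)]
  have "card (E1 \<union> E2) \<le> w" using card_Un_le[of E1 E2] e1 e2 w by linarith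
  then obtain E3 where E3: "E3 \<in> F" "S3 \<subseteq> E3" "E3 \<inter> (E1 \<union> E2) \<subseteq> S3" using flexD[OF f(3)] e1 e2 by blast
  have "E1 \<inter> E2 = S1 \<inter> S2" using E1(2,3) E2(2,3) by blast
  moreover have "E2 \<inter> E3 = S2 \<inter> S3" using E2(2,3) E3(2,3) by blast
  moreover have "E3 \<inter> E1 = S3 \<inter> S1" using E1(2,3) E3(2,3) by blast
  ultimately have "E1 \<inter> E2 = {x}" "E2 \<inter> E3 = {y}" "E3 \<inter> E1 = {z}" using i by simp_all
  moreover have "E1 \<inter> E2 \<inter> E3 = (E1 \<inter> E2) \<inter> (E2 \<inter> E3)" by blast
  ultimately show False using linear_triangle_freeD[OF tf E1(1) E2(1) E3(1)] i(4) by simp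
qed

lemma triangle_edge_of_flex_center:
  assumes "linear_triangle_free F" "2 * k \<le> w" "flex F w {c, a}" "flex F w {c, b}" "a \<noteq> b" "C \<in> F" "c \<notin> C" "a \<in> C"
  shows "b \<notin> C"
proof
  assume "b \<in> C"
  then show False
    using no_flex_triangle[OF assms(1,2,3) flex_edge[OF assms(6)] assms(4), of a b c] assms by blast
qed

lemma path_edge_of_flex_center:
  assumes pf: "linear_path_free F" and w: "2 * k \<le> w" and f: "flex F w {c}" "flex F w {c, a}" and C: "C \<in> F" "c \<notin> C"
  shows "a \<notin> C"
proof
  assume a: "a \<in> C"
  note eC = edgeD[OF C(1)]
  have "card C \<le> w" using eC w by simp
  then obtain E where E: "E \<in> F" "{c, a} \<subseteq> E" "E \<inter> C \<subseteq> {c, a}" using flexD[OF f(2)] eC by blast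
  note eE = edgeD[OF E(1)]
  have "card (C \<union> E) \<le> w" using card_Un_le[of C E] eC eE w by linarith
  then obtain E' where E': "E' \<in> F" "{c} \<subseteq> E'" "E' \<inter> (C \<union> E) \<subseteq> {c}" using flexD[OF f(1)] eC eE by blast
  have "C \<inter> E = {a}" "E \<inter> E' = {c}" "C \<inter> E' = {}" using E E' a C(2) by blast+
  then show False using linear_path_freeD[OF pf C(1) E(1) E'(1)] by simp
qed

lemma two_flex_points_path:
  assumes pf: "linear_path_free F" and w: "2 * k \<le> w" and f: "flex F w {a}" "flex F w {b}"
    and A: "A \<in> F" "a \<in> A" "b \<in> A"
  shows "a = b"
proof (rule ccontr)
  assume ab: "a \<noteq> b"
  note eA = edgeD[OF A(1)]
  have "card A \<le> w" using eA w by simp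
  then obtain E where E: "E \<in> F" "{a} \<subseteq> E" "E \<inter> A \<subseteq> {a}" using flexD[OF f(1)] eA by blast
  note eE = edgeD[OF E(1)]
  have "card (A \<union> E) \<le> w" using card_Un_le[of A E] eA eE w by linarith
  then obtain E' where E': "E' \<in> F" "{b} \<subseteq> E'" "E' \<inter> (A \<union> E) \<subseteq> {b}" using flexD[OF f(2)] eA eE by blast
  have "E \<inter> A = {a}" "A \<inter> E' = {b}" "E \<inter> E' = {}" using E E' A ab by blast+
  then show False using linear_path_freeD[OF pf E(1) A(1) E'(1)] by simp
qed

text \<open>Two flexible vertices in one edge give a linear path. By \<open>nice_flex\<close> all
  vertices are flexible if no vertex or at least three are blocked, and the other
  \<open>k - 2 \<ge> 2\<close> vertices are flexible if exactly two are.\<close>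

lemma blocked_path:
  assumes pf: "linear_path_free F" and w: "2 * k \<le> w" and A: "A \<in> F" "nice k F w A" and k: "4 \<le> k"
  shows "card (blocked F w A) = 1"
proof (rule ccontr)
  let ?N = "blocked F w A"
  assume ne: "card ?N \<noteq> 1"
  note eA = edgeD[OF A(1)]
  have NA: "?N \<subseteq> A" by (auto simp: blocked_def)
  then have fN: "finite ?N" using eA finite_subset by blast
  have fl: "flex F w {x}" if x: "x \<in> A" "?N \<subseteq> {x} \<or> 2 \<le> card (?N - {x})" for x
  proof -
    have "{x} \<noteq> A" using eA k by auto
    then show ?thesis using nice_flex[OF A, of "{x}"] x by blast
  qed
  have "\<exists>B\<subseteq>A. 2 \<le> card B \<and> (\<forall>x\<in>B. flex F w {x})"
  proof (cases "card ?N = 2")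
    case True
    have "card (A - ?N) = k - 2" using NA fN eA True by (simp add: card_Diff_subset)
    moreover have "flex F w {x}" if "x \<in> A - ?N" for x using fl[of x] that True by simp
    ultimately show ?thesis using k by (intro exI[of _ "A - ?N"]) auto
  next
    case False
    then have N: "?N = {} \<or> 3 \<le> card ?N" using ne fN card_0_eq[OF fN] by linarith
    have "flex F w {x}" if x: "x \<in> A" for x
    proof -
      have "card ?N - 1 \<le> card (?N - {x})" using fN by (simp add: card_Diff_singleton_if)
      then have "3 \<le> card ?N \<Longrightarrow> 2 \<le> card (?N - {x})" by linarith
      then show ?thesis using fl[OF x] N by blast
    qed
    then show ?thesis using eA k by (intro exI[of _ A]) auto
  qed
  then obtain B where B: "B \<subseteq> A" "2 \<le> card B" "\<forall>x\<in>B. flex F w {x}" by blast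
  from two_points[OF B(2)] obtain a b where "a \<in> B" "b \<in> B" "a \<noteq> b" by blast
  then show False using two_flex_points_path[OF pf w _ _ A(1), of a b] B by blast
qed

text \<open>The same analysis with pairs: three vertices of an edge cannot have all three pairs
  flexible. For \<open>k = 4\<close> with two blocked vertices the only pairs provided are the
  blocked one and its complement, which form no triangle.\<close>

lemma blocked_triangle:
  assumes tf: "linear_triangle_free F" and w: "2 * k \<le> w" and A: "A \<in> F" "nice k F w A" and k: "4 \<le> k"
  shows "card (blocked F w A) = 1 \<or> k = 4 \<and> card (blocked F w A) = 2"
proof (rule ccontr)
  let ?N = "blocked F w A"
  assume ne: "\<not> (card ?N = 1 \<or> k = 4 \<and> card ?N = 2)"
  note eA = edgeD[OF A(1)]
  have NA: "?N \<subseteq> A" by (auto simp: blocked_def)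
  then have fN: "finite ?N" using eA finite_subset by blast
  have bad: False if "{a, b, c} \<subseteq> A" "a \<noteq> b" "b \<noteq> c" "a \<noteq> c"
    "flex F w {a, b}" "flex F w {b, c}" "flex F w {c, a}" for a b c
    using no_flex_triangle[OF tf w that(5-7), of b c a] that by blast
  have fl: "flex F w {x, y}" if "x \<in> A" "y \<in> A" "?N \<subseteq> {x, y} \<or> 2 \<le> card (?N - {x, y})" for x y
  proof -
    have "card {x, y} < card A" using eA k card_insert_le_m1[of 2 "{y}" x] by simp
    then have "{x, y} \<noteq> A" by auto
    then show ?thesis using nice_flex[OF A, of "{x, y}"] that by blast
  qed
  have cd: "card ?N \<le> card (?N - {x, y}) + 2" for x y
  proof -
    have "card ?N \<le> card ((?N - {x, y}) \<union> {x, y})" using fN by (intro card_mono) auto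
    also have "\<dots> \<le> card (?N - {x, y}) + card {x, y}" by (rule card_Un_le)
    finally show ?thesis using card_insert_le_m1[of 2 "{y}" x] by simp
  qed
  consider "?N = {}" | "card ?N = 2" "5 \<le> k" | "card ?N = 3" "5 \<le> k" | "card ?N = 3" "k = 4" | "4 \<le> card ?N"
    using ne fN card_0_eq[OF fN] k by linarith
  then show False
  proof cases
    case 1
    obtain a b c where "{a, b, c} \<subseteq> A" "a \<noteq> b" "b \<noteq> c" "a \<noteq> c" using three_points[of A] eA k by auto
    then show False using bad[of a b c] fl 1 by simp
  next
    case 2
    have "card (A - ?N) = k - 2" using NA fN eA 2 by (simp add: card_Diff_subset)
    then have "3 \<le> card (A - ?N)" using 2 by simp
    from three_points[OF this]
    obtain a b c where abc: "{a, b, c} \<subseteq> A - ?N" "a \<noteq> b" "b \<noteq> c" "a \<noteq> c" by blast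
    have "?N - {x, y} = ?N" if "x \<in> {a, b, c}" "y \<in> {a, b, c}" for x y using abc(1) that by blast
    then have "flex F w {x, y}" if "x \<in> {a, b, c}" "y \<in> {a, b, c}" for x y
      using fl[of x y] abc(1) that 2(1) by auto
    then show False using bad[of a b c] abc by auto
  next
    case 3
    have "card (A - ?N) = k - 3" using NA fN eA 3 by (simp add: card_Diff_subset)
    then have "2 \<le> card (A - ?N)" using 3 by simp
    from two_points[OF this] obtain a b where ab: "a \<in> A - ?N" "b \<in> A - ?N" "a \<noteq> b" by blast
    obtain c where c: "c \<in> ?N" using 3 by fastforce
    have n: "?N - {a, b} = ?N" "?N - {b, c} = ?N - {c}" "?N - {c, a} = ?N - {c}" using ab by auto
    have c2: "card (?N - {c}) = 2" using c 3 fN by simp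
    have "flex F w {a, b}" "flex F w {b, c}" "flex F w {c, a}"
      using fl[of a b] fl[of b c] fl[of c a] n c2 3(1) ab c NA by auto
    then show False using bad[of a b c] ab c NA by blast
  next
    case 4
    have "card (A - ?N) = 1" using NA fN eA 4 by (simp add: card_Diff_subset)
    then obtain a where a: "A - ?N = {a}" by (auto simp: card_1_singleton_iff)
    obtain p q where pq: "p \<in> ?N" "q \<in> ?N" "p \<noteq> q" using three_points[of ?N] 4 by auto
    have n: "?N - {a, p} = ?N - {p}" "?N - {a, q} = ?N - {q}" using a by auto
    have "flex F w {a, p}" "flex F w {a, q}"
      using fl[of a p] fl[of a q] n pq 4(1) fN a NA by auto
    \<comment> \<open>The pair \<open>{p, q}\<close> omits exactly one blocked vertex, so
      \<open>nice_flex\<close> says nothing about it; the set of all three blocked vertices serves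
      as the third side.\<close>
    moreover have "flex F w ?N" using nice_flex[OF A NA] a by blast
    moreover have "?N \<inter> {a, p} = {p}" "{a, p} \<inter> {a, q} = {a}" "{a, q} \<inter> ?N = {q}" using a pq by auto
    moreover have "p \<noteq> a" using a pq by blast
    ultimately show False using no_flex_triangle[OF tf w, of ?N "{a, p}" "{a, q}" p a q] by blast
  next
    case 5
    obtain a b c where abc: "{a, b, c} \<subseteq> A" "a \<noteq> b" "b \<noteq> c" "a \<noteq> c" using three_points[of A] eA k by auto
    have "2 \<le> card (?N - {x, y})" for x y using cd[of x y] 5 by linarith
    then show False using bad[of a b c] fl abc by simp
  qed
qed

lemma star_flex:
  assumes "A \<in> F" "nice k F w A" "blocked F w A = {c}" "c \<in> S" "S \<subseteq> A" "S \<noteq> A"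
  shows "flex F w S"
  using nice_flex[OF assms(1,2,5,6)] assms(3,4) by simp

end

section \<open>Edges missing the centre\<close>

lemma power_le_binomial:
  assumes "1 \<le> j" "j \<le> h"
  shows "h ^ j \<le> j ^ j * (h choose j)"
proof -
  have "(real h / real j) ^ j \<le> real (h choose j)" using binomial_ge_n_over_k_pow_k[OF assms(2), where 'a = real] .
  then have "real h ^ j \<le> real j ^ j * real (h choose j)" using assms by (simp add: power_divide divide_simps mult.commute)
  then show ?thesis by (metis (mono_tags) of_nat_le_iff of_nat_mult of_nat_power)
qed

text \<open>Quadratic growth already beats the linear number of edges missing the centre. It will be
  applied with exponent \<open>k - 2\<close>, which is where four-element edges become
  necessary.\<close>

lemma sq_le_binomial:
  assumes "2 \<le> j" "j \<le> h"
  shows "h ^ 2 \<le> j ^ 2 * (h choose j)"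
proof -
  have j: "j ^ j = j ^ (j - 2) * j ^ 2" "h ^ j = h ^ (j - 2) * h ^ 2" using assms(1) power_add[of j "j - 2" 2] power_add[of h "j - 2" 2] by (simp_all only: le_add_diff_inverse2)
  have "j ^ (j - 2) * h ^ 2 \<le> h ^ (j - 2) * h ^ 2" using assms by (intro mult_le_mono1 power_mono) auto
  also have "\<dots> \<le> j ^ (j - 2) * (j ^ 2 * (h choose j))"
    using power_le_binomial[of j h] assms unfolding j by (simp add: mult.assoc)
  finally show ?thesis using assms(1) by simp
qed

context uniform_hypergraph
begin

text \<open>Such an edge is a subset of the bounded set \<open>X\<close> with at most one vertex
  added.\<close>

lemma card_avoiding_le:
  assumes X: "finite X" and C: "\<And>C. C \<in> F \<Longrightarrow> c \<notin> C \<Longrightarrow> card (C - X) \<le> 1"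
  shows "card {C \<in> F. c \<notin> C} \<le> 2 ^ card X * (card V + 1)"
proof -
  let ?T = "insert {} ((\<lambda>v. {v}) ` V)"
  have "{C \<in> F. c \<notin> C} \<subseteq> (\<lambda>(S, T). S \<union> T) ` (Pow X \<times> ?T)"
  proof
    fix C' assume C': "C' \<in> {C \<in> F. c \<notin> C}"
    note e = edgeD[of C']
    have "finite (C' - X)" using e C' by simp
    moreover have "card (C' - X) \<le> 1" using C[of C'] C' by simp
    then have "card (C' - X) = 0 \<or> card (C' - X) = 1" by linarith
    ultimately have "C' - X = {} \<or> (\<exists>v. C' - X = {v})" by (auto simp: card_1_singleton_iff)
    then have "C' - X \<in> ?T" using e C' by auto
    moreover have "C' = (C' \<inter> X) \<union> (C' - X)" by blast
    ultimately show "C' \<in> (\<lambda>(S, T). S \<union> T) ` (Pow X \<times> ?T)" by (intro image_eqI[of _ _ "(C' \<inter> X, C' - X)"]) auto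
  qed
  then have "card {C \<in> F. c \<notin> C} \<le> card (Pow X \<times> ?T)"
    using X finite_V by (intro surj_card_le) auto
  also have "\<dots> \<le> 2 ^ card X * (card V + 1)"
    unfolding card_cartesian_product card_Pow[OF X]
    using card_image_le[OF finite_V, of "\<lambda>v. {v}"] finite_V by (intro mult_le_mono2) (auto simp: card_insert_if)
  finally show ?thesis .
qed

lemma card_star_balance:
  assumes "c \<in> V"
  shows "card F + card {A \<in> nsets V k. c \<in> A \<and> A \<notin> F} = (card V - 1 choose (k - 1)) + card {C \<in> F. c \<notin> C}"
    and "card {A \<in> F. c \<in> A} + card {A \<in> nsets V k. c \<in> A \<and> A \<notin> F} = (card V - 1 choose (k - 1))"
proof -
  have fin: "finite (nsets V k)" using finite_V by (rule finite_imp_finite_nsets)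
  have "card {A \<in> nsets V k. c \<in> A} = card ({A \<in> F. c \<in> A} \<union> {A \<in> nsets V k. c \<in> A \<and> A \<notin> F})"
    by (rule arg_cong[where f = card]) (use F_sub in blast)
  also have "\<dots> = card {A \<in> F. c \<in> A} + card {A \<in> nsets V k. c \<in> A \<and> A \<notin> F}"
    using fin finite_F by (intro card_Un_disjoint) auto
  finally show 2: "card {A \<in> F. c \<in> A} + card {A \<in> nsets V k. c \<in> A \<and> A \<notin> F} = (card V - 1 choose (k - 1))"
    using card_nsets_containing[OF finite_V assms, of k] k_ge by simp
  have "card F = card ({A \<in> F. c \<in> A} \<union> {C \<in> F. c \<notin> C})" by (rule arg_cong[where f = card]) blast
  also have "\<dots> = card {A \<in> F. c \<in> A} + card {C \<in> F. c \<notin> C}" using finite_F by (intro card_Un_disjoint) auto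
  finally show "card F + card {A \<in> nsets V k. c \<in> A \<and> A \<notin> F} = (card V - 1 choose (k - 1)) + card {C \<in> F. c \<notin> C}"
    using 2 by simp
qed

lemma all_missing:
  assumes "c \<in> V" "a \<in> V" "a \<noteq> c" and H: "H \<subseteq> V - {a, c}"
    and "\<And>P. P \<in> nsets H (k - 2) \<Longrightarrow> insert c (insert a P) \<notin> F"
  shows "(card H choose (k - 2)) \<le> card {A \<in> nsets V k. c \<in> A \<and> A \<notin> F}"
proof -
  have fH: "finite H" using H finite_V finite_subset by blast
  have "card (nsets H (k - 2)) \<le> card {A \<in> nsets V k. c \<in> A \<and> A \<notin> F}"
  proof (rule card_inj_on_le)
    show "inj_on (\<lambda>P. insert c (insert a P)) (nsets H (k - 2))"
    proof (rule inj_onI)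
      fix P Q assume PQ: "P \<in> nsets H (k - 2)" "Q \<in> nsets H (k - 2)" "insert c (insert a P) = insert c (insert a Q)"
      then have "P = insert c (insert a P) - {a, c}" "Q = insert c (insert a Q) - {a, c}"
        using H by (auto simp: nsets_def)
      then show "P = Q" using PQ(3) by simp
    qed
    show "(\<lambda>P. insert c (insert a P)) ` nsets H (k - 2) \<subseteq> {A \<in> nsets V k. c \<in> A \<and> A \<notin> F}"
    proof
      fix A assume "A \<in> (\<lambda>P. insert c (insert a P)) ` nsets H (k - 2)"
      then obtain P where P: "P \<in> nsets H (k - 2)" "A = insert c (insert a P)" by blast
      then have "finite P" "card P = k - 2" "a \<notin> P" "c \<notin> P" "P \<subseteq> V" using H by (auto simp: nsets_def)
      then have "A \<in> nsets V k" using P(2) assms(1-3) k_ge by (auto simp: nsets_def)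
      then show "A \<in> {A \<in> nsets V k. c \<in> A \<and> A \<notin> F}" using P assms(5) by blast
    qed
    show "finite {A \<in> nsets V k. c \<in> A \<and> A \<notin> F}"
      by (rule finite_subset[OF _ finite_imp_finite_nsets[OF finite_V, of k]]) blast
  qed
  then show ?thesis using fH by (simp add: card_nsets)
qed

text \<open>A single edge missing the centre forbids about \<open>n ^ (k - 2)\<close> edges through the centre, while
  there are only linearly many edges missing the centre.\<close>

lemma card_le_of_dominant_center:
  assumes c: "c \<in> V" and X: "finite X" "card X \<le> q"
    and one: "\<And>C. C \<in> F \<Longrightarrow> c \<notin> C \<Longrightarrow> card (C - X) \<le> 1"
    and avoid: "\<And>C. C \<in> F \<Longrightarrow> c \<notin> C \<Longrightarrow> \<exists>a b. a \<in> V \<and> b \<in> V \<and> a \<noteq> b \<and> a \<noteq> c \<and> b \<noteq> c \<and>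
      (\<forall>P1 P2. P1 \<subseteq> V - C - {a, b, c} \<longrightarrow> P2 \<subseteq> V - C - {a, b, c} \<longrightarrow> P1 \<inter> P2 = {} \<longrightarrow>
        \<not> (insert c (insert a P1) \<in> F \<and> insert c (insert b P2) \<in> F))"
    and k4: "4 \<le> k" and large: "4 * k \<le> card V" "32 * k ^ 2 * 2 ^ q \<le> card V"
  shows "card F \<le> (card V - 1 choose (k - 1))"
proof (cases "{C \<in> F. c \<notin> C} = {}")
  case True
  have "card {C \<in> F. c \<notin> C} = 0" unfolding True by simp
  then show ?thesis using card_star_balance(1)[OF c] by linarith
next
  case False
  define n where "n = card V"
  obtain C where C: "C \<in> F" "c \<notin> C" using False by blast
  note eC = edgeD[OF C(1)]
  obtain a b where ab: "a \<in> V" "b \<in> V" "a \<noteq> b" "a \<noteq> c" "b \<noteq> c"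
    "\<forall>P1 P2. P1 \<subseteq> V - C - {a, b, c} \<longrightarrow> P2 \<subseteq> V - C - {a, b, c} \<longrightarrow> P1 \<inter> P2 = {} \<longrightarrow>
        \<not> (insert c (insert a P1) \<in> F \<and> insert c (insert b P2) \<in> F)"
    using avoid[OF C] by metis
  define U where "U = V - C - {a, b, c}"
  define h where "h = (n - k - 3) div 2"
  have nk: "4 * k \<le> n" "4 \<le> k" using large(1) k4 by (auto simp: n_def)
  have "n - k - 3 \<le> card U"
  proof -
    have "card V - card (C \<union> {a, b, c}) \<le> card (V - (C \<union> {a, b, c}))"
      using diff_card_le_card_Diff[of "C \<union> {a, b, c}" V] eC by simp
    moreover have "V - (C \<union> {a, b, c}) = U" unfolding U_def by blast
    moreover have "card (C \<union> {a, b, c}) \<le> k + 3"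
    proof -
      have "card {a, b, c} \<le> 3" by (simp add: card_insert_if)
      then show ?thesis using card_Un_le[of C "{a, b, c}"] eC by linarith
    qed
    ultimately show ?thesis unfolding n_def by simp
  qed
  then have hU: "h + h \<le> card U" by (simp add: h_def)
  then obtain H1 where H1: "H1 \<subseteq> U" "card H1 = h" "finite H1" using obtain_subset_with_card_n[of h U] by auto
  have "h \<le> card (U - H1)" using hU H1 by (simp add: card_Diff_subset)
  then obtain H2 where H2: "H2 \<subseteq> U - H1" "card H2 = h" "finite H2" using obtain_subset_with_card_n[of h "U - H1"] by auto
  \<comment> \<open>\<open>H1\<close> and \<open>H2\<close> are disjoint reservoirs outside
    \<open>C\<close>. If some set from \<open>H1\<close> extends \<open>{c, a}\<close> to an edge,
    no set from \<open>H2\<close> extends \<open>{c, b}\<close>; otherwise no set from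
    \<open>H1\<close> extends \<open>{c, a}\<close>. Either way \<open>h choose (k - 2)\<close>
    edges through \<open>c\<close> are absent.\<close>
  have "(h choose (k - 2)) \<le> card {A \<in> nsets V k. c \<in> A \<and> A \<notin> F}"
  proof (cases "\<exists>P\<in>nsets H1 (k - 2). insert c (insert a P) \<in> F")
    case True
    then obtain P1 where P1: "P1 \<subseteq> H1" "insert c (insert a P1) \<in> F" by (auto simp: nsets_def)
    have "insert c (insert b P) \<notin> F" if "P \<in> nsets H2 (k - 2)" for P
    proof -
      have "P \<subseteq> H2" using that by (simp add: nsets_def)
      then have "P1 \<subseteq> V - C - {a, b, c}" "P \<subseteq> V - C - {a, b, c}" "P1 \<inter> P = {}"
        using P1(1) H1(1) H2(1) unfolding U_def by blast+
      then show ?thesis using ab(6) P1(2) by blast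
    qed
    moreover have "H2 \<subseteq> V - {b, c}" using H2(1) unfolding U_def by blast
    ultimately show ?thesis using all_missing[of c b H2] c ab H2 by simp
  next
    case False
    moreover have "H1 \<subseteq> V - {a, c}" using H1(1) unfolding U_def by blast
    ultimately show ?thesis using all_missing[of c a H1] c ab H1 by auto
  qed
  moreover have "2 ^ q * (n + 1) \<le> (h choose (k - 2))"
  proof -
    define Z where "Z = (h choose (k - 2))"
    have h: "n \<le> 4 * h" "k - 2 \<le> h" using nk unfolding h_def by linarith+
    have "n ^ 2 \<le> (4 * h) ^ 2" using h(1) by (intro power_mono) auto
    also have "\<dots> = 16 * h ^ 2" by (simp add: power_mult_distrib)
    also have "\<dots> \<le> 16 * ((k - 2) ^ 2 * Z)" unfolding Z_def using sq_le_binomial[of "k - 2" h] h nk by simp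
    also have "\<dots> \<le> 16 * (k ^ 2 * Z)" by (intro mult_le_mono2 mult_le_mono1 power_mono) auto
    finally have 1: "n * n \<le> 16 * (k ^ 2 * Z)" by (simp add: power2_eq_square)
    have "(16 * k ^ 2) * (2 ^ q * (n + 1)) \<le> (16 * k ^ 2) * (2 ^ q * (2 * n))"
      using nk by (intro mult_le_mono2) simp
    also have "\<dots> = (32 * k ^ 2 * 2 ^ q) * n" by simp
    also have "\<dots> \<le> n * n" using large(2) unfolding n_def by (rule mult_le_mono1)
    finally have "(16 * k ^ 2) * (2 ^ q * (n + 1)) \<le> (16 * k ^ 2) * Z" using 1 by (simp only: mult.assoc; linarith)
    moreover have "0 < 16 * k ^ 2" using nk by simp
    ultimately show ?thesis unfolding Z_def by (metis nat_mult_le_cancel1)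
  qed
  moreover have "card {C \<in> F. c \<notin> C} \<le> 2 ^ q * (n + 1)"
  proof -
    have "2 ^ card X * (card V + 1) \<le> 2 ^ q * (card V + 1)" using X(2) by (intro mult_le_mono1 power_increasing) auto
    moreover have "card {C \<in> F. c \<notin> C} \<le> 2 ^ card X * (card V + 1)" using card_avoiding_le[OF X(1), of c] one by blast
    ultimately show ?thesis unfolding n_def by linarith
  qed
  ultimately show ?thesis using card_star_balance(1)[OF c] by linarith
qed

section \<open>Edges with a centre and the resulting edge bounds\<close>

definition star_edges :: "nat \<Rightarrow> 'a set set" where
  "star_edges w = {A \<in> F. nice k F w A \<and> card (blocked F w A) = 1}"

definition center :: "nat \<Rightarrow> 'a set \<Rightarrow> 'a" where
  "center w A = the_elem (blocked F w A)"

lemma star_edges: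
  assumes "A \<in> star_edges w"
  shows "A \<in> F" "nice k F w A" "blocked F w A = {center w A}" "center w A \<in> A"
    "\<And>S. center w A \<in> S \<Longrightarrow> S \<subseteq> A \<Longrightarrow> S \<noteq> A \<Longrightarrow> flex F w S"
proof -
  show A: "A \<in> F" "nice k F w A" using assms by (simp_all add: star_edges_def)
  have "card (blocked F w A) = 1" using assms by (simp add: star_edges_def)
  then obtain x where "blocked F w A = {x}" by (auto simp: card_1_singleton_iff)
  then show b: "blocked F w A = {center w A}" by (simp add: center_def)
  show "center w A \<in> A" using b by (auto simp: blocked_def)
  show "flex F w S" if "center w A \<in> S" "S \<subseteq> A" "S \<noteq> A" for S using star_flex[OF A b that] .
qed

lemma star_edges_flex_pair:
  assumes "A \<in> star_edges w" "3 \<le> k" "a \<in> A"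
  shows "flex F w {center w A, a}"
proof -
  note se = star_edges[OF assms(1)]
  have "card {center w A, a} \<le> 2" by (simp add: card_insert_if)
  then have "{center w A, a} \<noteq> A" using edgeD[OF se(1)] assms(2) by auto
  then show ?thesis using se(4,5) assms(3) by blast
qed

lemma edge_eq_of_superset: "A \<in> F \<Longrightarrow> E \<in> F \<Longrightarrow> A - {c} \<subseteq> E \<Longrightarrow> c \<in> E \<Longrightarrow> E = A"
proof -
  assume A: "A \<in> F" "E \<in> F" "A - {c} \<subseteq> E" "c \<in> E"
  then have "A \<subseteq> E" by blast
  then show "E = A" using edgeD[OF A(1)] edgeD[OF A(2)] card_subset_eq[of E A] by simp
qed

lemma two_points_minus:
  assumes "A \<in> F" "3 \<le> k" "c \<in> A"
  obtains a b where "a \<in> A - {c}" "b \<in> A - {c}" "a \<noteq> b"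
proof -
  have "2 \<le> card (A - {c})" using edgeD[OF assms(1)] assms by simp
  then show ?thesis using that two_points by blast
qed

text \<open>An edge over the facet opposite the centre that misses the centre contains two vertices
  forming flexible pairs with it, and so closes a triangle.\<close>

lemma star_edges_own_triangle:
  assumes "linear_triangle_free F" "2 * k \<le> w" "3 \<le> k" "A \<in> star_edges w" "E \<in> F" "A - {center w A} \<subseteq> E"
  shows "E = A"
proof (cases "center w A \<in> E")
  case False
  note se = star_edges[OF assms(4)]
  obtain a b where "a \<in> A - {center w A}" "b \<in> A - {center w A}" "a \<noteq> b" using two_points_minus[OF se(1) assms(3) se(4)] .
  then show ?thesis
    using triangle_edge_of_flex_center[OF assms(1,2) star_edges_flex_pair[OF assms(4,3)] star_edges_flex_pair[OF assms(4,3)], of a b E]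
      assms False by blast
qed (use edge_eq_of_superset[OF star_edges(1)[OF assms(4)] assms(5,6)] in simp)

lemma star_edges_own_path:
  assumes "linear_path_free F" "2 * k \<le> w" "3 \<le> k" "A \<in> star_edges w" "E \<in> F" "A - {center w A} \<subseteq> E"
  shows "E = A"
proof (cases "center w A \<in> E")
  case False
  note se = star_edges[OF assms(4)]
  obtain a b where a: "a \<in> A - {center w A}" "b \<in> A - {center w A}" "a \<noteq> b" using two_points_minus[OF se(1) assms(3) se(4)] .
  have "{center w A} \<noteq> A"
  proof
    assume "{center w A} = A"
    from arg_cong[where f = card, OF this] show False using edgeD(3)[OF se(1)] assms(3) by simp
  qed
  then have "flex F w {center w A}" using se(4) se(5)[of "{center w A}"] by simp
  then show ?thesis
    using path_edge_of_flex_center[OF assms(1,2) _ star_edges_flex_pair[OF assms(4,3)], of a E] a assms False by blast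
qed (use edge_eq_of_superset[OF star_edges(1)[OF assms(4)] assms(5,6)] in simp)

lemma path_free_card_le:
  assumes pf: "linear_path_free F" and k4: "4 \<le> k"
    and co: "(card V - 1 choose (k - 1)) * (1 + (card V - k + 1) * (k - 1)) \<le> (\<Sum>Y\<in>nsets V (k - 1). (degree F Y)\<^sup>2)"
    and K: "K = (2 ^ k * (2 * k))\<^sup>2" and q: "q = 2 * k ^ k * (2 * K + 1)"
    and large: "4 * k \<le> card V" "2 * k ^ k * K \<le> card V" "32 * k ^ 2 * 2 ^ q \<le> card V"
  shows "card F \<le> (card V - 1 choose (k - 1))"
proof -
  define w where "w = 2 * k"
  let ?S = "star_edges w"
  have w: "2 * k \<le> w" and k3: "3 \<le> k" using k4 by (auto simp: w_def)
  have "F - ?S \<subseteq> {A \<in> F. \<not> nice k F w A}"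
    using blocked_path[OF pf w _ _ k4] by (auto simp: star_edges_def)
  then have "card (F - ?S) \<le> card {A \<in> F. \<not> nice k F w A}" using finite_F by (intro card_mono) auto
  then have few: "card (F - ?S) \<le> K * card V ^ (k - 2)" using card_not_nice[of w] unfolding K w_def by linarith
  have "?S \<subseteq> F" using star_edges(1) by blast
  have "\<exists>A\<in>?S. card {v \<in> V - {center w A}. \<not> flex F w {center w A, v}} \<le> q"
  proof (rule dominant_center[of ?S "center w" "\<lambda>c v. flex F w {c, v}" K])
    show "?S \<subseteq> F" "card (F - ?S) \<le> K * card V ^ (k - 2)" by fact (use few in \<open>simp add: w_def\<close>)
    show "center w A \<in> A" if "A \<in> ?S" for A using star_edges(4)[OF that] .
    show "E = A" if "A \<in> ?S" "E \<in> F" "A - {center w A} \<subseteq> E" for A E using star_edges_own_path[OF pf w k3 that] .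
    show "flex F w {center w A, a}" if "A \<in> ?S" "a \<in> A - {center w A}" for A a
      using star_edges_flex_pair[OF that(1) k3] that(2) by simp
    show "2 * k \<le> card V" using large(1) by simp
    fix A assume "A \<in> ?S" "card {v \<in> V - {center w A}. \<not> flex F w {center w A, v}} \<le> 2 * k ^ k * (2 * K + 1)"
    then show "\<exists>A\<in>?S. card {v \<in> V - {center w A}. \<not> flex F w {center w A, v}} \<le> q" unfolding q by blast
  qed (rule co k3 large)+
  then obtain A where A: "A \<in> ?S" "card {v \<in> V - {center w A}. \<not> flex F w {center w A, v}} \<le> q" by blast
  note se = star_edges[OF A(1)]
  define c where "c = center w A"
  define X where "X = {v \<in> V - {c}. \<not> flex F w {c, v}}"
  have "{c} \<noteq> A"
  proof
    assume "{c} = A"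
    from this[symmetric] show False using edgeD(3)[OF se(1)] k4 by simp
  qed
  then have fc: "flex F w {c}" using se(4) se(5)[of "{c}"] by (simp add: c_def)
  have out: "flex F w {c, a} \<Longrightarrow> a \<notin> C" if "C \<in> F" "c \<notin> C" for a C
    using path_edge_of_flex_center[OF pf w fc _ that] .
  show ?thesis
  proof (rule card_le_of_dominant_center[OF _ _ _ _ _ k4 large(1,3)])
    show cV: "c \<in> V" using se(1,4) edgeD c_def by blast
    show "finite X" "card X \<le> q" using A(2) finite_V by (auto simp: X_def c_def)
    show "card (C - X) \<le> 1" if C: "C \<in> F" "c \<notin> C" for C
    proof -
      \<comment> \<open>For paths a single flexible pair \<open>{c, a}\<close> with \<open>a\<close>
        in \<open>C\<close> is already impossible, so edges missing the centre lie in
        \<open>X\<close>.\<close>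
      have "C - X = {}" using out[OF C] edgeD(1)[OF C(1)] C(2) unfolding X_def by blast
      then show ?thesis by (simp only: card.empty)
    qed
    show "\<exists>a b. a \<in> V \<and> b \<in> V \<and> a \<noteq> b \<and> a \<noteq> c \<and> b \<noteq> c \<and>
      (\<forall>P1 P2. P1 \<subseteq> V - C - {a, b, c} \<longrightarrow> P2 \<subseteq> V - C - {a, b, c} \<longrightarrow> P1 \<inter> P2 = {} \<longrightarrow>
        \<not> (insert c (insert a P1) \<in> F \<and> insert c (insert b P2) \<in> F))" if C: "C \<in> F" "c \<notin> C" for C
    proof -
      note eC = edgeD[OF C(1)]
      have "C \<noteq> {}" using eC k4 by auto
      \<comment> \<open>With \<open>a\<close> on \<open>C\<close> and \<open>b\<close> off
        \<open>C\<close>, the edge \<open>C\<close>, an edge over \<open>{c, a}\<close> and an edge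
        over \<open>{c, b}\<close> would form a linear path. For triangles both vertices are taken
        on \<open>C\<close>.\<close>
      then obtain a where a: "a \<in> C" by blast
      have "card (insert c C) < card V" using eC C(2) large(1) k4 by simp
      then have "\<not> V \<subseteq> insert c C" using card_mono[of "insert c C" V] eC by auto
      then obtain b where b: "b \<in> V" "b \<noteq> c" "b \<notin> C" by blast
      have "\<not> (insert c (insert a P1) \<in> F \<and> insert c (insert b P2) \<in> F)"
        if P: "P1 \<subseteq> V - C - {a, b, c}" "P2 \<subseteq> V - C - {a, b, c}" "P1 \<inter> P2 = {}" for P1 P2
      proof
        assume E: "insert c (insert a P1) \<in> F \<and> insert c (insert b P2) \<in> F"
        define E1 where "E1 = insert c (insert a P1)"
        define E2 where "E2 = insert c (insert b P2)"
        have "C \<inter> E1 = {a}" "E1 \<inter> E2 = {c}" "C \<inter> E2 = {}" unfolding E1_def E2_def using P a b C(2) by auto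
        then show False using linear_path_freeD[OF pf C(1), of E1 E2] E by (simp add: E1_def[symmetric] E2_def[symmetric])
      qed
      moreover have "a \<in> V" "a \<noteq> b" "a \<noteq> c" using a b eC C(2) by auto
      ultimately show ?thesis using b by blast
    qed
  qed
qed

lemma triangle_free_dominated_card_le:
  assumes tf: "linear_triangle_free F" and k4: "4 \<le> k"
    and co: "(card V - 1 choose (k - 1)) * (1 + (card V - k + 1) * (k - 1)) \<le> (\<Sum>Y\<in>nsets V (k - 1). (degree F Y)\<^sup>2)"
    and few: "card (F - star_edges (2 * k)) \<le> K * card V ^ (k - 2)" and q: "q = 2 * k ^ k * (2 * K + 1)"
    and large: "4 * k \<le> card V" "2 * k ^ k * K \<le> card V" "32 * k ^ 2 * 2 ^ q \<le> card V"
  shows "card F \<le> (card V - 1 choose (k - 1))"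
proof -
  define w where "w = 2 * k"
  let ?S = "star_edges w"
  have w: "2 * k \<le> w" and k3: "3 \<le> k" using k4 by (auto simp: w_def)
  have "?S \<subseteq> F" using star_edges(1) by blast
  have "\<exists>A\<in>?S. card {v \<in> V - {center w A}. \<not> flex F w {center w A, v}} \<le> q"
  proof (rule dominant_center[of ?S "center w" "\<lambda>c v. flex F w {c, v}" K])
    show "?S \<subseteq> F" "card (F - ?S) \<le> K * card V ^ (k - 2)" by fact (use few in \<open>simp add: w_def\<close>)
    show "center w A \<in> A" if "A \<in> ?S" for A using star_edges(4)[OF that] .
    show "E = A" if "A \<in> ?S" "E \<in> F" "A - {center w A} \<subseteq> E" for A E using star_edges_own_triangle[OF tf w k3 that] .
    show "flex F w {center w A, a}" if "A \<in> ?S" "a \<in> A - {center w A}" for A a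
      using star_edges_flex_pair[OF that(1) k3] that(2) by simp
    show "2 * k \<le> card V" using large(1) by simp
    fix A assume "A \<in> ?S" "card {v \<in> V - {center w A}. \<not> flex F w {center w A, v}} \<le> 2 * k ^ k * (2 * K + 1)"
    then show "\<exists>A\<in>?S. card {v \<in> V - {center w A}. \<not> flex F w {center w A, v}} \<le> q" unfolding q by blast
  qed (rule co k3 large)+
  then obtain A where A: "A \<in> ?S" "card {v \<in> V - {center w A}. \<not> flex F w {center w A, v}} \<le> q" by blast
  note se = star_edges[OF A(1)]
  define c where "c = center w A"
  define X where "X = {v \<in> V - {c}. \<not> flex F w {c, v}}"
  have out: "flex F w {c, a} \<Longrightarrow> flex F w {c, b} \<Longrightarrow> a \<noteq> b \<Longrightarrow> a \<in> C \<Longrightarrow> b \<notin> C" if "C \<in> F" "c \<notin> C" for a b C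
    using triangle_edge_of_flex_center[OF tf w _ _ _ that] .
  show ?thesis
  proof (rule card_le_of_dominant_center[OF _ _ _ _ _ k4 large(1,3)])
    show cV: "c \<in> V" using se(1,4) edgeD c_def by blast
    show "finite X" "card X \<le> q" using A(2) finite_V by (auto simp: X_def c_def)
    show "card (C - X) \<le> 1" if C: "C \<in> F" "c \<notin> C" for C
    proof (rule ccontr)
      assume "\<not> card (C - X) \<le> 1"
      then have "2 \<le> card (C - X)" by simp
      from two_points[OF this] obtain a b where ab: "a \<in> C - X" "b \<in> C - X" "a \<noteq> b" by blast
      then have "flex F w {c, a}" "flex F w {c, b}" using edgeD(1)[OF C(1)] C(2) unfolding X_def by blast+
      then show False using out[OF C] ab by blast
    qed
    show "\<exists>a b. a \<in> V \<and> b \<in> V \<and> a \<noteq> b \<and> a \<noteq> c \<and> b \<noteq> c \<and>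
      (\<forall>P1 P2. P1 \<subseteq> V - C - {a, b, c} \<longrightarrow> P2 \<subseteq> V - C - {a, b, c} \<longrightarrow> P1 \<inter> P2 = {} \<longrightarrow>
        \<not> (insert c (insert a P1) \<in> F \<and> insert c (insert b P2) \<in> F))" if C: "C \<in> F" "c \<notin> C" for C
    proof -
      note eC = edgeD[OF C(1)]
      have "2 \<le> card C" using eC k4 by simp
      from two_points[OF this] obtain a b where ab: "a \<in> C" "b \<in> C" "a \<noteq> b" by blast
      have "\<not> (insert c (insert a P1) \<in> F \<and> insert c (insert b P2) \<in> F)"
        if P: "P1 \<subseteq> V - C - {a, b, c}" "P2 \<subseteq> V - C - {a, b, c}" "P1 \<inter> P2 = {}" for P1 P2
      proof
        assume E: "insert c (insert a P1) \<in> F \<and> insert c (insert b P2) \<in> F"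
        define E1 where "E1 = insert c (insert a P1)"
        define E2 where "E2 = insert c (insert b P2)"
        have i: "C \<inter> E1 = {a}" "E1 \<inter> E2 = {c}" "E2 \<inter> C = {b}" unfolding E1_def E2_def using P ab C(2) by auto
        have "C \<inter> E1 \<inter> E2 = {}" unfolding i(1) E2_def using ab C(2) P by auto
        then show False using linear_triangle_freeD[OF tf C(1), of E1 E2] E i by (simp add: E1_def[symmetric] E2_def[symmetric])
      qed
      moreover have "a \<in> V" "b \<in> V" "a \<noteq> c" "b \<noteq> c" using ab eC C(2) by auto
      ultimately show ?thesis using ab(3) by blast
    qed
  qed
qed

end

section \<open>Linear cycles\<close>

context uniform_hypergraph
begin

text \<open>An edge with two blocked vertices has no centre, but a facet opposite a blocked vertex
  still belongs to no other nice edge. For a second nice edge \<open>C = {q, a, b, v}\<close> every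
  position of its blocked vertices yields flexible sets that form a triangle with those of
  \<open>A\<close>.\<close>

lemma type2_unique:
  assumes tf: "linear_triangle_free F" and w: "2 * k \<le> w" and k: "k = 4"
    and A: "A \<in> F" "nice k F w A" "card (blocked F w A) = 2" and p: "p \<in> blocked F w A"
    and C: "C \<in> F" "nice k F w C" "A - {p} \<subseteq> C"
  shows "C = A"
proof (rule ccontr)
  assume ne: "C \<noteq> A"
  note eA = edgeD[OF A(1)] and eC = edgeD[OF C(1)]
  have NA: "blocked F w A \<subseteq> A" and NC: "blocked F w C \<subseteq> C" by (auto simp: blocked_def)
  obtain u u' where u: "blocked F w A = {u, u'}" "u \<noteq> u'" using A(3) by (meson card_2_iff)
  have "\<exists>q. blocked F w A = {p, q} \<and> q \<noteq> p"
  proof (cases "p = u")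
    case True
    then show ?thesis using u by blast
  next
    case False
    then have "p = u'" using p u by blast
    then show ?thesis using u by blast
  qed
  then obtain q where q: "blocked F w A = {p, q}" "q \<noteq> p" by blast
  have pqA: "p \<in> A" "q \<in> A" using q NA by auto
  have "card (A - {p, q}) = 2" using eA pqA q(2) k by (simp add: card_Diff_subset)
  then obtain a b where ab: "A - {p, q} = {a, b}" "a \<noteq> b" by (meson card_2_iff)
  then have dA: "a \<in> A" "b \<in> A" "a \<noteq> p" "a \<noteq> q" "b \<noteq> p" "b \<noteq> q" by blast+
  have Aeq: "A = {p, q, a, b}" using ab(1) pqA by blast
  have "{q, a, b} \<subseteq> C" using C(3) dA pqA q(2) by blast
  moreover from this have "card (C - {q, a, b}) = 1" using eC k dA ab(2) by (simp add: card_Diff_subset)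
  then obtain v where v: "C - {q, a, b} = {v}" by (auto simp: card_1_singleton_iff)
  ultimately have Ceq: "C = {q, a, b, v}" by blast
  have vd: "v \<noteq> q" "v \<noteq> a" "v \<noteq> b" using v by blast+
  have "v \<noteq> p" using Ceq Aeq ne by blast
  note d = q(2) ab(2) dA(3-6) vd \<open>v \<noteq> p\<close>
  note d' = d d[symmetric]
  have fA: "flex F w S" if "S \<subseteq> A" "S \<noteq> A" "{p, q} \<subseteq> S \<or> {p, q} \<inter> S = {}" for S
  proof -
    have "{p, q} \<inter> S = {} \<Longrightarrow> card ({p, q} - S) = 2" using q(2) by (simp add: Diff_triv)
    then show ?thesis using nice_flex[OF A(1,2) that(1,2)] q(1) that(3) by auto
  qed
  have f1: "flex F w {a, b}" and f2: "flex F w {p, q}" and f3: "flex F w {p, q, a}" and f4: "flex F w {p, q, b}"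
    by (rule fA; use Aeq d' in auto)+
  note nt = no_flex_triangle[OF tf w]
  have qa: "\<not> flex F w {q, a}"
  proof
    assume f: "flex F w {q, a}"
    show False by (rule nt[OF f f1 f4, of a b q]) (use d' in auto)
  qed
  have qb: "\<not> flex F w {q, b}"
  proof
    assume f: "flex F w {q, b}"
    show False by (rule nt[OF f f1 f3, of b a q]) (use d' in auto)
  qed
  have vq: "\<not> (flex F w {v, q} \<and> flex F w {v, a})"
  proof
    assume f: "flex F w {v, q} \<and> flex F w {v, a}"
    show False by (rule nt[OF conjunct1[OF f] conjunct2[OF f] f3, of v a q]) (use d' in auto)
  qed
  have qva: "\<not> flex F w {q, v, a}"
  proof
    assume f: "flex F w {q, v, a}"
    show False by (rule nt[OF f f4 f1, of q b a]) (use d' in auto)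
  qed
  have abv: "\<not> (flex F w {a, b, v} \<and> flex F w {q, v})"
  proof
    assume f: "flex F w {a, b, v} \<and> flex F w {q, v}"
    show False by (rule nt[OF f4 conjunct1[OF f] conjunct2[OF f], of b v q]) (use d' in auto)
  qed
  have "card (blocked F w C) = 1 \<or> card (blocked F w C) = 2"
    using blocked_triangle[OF tf w C(1,2)] k by simp
  then show False
  proof
    assume "card (blocked F w C) = 1"
    then obtain z where z: "blocked F w C = {z}" by (auto simp: card_1_singleton_iff)
    then have "z \<in> {q, a, b, v}" using NC Ceq by simp
    have fC: "flex F w S" if "z \<in> S" "S \<subseteq> C" "S \<noteq> C" for S using star_flex[OF C(1,2) z that] .
    have C4: "S \<noteq> C" if "card S \<le> 2" for S using that eC(3) k by auto
    have c2: "card {s, t} \<le> 2" for s t :: 'a by (simp add: card_insert_if)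
    have sub: "{q, a} \<subseteq> C" "{q, b} \<subseteq> C" "{v, q} \<subseteq> C" "{v, a} \<subseteq> C" unfolding Ceq by blast+
    have "z = q \<Longrightarrow> flex F w {q, a}" "z = a \<Longrightarrow> flex F w {q, a}"
      by (rule fC[OF _ sub(1) C4[OF c2]], simp)+
    moreover have "z = b \<Longrightarrow> flex F w {q, b}" by (rule fC[OF _ sub(2) C4[OF c2]], simp)
    moreover have "z = v \<Longrightarrow> flex F w {v, q}" by (rule fC[OF _ sub(3) C4[OF c2]], simp)
    moreover have "z = v \<Longrightarrow> flex F w {v, a}" by (rule fC[OF _ sub(4) C4[OF c2]], simp)
    ultimately show False using qa qb vq \<open>z \<in> {q, a, b, v}\<close> by blast
  next
    assume N2: "card (blocked F w C) = 2"
    define N where "N = blocked F w C"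
    have fC: "flex F w S" if "S \<subseteq> C" "S \<noteq> C" "N \<subseteq> S \<or> N \<inter> S = {}" for S
    proof -
      have "N \<inter> S = {} \<Longrightarrow> card (N - S) = 2" using N2 by (simp add: Diff_triv N_def)
      then show ?thesis using nice_flex[OF C(1,2) that(1,2)] that(3) unfolding N_def by auto
    qed
    obtain s t where st: "N = {s, t}" "s \<noteq> t" using N2 unfolding N_def by (meson card_2_iff)
    then have "s \<in> {q, a, b, v}" "t \<in> {q, a, b, v}" using NC Ceq unfolding N_def by auto
    then have "s = q \<or> s = a \<or> s = b \<or> s = v" "t = q \<or> t = a \<or> t = b \<or> t = v" by simp_all
    then have "N = {q, a} \<or> N = {b, v} \<or> N = {q, b} \<or> N = {a, v} \<or> N = {q, v} \<or> N = {a, b}"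
      using st by (elim disjE) (simp_all add: insert_commute)
    moreover have C4: "S \<noteq> C" if "card S \<le> 3" for S using that eC(3) k by auto
    have c2: "card {s, t} \<le> 3" and c3: "card {s, t, u} \<le> 3" for s t u :: 'a by (simp_all add: card_insert_if)
    have sub: "{q, a} \<subseteq> C" "{q, b} \<subseteq> C" "{q, v, a} \<subseteq> C" "{a, b, v} \<subseteq> C" "{q, v} \<subseteq> C" unfolding Ceq by blast+
    have dj: "{b, v} \<inter> {q, a} = {}" "{a, v} \<inter> {q, b} = {}" "{a, b} \<inter> {q, v} = {}" using d' by simp_all
    have "N = {q, a} \<Longrightarrow> flex F w {q, a}" "N = {b, v} \<Longrightarrow> flex F w {q, a}"
      by (rule fC[OF sub(1) C4[OF c2]], simp add: dj)+
    moreover have "N = {q, b} \<Longrightarrow> flex F w {q, b}" "N = {a, v} \<Longrightarrow> flex F w {q, b}"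
      by (rule fC[OF sub(2) C4[OF c2]], simp add: dj)+
    moreover have "N = {q, v} \<Longrightarrow> flex F w {q, v, a}" by (rule fC[OF sub(3) C4[OF c3]], simp)
    moreover have "N = {a, b} \<Longrightarrow> flex F w {a, b, v}" by (rule fC[OF sub(4) C4[OF c3]], simp)
    moreover have "N = {a, b} \<Longrightarrow> flex F w {q, v}" by (rule fC[OF sub(5) C4[OF c2]], simp add: dj)
    ultimately show False using qa qb qva abv by blast
  qed
qed

text \<open>For \<open>5 \<le> k\<close> all nice edges are star edges. For \<open>k = 4\<close>,
  edges with two blocked vertices have two facets of small degree and weigh about
  \<open>2 * m\<close> instead of \<open>3 * m\<close>. Together with the star edges they are
  counted by facets that determine them, so a large degree square sum allows only
  \<open>O(n ^ (k - 2))\<close> of them.\<close>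

lemma few_non_star_edges:
  assumes tf: "linear_triangle_free F" and k4: "4 \<le> k"
    and co: "(card V - 1 choose (k - 1)) * (1 + (card V - k + 1) * (k - 1)) \<le> (\<Sum>Y\<in>nsets V (k - 1). (degree F Y)\<^sup>2)"
    and large: "4 * k \<le> card V" and K: "K = (2 ^ k * (2 * k))\<^sup>2"
  shows "card (F - star_edges (2 * k)) \<le> (6 + 11 * K) * card V ^ (k - 2)"
proof -
  define w where "w = 2 * k"
  have w: "2 * k \<le> w" and k3: "3 \<le> k" using k4 by (auto simp: w_def)
  define n where "n = card V"
  define S0 where "S0 = star_edges w"
  define B0 where "B0 = {A \<in> F. \<not> nice k F w A}"
  define T0 where "T0 = {A \<in> F. nice k F w A \<and> card (blocked F w A) = 2}"
  have cB: "card B0 \<le> K * n ^ (k - 2)" using card_not_nice[of w] unfolding B0_def K w_def n_def by simp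
  have types: "card (blocked F w A) = 1 \<or> k = 4 \<and> card (blocked F w A) = 2" if "A \<in> F" "nice k F w A" for A
    using blocked_triangle[OF tf w that k4] .
  have FS: "F - S0 \<subseteq> B0 \<union> (if k = 4 then T0 else {})"
    using types unfolding S0_def star_edges_def B0_def T0_def by auto
  have fin: "finite S0" "finite T0" "finite B0"
    using finite_F unfolding S0_def star_edges_def B0_def T0_def by auto
  show ?thesis
  proof (cases "k = 4")
    case False
    then have "card (F - S0) \<le> card B0" using FS fin by (intro card_mono) auto
    also have "\<dots> \<le> (6 + 11 * K) * n ^ (k - 2)" using cB by (rule order_trans) simp
    finally show ?thesis by (simp add: S0_def n_def w_def)
  next
    case True
    define Ni where "Ni = S0 \<union> T0"
    define m where "m = n - k + 1"
    define D where "D = 1 + (k - 1) * m"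
    have SF: "S0 \<subseteq> F" "T0 \<subseteq> F" "B0 \<subseteq> F" unfolding S0_def star_edges_def T0_def B0_def by auto
    have nic: "nice k F w A" if "A \<in> Ni" for A using that unfolding Ni_def S0_def star_edges_def T0_def by auto
    have NiF: "A \<in> F" if "A \<in> Ni" for A using that SF unfolding Ni_def by auto
    have dis: "S0 \<inter> T0 = {}" "Ni \<inter> B0 = {}" unfolding Ni_def S0_def star_edges_def T0_def B0_def by auto
    have Feq: "F = S0 \<union> T0 \<union> B0" using FS SF True unfolding Ni_def by auto
    have uniq: "E = A" if A: "A \<in> Ni" "x \<in> blocked F w A" and E: "E \<in> Ni" "A - {x} \<subseteq> E" for A x E
    proof (cases "A \<in> S0")
      case s: True
      then have "x = center w A" using star_edges(3)[of A w] A(2) unfolding S0_def by auto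
      then show ?thesis using star_edges_own_triangle[OF tf w k3, of A E] s E NiF unfolding S0_def by blast
    next
      case False
      then have "card (blocked F w A) = 2" using A unfolding Ni_def T0_def by blast
      then show ?thesis using type2_unique[OF tf w True NiF[OF A(1)] nic[OF A(1)] _ A(2) NiF[OF E(1)] nic[OF E(1)] E(2)] by blast
    qed
    have "card (S0 \<union> T0) \<le> (card V choose (k - 1))"
    proof (rule card_own_le)
      show "S0 \<union> T0 \<subseteq> F" using SF by blast
      have sb: "(SOME x. x \<in> blocked F w A) \<in> blocked F w A" if "A \<in> S0 \<union> T0" for A
      proof -
        have "card (blocked F w A) \<noteq> 0" using that unfolding S0_def star_edges_def T0_def by auto
        then have "blocked F w A \<noteq> {}" by (intro notI) simp
        then show ?thesis by (simp add: some_in_eq)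
      qed
      show "(SOME x. x \<in> blocked F w A) \<in> A" if "A \<in> S0 \<union> T0" for A
        using sb[OF that] by (simp add: blocked_def)
      show "E = A" if "A \<in> S0 \<union> T0" "E \<in> S0 \<union> T0" "A - {SOME x. x \<in> blocked F w A} \<subseteq> E" for A E
        using uniq[OF _ sb[OF that(1)], of E] that unfolding Ni_def by blast
    qed
    also have "(card V choose (k - 1)) = (n - 1 choose (k - 1)) + (n - 1 choose (k - 2))"
    proof -
      obtain l where "n = Suc l" using large k4 unfolding n_def by (cases "card V") auto
      then show ?thesis using True unfolding n_def[symmetric] by (simp add: numeral_eq_Suc)
    qed
    also have "\<dots> \<le> (n - 1 choose (k - 1)) + n ^ (k - 2)" using binomial_le_power by simp
    finally have ST: "card S0 + card T0 \<le> (n - 1 choose (k - 1)) + n ^ (k - 2)"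
      using card_Un_disjoint[OF fin(1,2) dis(1)] by simp
    \<comment> \<open>The facets opposite the blocked vertices are unshared only among nice edges;
      \<open>r A\<close> counts the other edges containing them.\<close>
    define r where "r A = (\<Sum>x\<in>blocked F w A. card {E \<in> B0. A - {x} \<subseteq> E})" for A
    have wT: "weight A \<le> 2 * m + 2 + r A" if A: "A \<in> T0" for A
    proof -
      have AF: "A \<in> F" and c2: "card (blocked F w A) = 2" using A by (auto simp: T0_def)
      note eA = edgeD[OF AF]
      have NA: "blocked F w A \<subseteq> A" by (auto simp: blocked_def)
      have fN: "finite (blocked F w A)" using NA eA finite_subset by blast
      have "(\<Sum>y\<in>A - blocked F w A. degree F (A - {y})) \<le> of_nat (card (A - blocked F w A)) * m"
        by (rule sum_bounded_above) (use degree_edge_le[OF AF] in \<open>auto simp: m_def n_def\<close>)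
      also have "\<dots> = 2 * m" using NA eA fN c2 True by (simp add: card_Diff_subset)
      finally have 1: "(\<Sum>y\<in>A - blocked F w A. degree F (A - {y})) \<le> 2 * m" .
      have "(\<Sum>y\<in>blocked F w A. degree F (A - {y})) \<le> (\<Sum>y\<in>blocked F w A. 1 + card {E \<in> B0. A - {y} \<subseteq> E})"
      proof (rule sum_mono)
        fix y assume y: "y \<in> blocked F w A"
        have ANi: "A \<in> Ni" using A by (simp add: Ni_def)
        have "{E \<in> F. A - {y} \<subseteq> E} \<subseteq> insert A {E \<in> B0. A - {y} \<subseteq> E}"
          using uniq[OF ANi y] Feq unfolding Ni_def by blast
        then have "degree F (A - {y}) \<le> card (insert A {E \<in> B0. A - {y} \<subseteq> E})"
          unfolding degree_def using fin by (intro card_mono) auto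
        also have "\<dots> \<le> 1 + card {E \<in> B0. A - {y} \<subseteq> E}" using fin by (simp add: card_insert_if)
        finally show "degree F (A - {y}) \<le> 1 + card {E \<in> B0. A - {y} \<subseteq> E}" .
      qed
      also have "\<dots> = 2 + r A" unfolding r_def sum.distrib using c2 by simp
      finally have "(\<Sum>y\<in>blocked F w A. degree F (A - {y})) \<le> 2 + r A" .
      then show ?thesis using 1 sum.subset_diff[OF NA eA(2), of "\<lambda>y. degree F (A - {y})"] unfolding weight_def by linarith
    qed
    have rT: "(\<Sum>A\<in>T0. r A) \<le> 16 * card B0"
    proof -
      have fP: "finite (Pow E)" "card (Pow E) = 2 ^ k" if "E \<in> B0" for E
        using edgeD(2,3)[of E] SF(3) that by (auto simp: card_Pow)
      let ?I = "SIGMA A:T0. SIGMA x:blocked F w A. {E \<in> B0. A - {x} \<subseteq> E}"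
      \<comment> \<open>By \<open>uniq\<close> such a facet determines \<open>A\<close>, and an edge
        \<open>E\<close> has only \<open>2 ^ k = 16\<close> subsets.\<close>
      let ?h = "\<lambda>(A, x, E). (E, A - {x})"
      have fb: "finite (blocked F w A)" if "A \<in> T0" for A
        using that unfolding T0_def by (auto intro: card_ge_0_finite)
      have "(\<Sum>A\<in>T0. r A) = card ?I"
        using fin fb by (subst card_SigmaI) (auto simp: r_def card_SigmaI)
      also have "\<dots> \<le> card (SIGMA E:B0. Pow E)"
      proof (rule card_inj_on_le)
        show "inj_on ?h ?I"
        proof (rule inj_onI)
          fix s t assume st: "s \<in> ?I" "t \<in> ?I" "?h s = ?h t"
          obtain A x E where s: "s = (A, x, E)" by (metis prod.collapse)
          obtain A' x' E' where t: "t = (A', x', E')" by (metis prod.collapse)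
          have eq: "E = E'" "A - {x} = A' - {x'}" using st(3) s t by auto
          have x: "A \<in> T0" "x \<in> blocked F w A" "A' \<in> T0" "x' \<in> blocked F w A'" using st s t by auto
          have "A - {x} \<subseteq> A'" using eq(2) by blast
          then have AA: "A' = A" using uniq[of A x A'] x unfolding Ni_def by blast
          have "x \<in> A" "x' \<in> A" using x AA by (auto simp: blocked_def)
          then have "x = x'" using eq(2) AA by blast
          then show "s = t" using s t eq AA by simp
        qed
        show "?h ` ?I \<subseteq> (SIGMA E:B0. Pow E)" by auto
        show "finite (SIGMA E:B0. Pow E)" using fin(3) fP(1) by (rule finite_SigmaI)
      qed
      also have "\<dots> = (\<Sum>E\<in>B0. 2 ^ k)"
      proof (subst card_SigmaI)
        show "(\<Sum>E\<in>B0. card (Pow E)) = (\<Sum>E\<in>B0. 2 ^ k)"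
          by (rule sum.cong) (simp_all add: fP)
      qed (use fin fP in auto)
      also have "\<dots> = 16 * card B0" using True by simp
      finally show ?thesis .
    qed
    have wS: "weight A \<le> D" if "A \<in> S0" for A
      using weight_own(2)[OF star_edges(1) star_edges(4) star_edges_own_triangle[OF tf w k3]] that
      unfolding S0_def D_def m_def n_def by blast
    have "(\<Sum>A\<in>F. weight A) = (\<Sum>A\<in>S0. weight A) + (\<Sum>A\<in>T0. weight A) + (\<Sum>A\<in>B0. weight A)"
      unfolding Feq using fin dis by (simp add: sum.union_disjoint Ni_def)
    moreover have "(\<Sum>A\<in>S0. weight A) \<le> card S0 * D"
      using sum_bounded_above[of S0 weight D] wS by simp
    moreover have "(\<Sum>A\<in>T0. weight A) \<le> card T0 * (2 * m + 2) + 16 * card B0"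
    proof -
      have "(\<Sum>A\<in>T0. weight A) \<le> (\<Sum>A\<in>T0. 2 * m + 2 + r A)" using wT by (intro sum_mono)
      then show ?thesis using rT unfolding sum.distrib sum_constant of_nat_id distrib_left by linarith
    qed
    moreover have "(\<Sum>A\<in>B0. weight A) \<le> card B0 * (4 * m)"
      using sum_bounded_above[of B0 weight "4 * m"] weight_le SF(3) True unfolding m_def n_def by fastforce
    moreover have "(n - 1 choose (k - 1)) * D \<le> (\<Sum>A\<in>F. weight A)"
      using co unfolding sum_degree_sq D_def n_def m_def by (simp only: mult.commute[of "k - 1"])
    ultimately have key: "(n - 1 choose (k - 1)) * D
      \<le> card S0 * D + (card T0 * (2 * m + 2) + 16 * card B0) + card B0 * (4 * m)" by linarith
    have "card S0 * D + card T0 * D \<le> (n - 1 choose (k - 1)) * D + n ^ (k - 2) * D"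
      using mult_le_mono1[OF ST, of D] by (simp only: distrib_right)
    with key have "card T0 * D \<le> n ^ (k - 2) * D + card T0 * (2 * m + 2) + card B0 * (4 * m + 16)"
      unfolding distrib_left by linarith
    moreover have mn: "m = n - 3" "16 \<le> n" using True large unfolding m_def n_def by auto
    \<comment> \<open>The gap between the weights is
      \<open>D - (2 * m + 2) = m - 1 = n - 4 = l + 12\<close>.\<close>
    moreover obtain l where l: "n = l + 16" using mn(2) le_Suc_ex by (metis add.commute)
    ultimately have "card T0 * (l + 12) \<le> n ^ (k - 2) * D + card B0 * (4 * m + 16)"
      using True by (simp add: D_def algebra_simps)
    also have "\<dots> \<le> n ^ (k - 2) * (3 * n) + (K * n ^ (k - 2)) * (5 * n)"
      using cB mn l True by (intro add_mono mult_mono) (auto simp: D_def)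
    also have "\<dots> = (3 + 5 * K) * n ^ (k - 2) * n" by (simp add: algebra_simps)
    finally have "card T0 * (l + 12) \<le> (3 + 5 * K) * n ^ (k - 2) * n" .
    moreover have "card T0 * n \<le> card T0 * (2 * (l + 12))" using l by (intro mult_le_mono2) simp
    ultimately have "card T0 * n \<le> (6 + 10 * K) * n ^ (k - 2) * n" by (simp add: algebra_simps)
    then have cT: "card T0 \<le> (6 + 10 * K) * n ^ (k - 2)" using mn(2) by simp
    have "card (F - S0) \<le> card (B0 \<union> T0)" using FS fin True by (intro card_mono) auto
    also have "\<dots> \<le> card B0 + card T0" by (rule card_Un_le)
    also have "\<dots> \<le> (6 + 11 * K) * n ^ (k - 2)" using cB cT by (simp add: algebra_simps)
    finally show ?thesis by (simp add: S0_def n_def w_def)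
  qed
qed

lemma linear_triangle_free_card_le:
  assumes tf: "linear_triangle_free F" and k4: "4 \<le> k"
    and co: "(card V - 1 choose (k - 1)) * (1 + (card V - k + 1) * (k - 1)) \<le> (\<Sum>Y\<in>nsets V (k - 1). (degree F Y)\<^sup>2)"
    and K: "K = 6 + 11 * (2 ^ k * (2 * k))\<^sup>2" and q: "q = 2 * k ^ k * (2 * K + 1)"
    and large: "4 * k \<le> card V" "2 * k ^ k * K \<le> card V" "32 * k ^ 2 * 2 ^ q \<le> card V"
  shows "card F \<le> (card V - 1 choose (k - 1))"
  using triangle_free_dominated_card_le[OF tf k4 co _ q large] few_non_star_edges[OF tf k4 co large(1) refl] K by simp

end

section \<open>Linear triangles for triples\<close>

text \<open>The numbers count further extensions of the three facets of a triple. The premises deny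
  that a greedy choice of distinct extensions succeeds in some order; what remains is a zero, two
  ones, or all at most two, with equality at two ones in the limit and at three twos.\<close>

lemma sum_inverse_Suc_ge_one:
  fixes p q r :: nat
  assumes "\<not> (1 \<le> p \<and> 2 \<le> q \<and> 3 \<le> r)" "\<not> (1 \<le> p \<and> 2 \<le> r \<and> 3 \<le> q)" "\<not> (1 \<le> q \<and> 2 \<le> p \<and> 3 \<le> r)"
    "\<not> (1 \<le> q \<and> 2 \<le> r \<and> 3 \<le> p)" "\<not> (1 \<le> r \<and> 2 \<le> p \<and> 3 \<le> q)" "\<not> (1 \<le> r \<and> 2 \<le> q \<and> 3 \<le> p)"
  shows "1 \<le> inverse (real (Suc p)) + inverse (real (Suc q)) + inverse (real (Suc r))"
proof -
  have nn: "0 \<le> inverse (real (Suc x))" for x by simp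
  have le: "inverse (real (Suc y)) \<le> inverse (real (Suc x))" if "x \<le> y" for x y using that by simp
  have 1: "3 \<le> p \<Longrightarrow> q = 0 \<or> r = 0 \<or> q = 1 \<and> r = 1" using assms(4,6) by linarith
  have 2: "3 \<le> q \<Longrightarrow> p = 0 \<or> r = 0 \<or> p = 1 \<and> r = 1" using assms(2,5) by linarith
  have 3: "3 \<le> r \<Longrightarrow> p = 0 \<or> q = 0 \<or> p = 1 \<and> q = 1" using assms(1,3) by linarith
  consider "p = 0" | "q = 0" | "r = 0" | "p = 1 \<and> q = 1" | "p = 1 \<and> r = 1" | "q = 1 \<and> r = 1"
    | "p \<le> 2 \<and> q \<le> 2 \<and> r \<le> 2"
  proof -
    have "\<not> 3 \<le> x \<Longrightarrow> x \<le> 2" for x :: nat by linarith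
    then show ?thesis using 1 2 3 that by metis
  qed
  then show ?thesis
  proof cases
    case 7
    show ?thesis using le[of p 2] le[of q 2] le[of r 2] 7 by simp
  qed (use nn[of p] nn[of q] nn[of r] in simp_all)
qed

context uniform_hypergraph
begin

lemma degree_le_of_not_flex:
  assumes "Y \<in> nsets V (k - 1)" "\<not> flex F w Y"
  shows "degree F Y \<le> w"
proof -
  note wn = wit_not_flex[OF assms(2)]
  have "{v \<in> V - Y. insert v Y \<in> F} \<subseteq> wit F w Y"
  proof
    fix v assume v: "v \<in> {v \<in> V - Y. insert v Y \<in> F}"
    then have "\<not> insert v Y \<inter> wit F w Y \<subseteq> Y" using wn by blast
    then show "v \<in> wit F w Y" by blast
  qed
  then have "degree F Y \<le> card (wit F w Y)" unfolding degree_eq[OF assms(1)] using wn by (intro card_mono) auto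
  then show ?thesis using wn by linarith
qed

text \<open>Every \<open>(k - 1)\<close>-set of positive degree distributes the amount one equally
  among its edges, and every edge receives at least one in total.\<close>

lemma card_le_of_inverse_degrees:
  assumes "\<And>A. A \<in> F \<Longrightarrow> 1 \<le> (\<Sum>y\<in>A. inverse (real (degree F (A - {y}))))"
  shows "card F \<le> (card V choose (k - 1))"
proof -
  have "real (card F) = (\<Sum>A\<in>F. 1)" by simp
  also have "\<dots> \<le> (\<Sum>A\<in>F. \<Sum>y\<in>A. inverse (real (degree F (A - {y}))))" using assms by (rule sum_mono)
  also have "\<dots> = (\<Sum>Y\<in>nsets V (k - 1). of_nat (degree F Y) * inverse (real (degree F Y)))"
    by (rule sum_degree_mult[symmetric])
  also have "\<dots> \<le> (\<Sum>Y\<in>nsets V (k - 1). 1)" by (rule sum_mono) (simp add: field_simps)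
  also have "\<dots> = real (card V choose (k - 1))" using finite_V by (simp add: card_nsets)
  finally show ?thesis by simp
qed

lemma distinct_extensions_triangle:
  assumes tf: "linear_triangle_free F" and A: "{x, y, z} \<in> F" "x \<noteq> y" "y \<noteq> z" "x \<noteq> z" and k: "k = 3"
    and d: "1 \<le> card {v \<in> V - {x, y, z}. insert v {y, z} \<in> F}" "2 \<le> card {v \<in> V - {x, y, z}. insert v {x, z} \<in> F}"
      "3 \<le> card {v \<in> V - {x, y, z}. insert v {x, y} \<in> F}"
  shows False
proof -
  have pick: "\<exists>v. v \<in> V - {x, y, z} \<and> v \<notin> U \<and> insert v Y \<in> F"
    if "card U < card {v \<in> V - {x, y, z}. insert v Y \<in> F}" "finite U" for U Y
  proof (rule ccontr)
    assume "\<not> ?thesis"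
    then have "{v \<in> V - {x, y, z}. insert v Y \<in> F} \<subseteq> U" by blast
    then show False using card_mono[OF that(2)] that(1) by (meson not_less)
  qed
  obtain u where u: "u \<in> V - {x, y, z}" "insert u {y, z} \<in> F" using pick[of "{}" "{y, z}"] d(1) by auto
  obtain v where v: "v \<in> V - {x, y, z}" "v \<noteq> u" "insert v {x, z} \<in> F" using pick[of "{u}" "{x, z}"] d(2) by auto
  have "card {u, v} < 3" by (simp add: card_insert_if)
  then obtain t where t: "t \<in> V - {x, y, z}" "t \<notin> {u, v}" "insert t {x, y} \<in> F"
    using pick[of "{u, v}" "{x, y}"] d(3) by auto
  define E1 where "E1 = insert u {y, z}"
  define E2 where "E2 = insert v {x, z}"
  define E3 where "E3 = insert t {x, y}"
  have i: "E1 \<inter> E2 = {z}" "E2 \<inter> E3 = {x}" "E3 \<inter> E1 = {y}"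
    unfolding E1_def E2_def E3_def using u v t A(2-4) by auto
  have "E1 \<inter> E2 \<inter> E3 = {}" unfolding i(1) E3_def using t A(2-4) by auto
  moreover have "E1 \<in> F" "E2 \<in> F" "E3 \<in> F" using u v t by (simp_all add: E1_def E2_def E3_def)
  ultimately show False using linear_triangle_freeD[OF tf, of E1 E2 E3] i by simp
qed

text \<open>A preliminary bound that exceeds the target by \<open>card V - 1\<close>. It limits the
  edges without a flexible centre and those missing the dominant centre.\<close>

lemma card_le_choose_two:
  assumes tf: "linear_triangle_free F" and k: "k = 3"
  shows "card F \<le> (card V choose (k - 1))"
proof (rule card_le_of_inverse_degrees)
  fix A assume A: "A \<in> F"
  have "card A = 3" using edgeD[OF A] k by simp
  then obtain x y z where xyz: "A = {x, y, z}" "x \<noteq> y" "y \<noteq> z" "x \<noteq> z" by (meson card_3_iff)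
  define f where "f Y = card {v \<in> V - A. insert v Y \<in> F}" for Y
  have m: "A - {x} = {y, z}" "A - {y} = {x, z}" "A - {z} = {x, y}" using xyz by auto
  have d: "degree F {y, z} = Suc (f {y, z})" "degree F {x, z} = Suc (f {x, z})" "degree F {x, y} = Suc (f {x, y})"
    using degree_edge[OF A, of x] degree_edge[OF A, of y] degree_edge[OF A, of z] m xyz(1) unfolding f_def by auto
  have no: "\<not> (1 \<le> f {b, c} \<and> 2 \<le> f {a, c} \<and> 3 \<le> f {a, b})" if "A = {a, b, c}" "a \<noteq> b" "b \<noteq> c" "a \<noteq> c" for a b c
    using distinct_extensions_triangle[OF tf _ that(2-4) k] A that(1) unfolding f_def by blast
  have "1 \<le> inverse (real (Suc (f {y, z}))) + inverse (real (Suc (f {x, z}))) + inverse (real (Suc (f {x, y})))"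
  proof (rule sum_inverse_Suc_ge_one)
    show "\<not> (1 \<le> f {y, z} \<and> 2 \<le> f {x, z} \<and> 3 \<le> f {x, y})" using no[of x y z] xyz by simp
    show "\<not> (1 \<le> f {y, z} \<and> 2 \<le> f {x, y} \<and> 3 \<le> f {x, z})" using no[of x z y] xyz by (simp add: insert_commute)
    show "\<not> (1 \<le> f {x, z} \<and> 2 \<le> f {y, z} \<and> 3 \<le> f {x, y})" using no[of y x z] xyz by (simp add: insert_commute)
    show "\<not> (1 \<le> f {x, z} \<and> 2 \<le> f {x, y} \<and> 3 \<le> f {y, z})" using no[of y z x] xyz by (simp add: insert_commute)
    show "\<not> (1 \<le> f {x, y} \<and> 2 \<le> f {y, z} \<and> 3 \<le> f {x, z})" using no[of z x y] xyz by (simp add: insert_commute)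
    show "\<not> (1 \<le> f {x, y} \<and> 2 \<le> f {x, z} \<and> 3 \<le> f {y, z})" using no[of z y x] xyz by (simp add: insert_commute)
  qed
  moreover have "(\<Sum>y\<in>A. inverse (real (degree F (A - {y})))) =
      inverse (real (degree F (A - {x}))) + inverse (real (degree F (A - {y}))) + inverse (real (degree F (A - {z})))"
    unfolding xyz(1) using xyz(2-4) by simp
  ultimately show "1 \<le> (\<Sum>y\<in>A. inverse (real (degree F (A - {y}))))" unfolding m d by simp
qed

text \<open>The analysis of blocked vertices starts at \<open>4 \<le> k\<close>. For triples the
  flexible pairs at the centre are demanded outright, and edges lacking them are controlled by their
  weight.\<close>

definition flex_star :: "nat \<Rightarrow> 'a set \<Rightarrow> 'a \<Rightarrow> bool" where
  "flex_star w A c \<longleftrightarrow> c \<in> A \<and> (\<forall>a\<in>A - {c}. flex F w {c, a})"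

lemma flex_star_own:
  assumes "linear_triangle_free F" "2 * k \<le> w" "3 \<le> k" "A \<in> F" "flex_star w A c" "E \<in> F" "A - {c} \<subseteq> E"
  shows "E = A"
proof (cases "c \<in> E")
  case False
  have c: "c \<in> A" using assms(5) by (simp add: flex_star_def)
  obtain a b where "a \<in> A - {c}" "b \<in> A - {c}" "a \<noteq> b" using two_points_minus[OF assms(4,3) c] .
  then show ?thesis
    using triangle_edge_of_flex_center[OF assms(1,2), of c a b E] assms False unfolding flex_star_def by blast
qed (use edge_eq_of_superset[OF assms(4,6,7)] in simp)

text \<open>At most one of the three pairs is flexible, for two of them would make their common
  vertex a centre. The others have degree at most \<open>w\<close>, every edge over them using a
  vertex of the witness set.\<close>

lemma weight_not_flex_star:
  assumes k: "k = 3" and A: "A \<in> F" "\<not> (\<exists>c. flex_star w A c)"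
  shows "weight A \<le> (card V - k + 1) + 2 * w"
proof -
  have "card A = 3" using edgeD[OF A(1)] k by simp
  then obtain x y z where xyz: "A = {x, y, z}" "x \<noteq> y" "y \<noteq> z" "x \<noteq> z" by (meson card_3_iff)
  have m: "A - {x} = {y, z}" "A - {y} = {x, z}" "A - {z} = {x, y}" using xyz by auto
  have mem: "x \<in> A" "y \<in> A" "z \<in> A" using xyz by auto
  have wt: "weight A = degree F {y, z} + degree F {x, z} + degree F {x, y}"
    unfolding weight_def using m xyz by simp
  have le: "degree F {y, z} \<le> card V - k + 1" "degree F {x, z} \<le> card V - k + 1" "degree F {x, y} \<le> card V - k + 1"
    using degree_edge_le[OF A(1) mem(1)] degree_edge_le[OF A(1) mem(2)] degree_edge_le[OF A(1) mem(3)] m by simp_all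
  have lw: "\<not> flex F w {y, z} \<Longrightarrow> degree F {y, z} \<le> w" "\<not> flex F w {x, z} \<Longrightarrow> degree F {x, z} \<le> w"
    "\<not> flex F w {x, y} \<Longrightarrow> degree F {x, y} \<le> w"
    using degree_le_of_not_flex edge_minus[OF A(1) mem(1)] edge_minus[OF A(1) mem(2)] edge_minus[OF A(1) mem(3)] m by simp_all
  have "\<not> flex_star w A x" "\<not> flex_star w A y" "\<not> flex_star w A z" using A(2) by blast+
  then have "\<not> (flex F w {x, y} \<and> flex F w {x, z})" "\<not> (flex F w {x, y} \<and> flex F w {y, z})"
    "\<not> (flex F w {x, z} \<and> flex F w {y, z})"
    using m mem unfolding flex_star_def by (auto simp: insert_commute)
  then show ?thesis using wt le lw by linarith
qed

text \<open>Consider the \<open>3 * (card V - 4)\<close> triples made of \<open>c\<close>, a vertex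
  of \<open>C\<close> and one vertex elsewhere. Two edges among them over different vertices of
  \<open>C\<close> must have the same third vertex, or they close a triangle with \<open>C\<close>;
  this leaves at most \<open>card V - 4\<close> edges.\<close>

lemma many_missing_triples:
  assumes tf: "linear_triangle_free F" and k: "k = 3" and c: "c \<in> V" and C: "C \<in> F" "c \<notin> C" and n: "7 \<le> card V"
  shows "2 * card V - 8 \<le> card {A \<in> nsets V k. c \<in> A \<and> A \<notin> F}"
proof -
  note eC = edgeD[OF C(1)]
  define U where "U = V - insert c C"
  define L where "L a = {p \<in> U. {c, a, p} \<in> F}" for a
  have fU: "finite U" using finite_V by (simp add: U_def)
  have cU: "card U = card V - 4" using eC C(2) c k by (simp add: U_def card_Diff_subset)
  have fL: "finite (L a)" "card (L a) \<le> card V - 4" for a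
    using fU cU card_mono[of U "L a"] by (auto simp: L_def)
  have cross: "p1 = p2" if p: "a \<in> C" "b \<in> C" "a \<noteq> b" "p1 \<in> L a" "p2 \<in> L b" for a b p1 p2
  proof (rule ccontr)
    assume ne: "p1 \<noteq> p2"
    have u: "p1 \<notin> C" "p1 \<noteq> c" "p2 \<notin> C" "p2 \<noteq> c" using p(4,5) by (auto simp: L_def U_def)
    define E1 where "E1 = {c, a, p1}"
    define E2 where "E2 = {c, b, p2}"
    have ac: "a \<noteq> c" "b \<noteq> c" "a \<noteq> p2" "b \<noteq> p1" using p(1,2) C(2) u by auto
    have i: "E1 \<inter> E2 = {c}" "E2 \<inter> C = {b}" "C \<inter> E1 = {a}"
      unfolding E1_def E2_def using p(1-3) u ne ac C(2) by auto
    have "E1 \<inter> E2 \<inter> C = {}" unfolding i(1) using C(2) by blast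
    moreover have "E1 \<in> F" "E2 \<in> F" using p(4,5) by (auto simp: E1_def E2_def L_def)
    ultimately show False using linear_triangle_freeD[OF tf _ _ C(1), of E1 E2] i by simp
  qed
  have sumL: "(\<Sum>a\<in>C. card (L a)) \<le> card V - 4"
  proof (cases "\<exists>a\<in>C. 2 \<le> card (L a)")
    case True
    then obtain a where a: "a \<in> C" "2 \<le> card (L a)" by blast
    from two_points[OF a(2)] obtain p p' where pp: "p \<in> L a" "p' \<in> L a" "p \<noteq> p'" by blast
    have "card (L b) = 0" if b: "b \<in> C - {a}" for b
    proof -
      have "L b = {}"
      proof (rule ccontr)
        assume "L b \<noteq> {}"
        then obtain s where "s \<in> L b" by blast
        then show False using cross[of a b p s] cross[of a b p' s] a b pp by auto
      qed
      then show ?thesis by simp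
    qed
    then have "(\<Sum>a\<in>C. card (L a)) = card (L a)" using a eC by (simp add: sum.remove)
    then show ?thesis using fL(2)[of a] by simp
  next
    case False
    have "card (L a) \<le> 1" if "a \<in> C" for a
    proof -
      have "\<not> 2 \<le> card (L a)" using False that by blast
      then show ?thesis by linarith
    qed
    then have "(\<Sum>a\<in>C. card (L a)) \<le> of_nat (card C) * 1" by (intro sum_bounded_above)
    then show ?thesis using eC k n by simp
  qed
  let ?I = "SIGMA a:C. U - L a"
  have "card ?I \<le> card {A \<in> nsets V k. c \<in> A \<and> A \<notin> F}"
  proof (rule card_inj_on_le)
    show "inj_on (\<lambda>(a, p). {c, a, p}) ?I"
    proof (rule inj_onI)
      fix s t assume st: "s \<in> ?I" "t \<in> ?I" "(\<lambda>(a, p). {c, a, p}) s = (\<lambda>(a, p). {c, a, p}) t"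
      obtain a p where s: "s = (a, p)" by (metis prod.collapse)
      obtain a' p' where t: "t = (a', p')" by (metis prod.collapse)
      have eq: "{c, a, p} = {c, a', p'}" using st(3) s t by simp
      have m: "a \<in> C" "a' \<in> C" "p \<notin> C" "p' \<notin> C" "p \<noteq> c" "p' \<noteq> c" using st s t by (auto simp: U_def)
      have "{c, a, p} \<inter> C = {a}" "{c, a', p'} \<inter> C = {a'}" using m C(2) by auto
      then have "a = a'" using eq by auto
      moreover have "{c, a, p} - insert c C = {p}" "{c, a', p'} - insert c C = {p'}" using m C(2) by auto
      then have "p = p'" using eq by auto
      ultimately show "s = t" using s t by simp
    qed
    show "(\<lambda>(a, p). {c, a, p}) ` ?I \<subseteq> {A \<in> nsets V k. c \<in> A \<and> A \<notin> F}"
    proof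
      fix A assume "A \<in> (\<lambda>(a, p). {c, a, p}) ` ?I"
      then obtain a p where ap: "a \<in> C" "p \<in> U" "p \<notin> L a" "A = {c, a, p}" by auto
      then have "a \<noteq> c" "p \<noteq> c" "a \<noteq> p" "a \<in> V" "p \<in> V" using C(2) eC by (auto simp: U_def)
      moreover have "A \<notin> F" using ap by (auto simp: L_def)
      ultimately show "A \<in> {A \<in> nsets V k. c \<in> A \<and> A \<notin> F}" using ap c k by (auto simp: nsets_def)
    qed
    show "finite {A \<in> nsets V k. c \<in> A \<and> A \<notin> F}"
      by (rule finite_subset[OF _ finite_imp_finite_nsets[OF finite_V, of k]]) blast
  qed
  moreover have "card ?I + (\<Sum>a\<in>C. card (L a)) = 3 * (card V - 4)"
  proof -
    have "card (U - L a) + card (L a) = card V - 4" for a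
      using cU card_Diff_subset[OF fL(1), of a U] card_mono[OF fU, of "L a"] by (auto simp: L_def)
    then have "(\<Sum>a\<in>C. card (U - L a) + card (L a)) = 3 * (card V - 4)" using eC k by simp
    moreover have "card ?I = (\<Sum>a\<in>C. card (U - L a))" using eC fU by (simp add: card_SigmaI)
    ultimately show ?thesis by (simp add: sum.distrib)
  qed
  ultimately show ?thesis using sumL by linarith
qed

text \<open>Edges missing the centre and missing star edges both have linear order here, so their
  weights are compared. An edge avoiding the centre weighs about \<open>n\<close> and replaces star
  edges of weight up to \<open>2 * n\<close>; a large degree square sum therefore implies that no
  edge avoids the centre.\<close>

lemma triangle_free_triples:
  assumes tf: "linear_triangle_free F" and k: "k = 3"
    and co: "(card V - 1 choose (k - 1)) * (1 + (card V - k + 1) * (k - 1)) \<le> (\<Sum>Y\<in>nsets V (k - 1). (degree F Y)\<^sup>2)"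
    and q: "q = 2 * k ^ k * (2 * 4 + 1)"
    and large: "6 * q + 300 + 3 * 2 ^ q \<le> card V"
  shows "card F \<le> (card V - 1 choose (k - 1))"
proof -
  define n where "n = card V"
  define N where "N = (n - 1 choose (k - 1))"
  define D where "D = 1 + (n - k + 1) * (k - 1)"
  have n: "6 * q + 300 + 3 * 2 ^ q \<le> n" using large by (simp add: n_def)
  have D: "D = 2 * n - 3" using k n by (simp add: D_def)
  have w: "2 * k \<le> (6::nat)" and k3: "3 \<le> k" using k by auto
  define S where "S = {A \<in> F. \<exists>c. flex_star 6 A c}"
  define ctr where "ctr A = (SOME c. flex_star 6 A c)" for A
  have SF: "S \<subseteq> F" by (auto simp: S_def)
  have ctr: "flex_star 6 A (ctr A)" if "A \<in> S" for A using that unfolding S_def ctr_def by (auto intro: someI)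
  have own: "E = A" if "A \<in> S" "E \<in> F" "A - {ctr A} \<subseteq> E" for A E
    using flex_star_own[OF tf w k3 _ ctr[OF that(1)] that(2,3)] that(1) SF by blast
  have ND: "N * D \<le> (\<Sum>A\<in>F. weight A)" using co unfolding sum_degree_sq N_def D_def n_def .
  have e: "card F \<le> N + (n - 1)"
  proof -
    obtain l where "n = Suc l" using n by (cases n) auto
    then show ?thesis using card_le_choose_two[OF tf k] k unfolding n_def[symmetric] N_def by (simp add: numeral_2_eq_2)
  qed
  have few: "card (F - S) \<le> 4 * card V ^ (k - 2)"
  proof -
    define B where "B = F - S"
    have fin: "finite S" "finite B" using SF finite_F finite_subset by (auto simp: B_def)
    have "(\<Sum>A\<in>F. weight A) = (\<Sum>A\<in>B. weight A) + (\<Sum>A\<in>S. weight A)"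
      unfolding B_def using sum.subset_diff[OF SF finite_F] .
    moreover have "(\<Sum>A\<in>S. weight A) \<le> of_nat (card S) * D"
    proof (rule sum_bounded_above)
      fix A assume A: "A \<in> S"
      have "ctr A \<in> A" using ctr[OF A] by (simp add: flex_star_def)
      then show "weight A \<le> D"
        using weight_own(2)[of A "ctr A"] own[OF A] A SF unfolding D_def n_def by (metis mult.commute subsetD)
    qed
    moreover have "(\<Sum>A\<in>B. weight A) \<le> of_nat (card B) * (n + 10)"
    proof (rule sum_bounded_above)
      fix A assume "A \<in> B"
      then have "weight A \<le> (card V - k + 1) + 2 * 6" by (intro weight_not_flex_star[OF k]) (auto simp: B_def S_def)
      then show "weight A \<le> n + 10" using k n by (simp add: n_def)
    qed
    moreover have cF: "card F = card B + card S"
      unfolding B_def using card_Diff_subset[OF fin(1) SF] card_mono[OF finite_F SF] by simp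
    ultimately have "N * D \<le> card B * (n + 10) + card S * D" using ND by simp
    moreover have "(card B + card S) * D \<le> (N + (n - 1)) * D" using e cF by (intro mult_le_mono1) simp
    ultimately have "card B * D \<le> (n - 1) * D + card B * (n + 10)" unfolding distrib_right by linarith
    \<comment> \<open>The gap in weight is \<open>D - (n + 10) = n - 13 = l + 13\<close>.\<close>
    moreover obtain l where l: "n = l + 26" using n le_Suc_ex[of 26 n] by (auto simp: add.commute)
    ultimately have "card B * (l + 13) \<le> (l + 25) * (2 * l + 49)" unfolding D l by (simp add: algebra_simps)
    also have "\<dots> \<le> (4 * n) * (l + 13)" unfolding l by (simp add: algebra_simps)
    finally have "card B \<le> 4 * n" by simp
    then show ?thesis using k by (simp add: B_def n_def)
  qed
  have "\<exists>A\<in>S. card {v \<in> V - {ctr A}. \<not> flex F 6 {ctr A, v}} \<le> q"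
  proof (rule dominant_center[of S ctr "\<lambda>c v. flex F 6 {c, v}" 4])
    show "S \<subseteq> F" by fact
    show "ctr A \<in> A" if "A \<in> S" for A using ctr[OF that] by (simp add: flex_star_def)
    show "E = A" if "A \<in> S" "E \<in> F" "A - {ctr A} \<subseteq> E" for A E by (rule own[OF that])
    show "flex F 6 {ctr A, a}" if "A \<in> S" "a \<in> A - {ctr A}" for A a using ctr[OF that(1)] that(2) by (simp add: flex_star_def)
    show "2 * k \<le> card V" using n k by (simp add: n_def)
    show "2 * k ^ k * 4 \<le> card V" using n k unfolding n_def by simp
    fix A assume "A \<in> S" "card {v \<in> V - {ctr A}. \<not> flex F 6 {ctr A, v}} \<le> 2 * k ^ k * (2 * 4 + 1)"
    then show "\<exists>A\<in>S. card {v \<in> V - {ctr A}. \<not> flex F 6 {ctr A, v}} \<le> q" unfolding q by blast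
  qed (rule few co k3)+
  then obtain A0 where A0: "A0 \<in> S" "card {v \<in> V - {ctr A0}. \<not> flex F 6 {ctr A0, v}} \<le> q" by blast
  define c where "c = ctr A0"
  define X where "X = {v \<in> V - {c}. \<not> flex F 6 {c, v}}"
  have X: "finite X" "card X \<le> q" using A0(2) finite_V by (auto simp: X_def c_def)
  have "c \<in> A0" "A0 \<in> F" using ctr[OF A0(1)] A0(1) SF by (auto simp: c_def flex_star_def)
  then have cV: "c \<in> V" using edgeD(1) by blast
  have one: "card (C - X) \<le> 1" if C: "C \<in> F" "c \<notin> C" for C
  proof (rule ccontr)
    assume "\<not> card (C - X) \<le> 1"
    then have "2 \<le> card (C - X)" by simp
    from two_points[OF this] obtain a b where ab: "a \<in> C - X" "b \<in> C - X" "a \<noteq> b" by blast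
    then have "flex F 6 {c, a}" "flex F 6 {c, b}" using edgeD(1)[OF C(1)] C(2) unfolding X_def by blast+
    then show False using triangle_edge_of_flex_center[OF tf w _ _ _ C, of a b] ab by blast
  qed
  define Q where "Q = {C \<in> F. c \<notin> C}"
  define P where "P = {A \<in> F. c \<in> A}"
  define M where "M = card {A \<in> nsets V k. c \<in> A \<and> A \<notin> F}"
  note bal = card_star_balance[OF cV, folded Q_def P_def M_def]
  show ?thesis
  proof (cases "Q = {}")
    case True
    have "card Q = 0" unfolding True by simp
    then show ?thesis using bal(1) by linarith
  next
    case False
    then obtain C0 where C0: "C0 \<in> F" "c \<notin> C0" by (auto simp: Q_def)
    have M: "2 * n - 8 \<le> M" unfolding M_def n_def by (rule many_missing_triples[OF tf k cV C0]) (use n in \<open>simp add: n_def\<close>)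
    have Q: "card Q \<le> M + (n - 1)" using bal(1) e unfolding N_def n_def by linarith
    have fin: "finite Q" "finite P" using finite_F by (auto simp: Q_def P_def)
    have wP: "(\<Sum>A\<in>P. weight A) \<le> card P * D + 8 * card Q"
    proof -
      have "weight A \<le> D + card {E \<in> Q. A - {c} \<subseteq> E}" if A: "A \<in> P" for A
      proof -
        have AF: "A \<in> F" "c \<in> A" using A by (auto simp: P_def)
        note eA = edgeD[OF AF(1)]
        have "(\<Sum>y\<in>A - {c}. degree F (A - {y})) \<le> of_nat (card (A - {c})) * (n - k + 1)"
          by (rule sum_bounded_above) (use degree_edge_le[OF AF(1)] in \<open>auto simp: n_def\<close>)
        moreover have "card (A - {c}) = k - 1" using eA AF(2) by simp
        moreover have "{E \<in> F. A - {c} \<subseteq> E} \<subseteq> insert A {E \<in> Q. A - {c} \<subseteq> E}"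
          using edge_eq_of_superset[OF AF(1)] by (auto simp: Q_def)
        then have "degree F (A - {c}) \<le> card (insert A {E \<in> Q. A - {c} \<subseteq> E})"
          unfolding degree_def using fin by (intro card_mono) auto
        moreover have "card (insert A {E \<in> Q. A - {c} \<subseteq> E}) \<le> 1 + card {E \<in> Q. A - {c} \<subseteq> E}"
          using fin by (simp add: card_insert_if)
        moreover have "weight A = degree F (A - {c}) + (\<Sum>y\<in>A - {c}. degree F (A - {y}))"
          unfolding weight_def using eA AF(2) by (simp add: sum.remove)
        ultimately show ?thesis unfolding D_def by (simp add: mult.commute)
      qed
      then have "(\<Sum>A\<in>P. weight A) \<le> (\<Sum>A\<in>P. D + card {E \<in> Q. A - {c} \<subseteq> E})" by (rule sum_mono)
      also have "\<dots> = card P * D + (\<Sum>A\<in>P. card {E \<in> Q. A - {c} \<subseteq> E})" by (simp add: sum.distrib)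
      also have "(\<Sum>A\<in>P. card {E \<in> Q. A - {c} \<subseteq> E}) \<le> 8 * card Q"
      proof -
        have fP: "finite (Pow E)" "card (Pow E) = 8" if "E \<in> Q" for E
          using edgeD(2,3)[of E] that k by (auto simp: card_Pow Q_def)
        have "(\<Sum>A\<in>P. card {E \<in> Q. A - {c} \<subseteq> E}) = card (SIGMA A:P. {E \<in> Q. A - {c} \<subseteq> E})"
          using fin by (simp add: card_SigmaI)
        also have "\<dots> \<le> card (SIGMA E:Q. Pow E)"
        proof (rule card_inj_on_le[of "\<lambda>(A, E). (E, A - {c})"])
          show "inj_on (\<lambda>(A, E). (E, A - {c})) (SIGMA A:P. {E \<in> Q. A - {c} \<subseteq> E})"
          proof (rule inj_onI)
            fix s t assume st: "s \<in> (SIGMA A:P. {E \<in> Q. A - {c} \<subseteq> E})" "t \<in> (SIGMA A:P. {E \<in> Q. A - {c} \<subseteq> E})"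
              "(\<lambda>(A, E). (E, A - {c})) s = (\<lambda>(A, E). (E, A - {c})) t"
            obtain A E where s: "s = (A, E)" by (metis prod.collapse)
            obtain A' E' where t: "t = (A', E')" by (metis prod.collapse)
            have "c \<in> A" "c \<in> A'" "A - {c} = A' - {c}" "E = E'" using st s t by (auto simp: P_def)
            then show "s = t" using s t by (metis insert_Diff)
          qed
          show "finite (SIGMA E:Q. Pow E)" using fin(1) fP(1) by (rule finite_SigmaI)
        qed auto
        also have "\<dots> = 8 * card Q" using fin fP by (subst card_SigmaI) auto
        finally show ?thesis .
      qed
      finally show ?thesis by simp
    qed
    \<comment> \<open>Edges inside \<open>X\<close> are bounded in number, so the trivial bound on
      their weight is enough.\<close>
    define Q1 where "Q1 = {C \<in> Q. C \<subseteq> X}"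
    have Q1: "card Q1 \<le> 2 ^ q"
    proof -
      have "card Q1 \<le> card (Pow X)" using X by (intro card_mono) (auto simp: Q1_def)
      also have "\<dots> = 2 ^ card X" using X by (simp add: card_Pow)
      also have "\<dots> \<le> 2 ^ q" using X(2) by (intro power_increasing) auto
      finally show ?thesis .
    qed
    have wQ1: "weight C \<le> 3 * n" if "C \<in> Q1" for C
    proof -
      have "weight C \<le> k * (card V - k + 1)" using weight_le that by (simp add: Q1_def Q_def)
      also have "\<dots> \<le> 3 * n" using k n by (intro mult_le_mono) (auto simp: n_def)
      finally show ?thesis .
    qed
    have wQ2: "weight C \<le> n + 2 * q + 2" if C: "C \<in> Q - Q1" for C
    proof -
      have CF: "C \<in> F" "c \<notin> C" "\<not> C \<subseteq> X" using C by (auto simp: Q1_def Q_def)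
      note eC = edgeD[OF CF(1)]
      obtain t where t: "t \<in> C" "t \<notin> X" using CF(3) by blast
      \<comment> \<open>An edge over \<open>C - {y}\<close> keeps \<open>t\<close>, which is outside
        \<open>X\<close>. Unless it contains \<open>c\<close>, its new vertex must lie in
        \<open>X\<close> by \<open>one\<close>.\<close>
      have dt: "degree F (C - {y}) \<le> q + 1" if y: "y \<in> C - {t}" for y
      proof -
        have Y: "C - {y} \<in> nsets V (k - 1)" using edge_minus[OF CF(1)] y by blast
        have "{v \<in> V - (C - {y}). insert v (C - {y}) \<in> F} \<subseteq> insert c X"
        proof
          fix v assume v: "v \<in> {v \<in> V - (C - {y}). insert v (C - {y}) \<in> F}"
          show "v \<in> insert c X"
          proof (rule ccontr)
            assume nv: "v \<notin> insert c X"
            define E where "E = insert v (C - {y})"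
            have E: "E \<in> F" "c \<notin> E" "finite E" using v nv CF(2) edgeD(2)[of E] by (auto simp: E_def)
            have "t \<noteq> v" using v t y by auto
            moreover have "{t, v} \<subseteq> E - X" using t y nv by (auto simp: E_def)
            ultimately have "2 \<le> card (E - X)" using card_mono[of "E - X" "{t, v}"] E(3) by simp
            then show False using one[OF E(1,2)] by simp
          qed
        qed
        then have "degree F (C - {y}) \<le> card (insert c X)" unfolding degree_eq[OF Y] using X by (intro card_mono) auto
        also have "\<dots> \<le> q + 1" using X by (simp add: card_insert_if)
        finally show ?thesis .
      qed
      have "(\<Sum>y\<in>C - {t}. degree F (C - {y})) \<le> of_nat (card (C - {t})) * (q + 1)" by (rule sum_bounded_above) (rule dt)
      moreover have "card (C - {t}) = 2" using eC t(1) k by simp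
      moreover have "degree F (C - {t}) \<le> n" using degree_edge_le[OF CF(1) t(1)] n k by (simp add: n_def)
      moreover have "weight C = degree F (C - {t}) + (\<Sum>y\<in>C - {t}. degree F (C - {y}))"
        unfolding weight_def using eC t(1) by (simp add: sum.remove)
      ultimately show ?thesis by simp
    qed
    have "(\<Sum>A\<in>Q. weight A) \<le> card Q * (n + 2 * q + 2) + 2 ^ q * (3 * n)"
    proof -
      have "(\<Sum>A\<in>Q. weight A) = (\<Sum>A\<in>Q - Q1. weight A) + (\<Sum>A\<in>Q1. weight A)"
        by (rule sum.subset_diff) (use fin in \<open>auto simp: Q1_def\<close>)
      moreover have "(\<Sum>A\<in>Q - Q1. weight A) \<le> of_nat (card (Q - Q1)) * (n + 2 * q + 2)" by (rule sum_bounded_above) (rule wQ2)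
      moreover have "(\<Sum>A\<in>Q1. weight A) \<le> of_nat (card Q1) * (3 * n)" by (rule sum_bounded_above) (rule wQ1)
      moreover have "card (Q - Q1) * (n + 2 * q + 2) \<le> card Q * (n + 2 * q + 2)"
        using fin by (intro mult_le_mono1 card_mono) auto
      moreover have "card Q1 * (3 * n) \<le> 2 ^ q * (3 * n)" using Q1 by (rule mult_le_mono1)
      ultimately show ?thesis unfolding of_nat_id by linarith
    qed
    moreover have "(\<Sum>A\<in>F. weight A) = (\<Sum>A\<in>P. weight A) + (\<Sum>A\<in>Q. weight A)"
    proof -
      have "F = P \<union> Q" "P \<inter> Q = {}" by (auto simp: P_def Q_def)
      then show ?thesis using fin by (simp add: sum.union_disjoint)
    qed
    ultimately have "N * D \<le> card P * D + 8 * card Q + (card Q * (n + 2 * q + 2) + 2 ^ q * (3 * n))"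
      using ND wP by linarith
    \<comment> \<open>The edges through the centre cancel; the \<open>M\<close> absent star edges
      are left against the edges missing the centre.\<close>
    moreover have "N * D = card P * D + M * D" using bal(2) unfolding N_def n_def by (metis distrib_right)
    ultimately have "M * D \<le> card Q * (n + 2 * q + 10) + 2 ^ q * (3 * n)" by (simp add: algebra_simps)
    also have "\<dots> \<le> (M + n) * (n + 2 * q + 10) + 2 ^ q * (3 * n)" using Q by (intro add_mono mult_le_mono1) auto
    finally have 1: "M * D \<le> (M + n) * (n + 2 * q + 10) + 2 ^ q * (3 * n)" .
    define T where "T = (2::nat) ^ q"
    obtain l where l: "n = l + 6 * q + 300 + 3 * T" using n le_Suc_ex unfolding T_def by (metis add.assoc add.commute)
    \<comment> \<open>\<open>g\<close> is \<open>D - (n + 2 * q + 10) = n - 2 * q - 13\<close>. With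
      \<open>M \<ge> 2 * n - 8\<close> the left side is about twice the square of \<open>n\<close>,
      the right side about one square, and \<open>large\<close> makes the difference strict.\<close>
    define g where "g = l + 4 * q + 287 + 3 * T"
    have "D = (n + 2 * q + 10) + g" unfolding D g_def l by simp
    then have "M * g \<le> n * (n + 2 * q + 10) + T * (3 * n)" using 1 unfolding T_def by (simp add: algebra_simps)
    also have "\<dots> = n * (n + 2 * q + 10 + 3 * T)" by (simp add: algebra_simps)
    finally have "M * g \<le> n * (n + 2 * q + 10 + 3 * T)" .
    moreover have "(2 * n - 8) * g \<le> M * g" using M by (rule mult_le_mono1)
    ultimately have "(2 * n - 8) * g \<le> n * (n + 2 * q + 10 + 3 * T)" by linarith
    moreover have "n * (n + 2 * q + 10 + 3 * T) < (2 * n - 8) * g"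
    proof -
      have "2 * n - 8 = 2 * l + 12 * q + 592 + 6 * T" unfolding l by simp
      then show ?thesis unfolding g_def l by (simp add: algebra_simps)
    qed
    ultimately show ?thesis by linarith
  qed
qed

end

section \<open>Linear paths and cycles for large vertex sets\<close>

lemma free_linear_triangle_free: "H \<in> free_hypergraphs n k (linear_cycles k 3) \<Longrightarrow> linear_triangle_free H"
  unfolding linear_triangle_free_def using free_no_linear_triangle by blast

lemma free_linear_path_free:
  assumes "H \<in> free_hypergraphs n k (linear_paths k 3)" "2 \<le> k"
  shows "linear_path_free H"
  unfolding linear_path_free_def using free_no_linear_path[OF assms] by blast

lemma eventually_exco2:
  assumes k: "3 \<le> k" and star: "\<And>n c. star_at n k c \<in> free_hypergraphs n k \<F>"
    and bound: "\<And>n H. n0 \<le> n \<Longrightarrow> uniform_hypergraph {1..n} k H \<Longrightarrow> H \<in> free_hypergraphs n k \<F> \<Longrightarrow>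
      (card {1..n} - 1 choose (k - 1)) * (1 + (card {1..n} - k + 1) * (k - 1))
        \<le> (\<Sum>Y\<in>nsets {1..n} (k - 1). (degree H Y)\<^sup>2) \<Longrightarrow>
      card H \<le> (card {1..n} - 1 choose (k - 1))"
  shows "\<forall>\<^sub>F n in sequentially.
      exco2 n k \<F> = (n - 1 choose (k - 1)) * (1 + (n - k + 1) * (k - 1)) \<and>
      (\<forall>H. extremal n k \<F> H \<longleftrightarrow> isomorphic_on n H (star n k))"
  unfolding eventually_sequentially
proof (intro exI allI impI)
  \<comment> \<open>The summand \<open>2 * k + 1\<close> excludes \<open>n = 2 * k\<close>, so
    complements of stars cannot occur as a second equality case.\<close>
  fix n assume n: "n0 + 2 * k + 1 \<le> n"
  have b: "card H \<le> (n - 1 choose (k - 1)) \<or> co2 n k H < star_co2 n k" if H: "H \<in> free_hypergraphs n k \<F>" for H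
  proof (cases "co2 n k H < star_co2 n k")
    case False
    have "uniform_hypergraph {1..n} k H" using H k by unfold_locales (auto simp: free_hypergraphs_def)
    from bound[OF _ this H] show ?thesis using False n by (simp add: star_co2_def co2_def)
  qed simp
  have kn: "k + 2 \<le> n" "n \<noteq> 2 * k" using n k by auto
  show "exco2 n k \<F> = (n - 1 choose (k - 1)) * (1 + (n - k + 1) * (k - 1)) \<and>
      (\<forall>H. extremal n k \<F> H \<longleftrightarrow> isomorphic_on n H (star n k))"
    using extremal_iff_star(1,3)[OF k kn(1) star b] kn(2) unfolding star_co2_def by blast
qed

lemma exco2_linear_paths:
  assumes "4 \<le> k"
  shows "\<forall>\<^sub>F n in sequentially.
      exco2 n k (linear_paths k 3) = (n - 1 choose (k - 1)) * (1 + (n - k + 1) * (k - 1)) \<and>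
      (\<forall>H. extremal n k (linear_paths k 3) H \<longleftrightarrow> isomorphic_on n H (star n k))"
proof -
  define K where "K = (2 ^ k * (2 * k))\<^sup>2"
  define q where "q = 2 * k ^ k * (2 * K + 1)"
  have k: "3 \<le> k" "2 \<le> k" using assms by auto
  show ?thesis
  proof (rule eventually_exco2[OF k(1) star_at_free_linear_paths])
    fix n H assume "4 * k + 2 * k ^ k * K + 32 * k ^ 2 * 2 ^ q \<le> n" "uniform_hypergraph {1..n} k H"
      "H \<in> free_hypergraphs n k (linear_paths k 3)"
      "(card {1..n} - 1 choose (k - 1)) * (1 + (card {1..n} - k + 1) * (k - 1))
        \<le> (\<Sum>Y\<in>nsets {1..n} (k - 1). (degree H Y)\<^sup>2)"
    then show "card H \<le> (card {1..n} - 1 choose (k - 1))"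
      by (intro uniform_hypergraph.path_free_card_le[OF _ free_linear_path_free assms _ K_def q_def]) (use k in auto)
  qed
qed

lemma exco2_linear_cycles:
  assumes "3 \<le> k"
  shows "\<forall>\<^sub>F n in sequentially.
      exco2 n k (linear_cycles k 3) = (n - 1 choose (k - 1)) * (1 + (n - k + 1) * (k - 1)) \<and>
      (\<forall>H. extremal n k (linear_cycles k 3) H \<longleftrightarrow> isomorphic_on n H (star n k))"
proof (cases "k = 3")
  case True
  define q where "q = 2 * k ^ k * (2 * 4 + 1)"
  show ?thesis
  proof (rule eventually_exco2[OF assms star_at_free_linear_cycles])
    fix n H assume "6 * q + 300 + 3 * 2 ^ q \<le> n" "uniform_hypergraph {1..n} k H"
      "H \<in> free_hypergraphs n k (linear_cycles k 3)"
      "(card {1..n} - 1 choose (k - 1)) * (1 + (card {1..n} - k + 1) * (k - 1))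
        \<le> (\<Sum>Y\<in>nsets {1..n} (k - 1). (degree H Y)\<^sup>2)"
    then show "card H \<le> (card {1..n} - 1 choose (k - 1))"
      by (intro uniform_hypergraph.triangle_free_triples[OF _ free_linear_triangle_free True _ q_def]) simp_all
  qed
next
  case False
  define K where "K = 6 + 11 * (2 ^ k * (2 * k))\<^sup>2"
  define q where "q = 2 * k ^ k * (2 * K + 1)"
  have k: "4 \<le> k" using assms False by simp
  show ?thesis
  proof (rule eventually_exco2[OF assms star_at_free_linear_cycles])
    fix n H assume "4 * k + 2 * k ^ k * K + 32 * k ^ 2 * 2 ^ q \<le> n" "uniform_hypergraph {1..n} k H"
      "H \<in> free_hypergraphs n k (linear_cycles k 3)"
      "(card {1..n} - 1 choose (k - 1)) * (1 + (card {1..n} - k + 1) * (k - 1))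
        \<le> (\<Sum>Y\<in>nsets {1..n} (k - 1). (degree H Y)\<^sup>2)"
    then show "card H \<le> (card {1..n} - 1 choose (k - 1))"
      by (intro uniform_hypergraph.linear_triangle_free_card_le[OF _ free_linear_triangle_free k _ K_def q_def]) auto
  qed
qed

theorem theorem1p5:
  "(\<forall>k\<ge>4. \<forall>\<^sub>F n in sequentially.
      exco2 n k (linear_paths k 3) = (n - 1 choose (k - 1)) * (1 + (n - k + 1) * (k - 1)) \<and>
      (\<forall>H. extremal n k (linear_paths k 3) H \<longleftrightarrow> isomorphic_on n H (star n k)))
   \<and>
   (\<forall>k\<ge>3. \<forall>\<^sub>F n in sequentially.
      exco2 n k (linear_cycles k 3) = (n - 1 choose (k - 1)) * (1 + (n - k + 1) * (k - 1)) \<and>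
      (\<forall>H. extremal n k (linear_cycles k 3) H \<longleftrightarrow> isomorphic_on n H (star n k)))
   \<and>
   (\<forall>k\<ge>3. \<forall>n\<ge>2 * k.
      exco2 n k (minimal_paths k 3) = (n - 1 choose (k - 1)) * (1 + (n - k + 1) * (k - 1)) \<and>
      extremal n k (minimal_paths k 3) (star n k) \<and>
      (n > 2 * k \<longrightarrow>
        (\<forall>H. extremal n k (minimal_paths k 3) H \<longleftrightarrow> isomorphic_on n H (star n k))))
   \<and>
   (\<forall>k\<ge>3. \<forall>n. real n \<ge> 3 * real k / 2 \<longrightarrow>
      exco2 n k (minimal_cycles k 3) = (n - 1 choose (k - 1)) * (1 + (n - k + 1) * (k - 1)) \<and>
      (\<forall>H. extremal n k (minimal_cycles k 3) H \<longleftrightarrow> isomorphic_on n H (star n k)))"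
proof (intro conjI allI impI)
  fix k n :: nat assume "3 \<le> k" "real n \<ge> 3 * real k / 2"
  then have kn: "3 \<le> k" "3 * k \<le> 2 * n" by linarith+
  show "exco2 n k (minimal_cycles k 3) = (n - 1 choose (k - 1)) * (1 + (n - k + 1) * (k - 1))"
    using exco2_minimal_cycles(1)[OF kn] by (simp only: star_co2_def)
  show "extremal n k (minimal_cycles k 3) H \<longleftrightarrow> isomorphic_on n H (star n k)" for H
    by (rule exco2_minimal_cycles(2)[OF kn])
next
  fix k n :: nat assume kn: "3 \<le> k" "2 * k \<le> n"
  show "exco2 n k (minimal_paths k 3) = (n - 1 choose (k - 1)) * (1 + (n - k + 1) * (k - 1))"
    using exco2_minimal_paths(1)[OF kn] by (simp only: star_co2_def)
  show "extremal n k (minimal_paths k 3) (star n k)" by (rule exco2_minimal_paths(2)[OF kn])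
  show "extremal n k (minimal_paths k 3) H \<longleftrightarrow> isomorphic_on n H (star n k)" if "2 * k < n" for H
    by (rule exco2_minimal_paths(3)[OF kn that])
qed (rule exco2_linear_paths exco2_linear_cycles; assumption)+

end
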